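(* Let $T$ be an isotropic spherical random field with harmonic coefficients $\{a_{\ell m}\}$ and angular power spectrum $\{C_\ell\}$. Let $H$ be a real-valued kernel depending only on the great-circle distance, with representation $$H(\gamma(\mathbf{x},\mathbf{x}'))=\sum_{\ell\in\mathbb{N}_0}h_\ell\sum_{m=-\ell}^{\ell}Y_{\ell m}(\mathbf{x})Y^*_{\ell m}(\mathbf{x}')=\sum_{\ell\in\mathbb{N}_0}\frac{2\ell+1}{4\pi}h_\ell P_\ell(\cos\gamma(\mathbf{x},\mathbf{x}')).$$ Then the convolutional random field $T_{\odot H}(\mathbf{x})=\int_{\mathbb{S}^2}T(\mathbf{x}')H(\gamma(\mathbf{x},\mathbf{x}'))\,d\mathbf{s}(\mathbf{x}')$, $\mathbf{x}\in\mathbb{S}^2$, is zero-mean and isotropic with the spectral representation $$T_{\odot H}(\mathbf{x})=\sum_{\ell\in\mathbb{N}_0}\sum_{m=-\ell}^{\ell}a_{\ell m,\odot}Y_{\ell m}(\mathbf{x}),\qquad a_{\ell m,\odot}=a_{\ell m}h_\ell.$$ Its harmonic coefficients satisfy $\mathbf{E}[a_{\ell m,\odot}]=0$ and $\mathbf{E}[a_{\ell m,\odot}a^*_{\ell'm',\odot}]=C_{\ell,\odot}\delta_\ell^{\ell'}\delta_m^{m'}$, where $C_{\ell,\odot}=C_\ell h_\ell^2$ is the angular power spectrum of the convolved field. The corresponding covariance function is $$\mathrm{Cov}(T_{\odot H}(\mathbf{x}_1),T_{\odot H}(\mathbf{x}_2))=\sum_{\ell\in\mathbb{N}_0}\fr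ac{2\ell+1}{4\pi}C_{\ell,\odot}P_\ell(\cos\gamma(\mathbf{x}_1,\mathbf{x}_2)).$$
   Context: $T$ is a real-valued zero-mean second-order random field on the unit sphere $\mathbb{S}^2\subset\mathbb{R}^3$ with continuous, not identically constant covariance; isotropic means that the covariance depends only on the great-circle distance $\gamma$, i.e. equals $B(\gamma(\mathbf{x}_1,\mathbf{x}_2))$. $d\mathbf{s}$ is the surface measure, $P_\ell$ the Legendre polynomials, $Y_{\ell m}$ the standard complex orthonormal spherical harmonics with $Y_{\ell(-m)}=(-1)^mY^*_{\ell m}$. $T=\sum_\ell\sum_m a_{\ell m}Y_{\ell m}$ (in mean square) with $a_{\ell m}=\int_{\mathbb{S}^2}TY^*_{\ell m}\,d\mathbf{s}$, and $\mathbf{E}a_{\ell m}a^*_{\ell'm'}=\delta_\ell^{\ell'}\delta_m^{m'}C_\ell$. The kernel satisfies the integrability condition $\int_{\mathbb{S}^2}\int_{\mathbb{S}^2}|B(\gamma(\mathbf{x}_1,\mathbf{x}_2))H(\gamma(\mathbf{x},\mathbf{x}_1))H(\gamma(\mathbf{x},\mathbf{x}_2))|\,d\mathbf{s}(\mathbf{x}_1)d\mathbf{s}(\mathbf{x}_2)<\infty$ for all $\mathbf{x}\in\mathbb{S}^2$. *)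

theory Defs
  imports "HOL-Probability.Probability" "HOL-Computational_Algebra.Polynomial"
begin

section \<open>The sphere\<close>

abbreviation sphere2 :: "(real^3) set" where
  "sphere2 \<equiv> sphere 0 1"

definition great_circle_dist :: "real^3 \<Rightarrow> real^3 \<Rightarrow> real" where
  "great_circle_dist x y = arccos (x \<bullet> y)"

definition spherical_point :: "real \<times> real \<Rightarrow> real^3" where
  "spherical_point = (\<lambda>(\<theta>, \<phi>). vector [sin \<theta> * cos \<phi>, sin \<theta> * sin \<phi>, cos \<theta>])"

text \<open>The surface measure \<open>sin \<theta> d\<theta> d\<phi>\<close>, as a Borel measure whose space is the sphere.\<close>

definition surface_measure :: "(real^3) measure" where
  "surface_measure =
     distr (density (restrict_space lborel ({0..pi} \<times> {0..2 * pi})) (\<lambda>(\<theta>, \<phi>). ennreal (sin \<theta>)))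
       (restrict_space borel sphere2) spherical_point"


section \<open>Legendre polynomials and spherical harmonics\<close>

text \<open>Rodrigues' formula \<open>P_l = (1 / (2^l l!)) (d/dx)^l (x^2 - 1)^l\<close>.\<close>

definition Legendre_poly :: "nat \<Rightarrow> real poly" where
  "Legendre_poly l = smult (1 / (2 ^ l * fact l)) ((pderiv ^^ l) ([:-1, 0, 1:] ^ l))"

text \<open>Associated Legendre functions of order \<open>k \<ge> 0\<close>, with the Condon-Shortley phase.\<close>

definition assoc_Legendre :: "nat \<Rightarrow> nat \<Rightarrow> real \<Rightarrow> real" where
  "assoc_Legendre l k t =
     (-1) ^ k * sqrt (1 - t\<^sup>2) ^ k * poly ((pderiv ^^ k) (Legendre_poly l)) t"

text \<open>
  The harmonic \<open>Y_{lm}\<close> at the point with polar angle \<open>\<theta>\<close> and azimuth \<open>\<phi>\<close>; only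
  \<open>\<bar>m\<bar> \<le> l\<close> is meaningful. At the poles \<open>\<phi>\<close> is conventional (\<open>Arg 0 = 0\<close>), which is
  harmless since \<open>assoc_Legendre l k (\<plusminus>1) = 0\<close> for \<open>k > 0\<close>.
\<close>

definition sph_harmonic :: "nat \<Rightarrow> int \<Rightarrow> real^3 \<Rightarrow> complex" where
  "sph_harmonic l m x =
     (let \<theta> = arccos (x $ 3);
          \<phi> = Arg (Complex (x $ 1) (x $ 2));
          k = nat \<bar>m\<bar>;
          y = complex_of_real
                (sqrt ((2 * real l + 1) / (4 * pi) * (fact (l - k) / fact (l + k)))
                  * assoc_Legendre l k (cos \<theta>)) * cis (real k * \<phi>)
      in if m \<ge> 0 then y else (-1) ^ k * cnj y)"


section \<open>Mean-square calculus\<close>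

definition square_integrable ::
    "'w measure \<Rightarrow> ('w \<Rightarrow> 'b :: {banach, second_countable_topology}) \<Rightarrow> bool" where
  "square_integrable M X \<longleftrightarrow> X \<in> borel_measurable M \<and> integrable M (\<lambda>\<omega>. (norm (X \<omega>))\<^sup>2)"

definition ms_norm ::
    "'w measure \<Rightarrow> ('w \<Rightarrow> 'b :: {banach, second_countable_topology}) \<Rightarrow> real" where
  "ms_norm M X = sqrt (\<integral>\<omega>. (norm (X \<omega>))\<^sup>2 \<partial>M)"

definition ms_tendsto ::
    "'w measure \<Rightarrow> (nat \<Rightarrow> 'w \<Rightarrow> 'b :: {banach, second_countable_topology}) \<Rightarrow> ('w \<Rightarrow> 'b) \<Rightarrow> bool" where
  "ms_tendsto M X Y \<longleftrightarrow>
     (\<forall>n. square_integrable M (X n)) \<and> square_integrable M Y \<and>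
     (\<lambda>n. ms_norm M (\<lambda>\<omega>. X n \<omega> - Y \<omega>)) \<longlonglongrightarrow> 0"

text \<open>
  The mean-square integral over the sphere is the Bochner integral of an \<open>L\<^sup>2\<close>-valued function.
  As \<open>L\<^sup>2\<close> is not a type, \<open>has_bochner_integral\<close> does not apply, and its definition is
  spelled out for representatives: \<open>s n\<close> are simple functions on the sphere with
  square-integrable random variables as values. The integral is determined up to
  almost sure equality.
\<close>

definition has_ms_integral ::
    "'w measure \<Rightarrow> (real^3 \<Rightarrow> 'w \<Rightarrow> 'b :: {banach, second_countable_topology}) \<Rightarrow> ('w \<Rightarrow> 'b) \<Rightarrow> bool" where
  "has_ms_integral M f I \<longleftrightarrow>
     (\<forall>x\<in>sphere2. square_integrable M (f x)) \<and>
     (\<exists>s. (\<forall>n. simple_function surface_measure (s n)) \<and>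
          (\<forall>n. \<forall>x\<in>sphere2. square_integrable M (s n x)) \<and>
          (\<forall>n. integrable surface_measure (\<lambda>x. ms_norm M (\<lambda>\<omega>. f x \<omega> - s n x \<omega>))) \<and>
          (\<lambda>n. \<integral>x. ms_norm M (\<lambda>\<omega>. f x \<omega> - s n x \<omega>) \<partial>surface_measure) \<longlonglongrightarrow> 0 \<and>
          ms_tendsto M
            (\<lambda>n \<omega>. \<Sum>v\<in>s n ` sphere2.
                measure surface_measure {x \<in> sphere2. s n x = v} *\<^sub>R v \<omega>) I)"

definition ms_integral ::
    "'w measure \<Rightarrow> (real^3 \<Rightarrow> 'w \<Rightarrow> 'b :: {banach, second_countable_topology}) \<Rightarrow> 'w \<Rightarrow> 'b" where
  "ms_integral M f = (SOME I. has_ms_integral M f I)"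


section \<open>Random fields on the sphere\<close>

definition covariance :: "'w measure \<Rightarrow> ('w \<Rightarrow> real) \<Rightarrow> ('w \<Rightarrow> real) \<Rightarrow> real" where
  "covariance M X Y =
     (\<integral>\<omega>. (X \<omega> - (\<integral>\<omega>'. X \<omega>' \<partial>M)) * (Y \<omega> - (\<integral>\<omega>'. Y \<omega>' \<partial>M)) \<partial>M)"

definition second_order_field :: "'w measure \<Rightarrow> (real^3 \<Rightarrow> 'w \<Rightarrow> real) \<Rightarrow> bool" where
  "second_order_field M T \<longleftrightarrow> (\<forall>x\<in>sphere2. square_integrable M (T x))"

definition zero_mean_field :: "'w measure \<Rightarrow> (real^3 \<Rightarrow> 'w \<Rightarrow> real) \<Rightarrow> bool" where
  "zero_mean_field M T \<longleftrightarrow> (\<forall>x\<in>sphere2. (\<integral>\<omega>. T x \<omega> \<partial>M) = 0)"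

definition isotropic_with ::
    "'w measure \<Rightarrow> (real^3 \<Rightarrow> 'w \<Rightarrow> real) \<Rightarrow> (real \<Rightarrow> real) \<Rightarrow> bool" where
  "isotropic_with M T B \<longleftrightarrow>
     (\<forall>x\<^sub>1\<in>sphere2. \<forall>x\<^sub>2\<in>sphere2. covariance M (T x\<^sub>1) (T x\<^sub>2) = B (great_circle_dist x\<^sub>1 x\<^sub>2))"

definition isotropic :: "'w measure \<Rightarrow> (real^3 \<Rightarrow> 'w \<Rightarrow> real) \<Rightarrow> bool" where
  "isotropic M T \<longleftrightarrow> (\<exists>B. isotropic_with M T B)"

definition harmonic_coeff ::
    "'w measure \<Rightarrow> (real^3 \<Rightarrow> 'w \<Rightarrow> real) \<Rightarrow> nat \<Rightarrow> int \<Rightarrow> 'w \<Rightarrow> complex" where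
  "harmonic_coeff M T l m =
     ms_integral M (\<lambda>x \<omega>. complex_of_real (T x \<omega>) * cnj (sph_harmonic l m x))"

definition angular_power_spectrum ::
    "'w measure \<Rightarrow> (nat \<Rightarrow> int \<Rightarrow> 'w \<Rightarrow> complex) \<Rightarrow> (nat \<Rightarrow> real) \<Rightarrow> bool" where
  "angular_power_spectrum M a C \<longleftrightarrow>
     (\<forall>l l'. \<forall>m\<in>{- int l..int l}. \<forall>m'\<in>{- int l'..int l'}.
        (\<integral>\<omega>. a l m \<omega> * cnj (a l' m' \<omega>) \<partial>M) =
        (if l = l' \<and> m = m' then complex_of_real (C l) else 0))"

definition convolved_field ::
    "'w measure \<Rightarrow> (real^3 \<Rightarrow> 'w \<Rightarrow> real) \<Rightarrow> (real \<Rightarrow> real) \<Rightarrow> real^3 \<Rightarrow> 'w \<Rightarrow> real" where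
  "convolved_field M T H x = ms_integral M (\<lambda>x' \<omega>. T x' \<omega> * H (great_circle_dist x x'))"


section \<open>Kernels\<close>

text \<open>
  The two series representing \<open>H (\<gamma>(x, x'))\<close> (over products of harmonics, and over Legendre
  polynomials) are taken to converge in \<open>L\<^sup>1\<close> of the sphere in \<open>x'\<close>, for every \<open>x\<close>. This
  is implied by \<open>L\<^sup>2\<close> as well as by uniform convergence.
\<close>

definition harmonic_representation :: "(real \<Rightarrow> real) \<Rightarrow> (nat \<Rightarrow> real) \<Rightarrow> bool" where
  "harmonic_representation H h \<longleftrightarrow>
     (\<forall>x\<in>sphere2.
        (\<lambda>n. \<integral>\<^sup>+x'. ennreal (norm (complex_of_real (H (great_circle_dist x x')) -
               (\<Sum>l\<le>n. complex_of_real (h l) *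
                  (\<Sum>m = - int l..int l. sph_harmonic l m x * cnj (sph_harmonic l m x')))))
             \<partial>surface_measure) \<longlonglongrightarrow> 0)"

definition Legendre_representation :: "(real \<Rightarrow> real) \<Rightarrow> (nat \<Rightarrow> real) \<Rightarrow> bool" where
  "Legendre_representation H h \<longleftrightarrow>
     (\<forall>x\<in>sphere2.
        (\<lambda>n. \<integral>\<^sup>+x'. ennreal \<bar>H (great_circle_dist x x') -
               (\<Sum>l\<le>n. (2 * real l + 1) / (4 * pi) * h l *
                  poly (Legendre_poly l) (cos (great_circle_dist x x')))\<bar>
             \<partial>surface_measure) \<longlonglongrightarrow> 0)"

end

theory Submission
  imports Defs
begin

text \<open>
  Since the covariance is continuous, \<open>T\<close> is a continuous map from the sphere to \<open>L\<^sup>2\<close>, so \<open>T g\<close>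
  is Bochner integrable for every integrable \<open>g\<close>; its integral is determined, up to null sets, by
  the moments \<open>E (\<integral>T g) w = \<integral>E (T w) g\<close>. Both \<open>T_conv x\<close> and the partial sums of its spectral
  representation are such integrals, with kernels \<open>H\<close> and its Legendre partial sums (by the
  addition theorem), so their mean-square distance is at most \<open>sup \<parallel>T\<parallel>\<close> times the \<open>L\<^sup>1\<close> distance of
  the kernels. The covariance series follows by orthogonality of the \<open>a l m\<close>; on the diagonal it is a
  convergent series of nonnegative terms, so \<open>T_conv\<close> is mean-square continuous too, and its
  coefficients are identified by computing second moments.

  The addition theorem is proved by showing that \<open>\<Sum>m. Y_{lm}(x) * cnj (Y_{lm}(y))\<close> is invariant under
  rotation of both points (the derivative telescopes because of the Legendre equation), so that \<open>y\<close> may be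
  taken to be the pole, where only \<open>m = 0\<close> contributes.
\<close>

section \<open>Mean-square calculus\<close>

text \<open>\<open>has_ms_integral\<close> only asserts that suitable simple functions exist, and it
  fixes an integral only up to null sets, so nothing can be said about it pointwise in
  \<open>\<omega>\<close>. Identities are therefore stated as moments against a square-integrable
  \<open>w\<close>, which are ordinary Bochner integrals over the sphere. Norm bounds are recovered
  from moments by taking for \<open>w\<close> the (conjugate) difference to be estimated and
  dividing by its norm.

  The kernel series converges in \<open>L^1\<close> only; this is matched by the uniform bound of
  the mean-square norm of \<open>T\<close> on the compact sphere. Moments of the partial sums with a
  fixed coefficient are eventually constant, so the limits that identify the coefficients of the
  convolved field can be read off.

  For the harmonics the obstacle is the azimuth, which jumps and is conventional at the poles.
  Merging \<open>sin \<theta>\<close> and the phase into one complex coordinate \<open>u\<close> of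
  the equatorial plane makes the harmonics polynomial in the coordinates, and motions of the points
  can then be differentiated without case distinctions.\<close>

lemma null_sequence_le:
  fixes f g :: "nat \<Rightarrow> real"
  assumes "\<And>n. 0 \<le> f n" "\<And>n. f n \<le> g n" "g \<longlonglongrightarrow> 0"
  shows "f \<longlonglongrightarrow> 0"
  by (rule tendsto_sandwich[of "\<lambda>_. 0" f _ g]) (use assms in simp_all)

section \<open>Square-integrable random variables\<close>

lemma square_integrable_scaleR [intro]:
  fixes X :: "'w \<Rightarrow> 'b :: {banach, second_countable_topology}"
  assumes "square_integrable M X"
  shows "square_integrable M (\<lambda>\<omega>. c *\<^sub>R X \<omega>)"
  using assms by (auto simp: square_integrable_def power_mult_distrib)

lemma square_integrable_scaleR_left [intro]:
  fixes c :: "'b :: {banach, second_countable_topology}"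
  assumes "square_integrable M X"
  shows "square_integrable M (\<lambda>\<omega>. X \<omega> *\<^sub>R c)"
  using assms by (auto simp: square_integrable_def power_mult_distrib)

lemma square_integrable_mult_right [intro]:
  fixes X :: "'w \<Rightarrow> 'b :: {banach, second_countable_topology, real_normed_div_algebra}"
  assumes "square_integrable M X"
  shows "square_integrable M (\<lambda>\<omega>. X \<omega> * c)"
  using assms by (auto simp: square_integrable_def power_mult_distrib norm_mult)

lemma square_integrable_of_real [intro]:
  fixes X :: "'w \<Rightarrow> real"
  assumes "square_integrable M X"
  shows "square_integrable M (\<lambda>\<omega>. complex_of_real (X \<omega>))"
  using assms by (auto simp: square_integrable_def)

lemma square_integrable_cnj [intro]:
  assumes "square_integrable M X"
  shows "square_integrable M (\<lambda>\<omega>. cnj (X \<omega>))"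
proof -
  have "cnj \<in> borel_measurable borel"
    by (intro borel_measurable_continuous_onI continuous_intros)
  then have "(\<lambda>\<omega>. cnj (X \<omega>)) \<in> borel_measurable M"
    using assms by (auto simp: square_integrable_def intro: measurable_compose)
  then show ?thesis
    using assms by (auto simp: square_integrable_def)
qed

lemma norm_add_power2_le: "(norm (a + b))\<^sup>2 \<le> 2 * (norm a)\<^sup>2 + 2 * (norm b)\<^sup>2"
  for a b :: "'b :: real_normed_vector"
proof -
  have "(norm (a + b))\<^sup>2 \<le> (norm a + norm b)\<^sup>2"
    by (intro power_mono norm_triangle_ineq) auto
  also have "\<dots> \<le> 2 * (norm a)\<^sup>2 + 2 * (norm b)\<^sup>2"
    using sum_squares_bound[of "norm a" "norm b"] by (simp add: power2_sum)
  finally show ?thesis .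
qed

lemma square_integrable_add [intro]:
  fixes X Y :: "'w \<Rightarrow> 'b :: {banach, second_countable_topology}"
  assumes X: "square_integrable M X" and Y: "square_integrable M Y"
  shows "square_integrable M (\<lambda>\<omega>. X \<omega> + Y \<omega>)"
proof -
  have [measurable]: "X \<in> borel_measurable M" "Y \<in> borel_measurable M"
    using X Y by (auto simp: square_integrable_def)
  have "integrable M (\<lambda>\<omega>. (norm (X \<omega> + Y \<omega>))\<^sup>2)"
  proof (rule Bochner_Integration.integrable_bound)
    show "integrable M (\<lambda>\<omega>. 2 * (norm (X \<omega>))\<^sup>2 + 2 * (norm (Y \<omega>))\<^sup>2)"
      using X Y by (auto simp: square_integrable_def)
  qed (auto intro!: AE_I2 order_trans[OF norm_add_power2_le])
  then show ?thesis
    by (simp add: square_integrable_def)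
qed

lemma square_integrable_diff [intro]:
  fixes X Y :: "'w \<Rightarrow> 'b :: {banach, second_countable_topology}"
  assumes X: "square_integrable M X" and Y: "square_integrable M Y"
  shows "square_integrable M (\<lambda>\<omega>. X \<omega> - Y \<omega>)"
  using square_integrable_add[OF X square_integrable_scaleR[OF Y, of "-1"]] by simp

lemma square_integrable_sum [intro]:
  fixes X :: "'i \<Rightarrow> 'w \<Rightarrow> 'b :: {banach, second_countable_topology}"
  assumes "\<And>i. i \<in> A \<Longrightarrow> square_integrable M (X i)"
  shows "square_integrable M (\<lambda>\<omega>. \<Sum>i\<in>A. X i \<omega>)"
  using assms
proof (induction A rule: infinite_finite_induct)
  case (insert x F)
  then show ?case by (auto intro!: square_integrable_add)
qed (auto simp: square_integrable_def)

lemma ms_norm_nonneg [simp]: "0 \<le> ms_norm M X"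
  by (simp add: ms_norm_def)

lemma ms_norm_power2: "(ms_norm M X)\<^sup>2 = (\<integral>\<omega>. (norm (X \<omega>))\<^sup>2 \<partial>M)"
  by (simp add: ms_norm_def)

lemma ms_norm_eqI: "(\<And>\<omega>. norm (X \<omega>) = norm (Y \<omega>)) \<Longrightarrow> ms_norm M X = ms_norm M Y"
  by (simp add: ms_norm_def)

lemma ms_norm_commute: "ms_norm M (\<lambda>\<omega>. X \<omega> - Y \<omega>) = ms_norm M (\<lambda>\<omega>. Y \<omega> - X \<omega>)"
  by (rule ms_norm_eqI) (rule norm_minus_commute)

lemma ms_norm_scaleR_left: "ms_norm M (\<lambda>\<omega>. X \<omega> *\<^sub>R c) = ms_norm M X * norm c"
  by (simp add: ms_norm_def power_mult_distrib real_sqrt_mult)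

text \<open>Passage to nonnegative integrals, the setting in which Cauchy-Schwarz and Fatou's lemma
  are applied below.\<close>

lemma square_integrable_nn_integral:
  assumes "square_integrable M X"
  shows "(\<integral>\<^sup>+\<omega>. ennreal ((norm (X \<omega>))\<^sup>2) \<partial>M) = ennreal ((ms_norm M X)\<^sup>2)"
  using assms by (simp add: ms_norm_power2 square_integrable_def nn_integral_eq_integral)

section \<open>Bilinear products and second moments\<close>

text \<open>The constant 1 in \<open>norm_le\<close> gives Cauchy-Schwarz without a factor. The
  interpretations serve complex second moments (multiplication), pairings of the real field with
  vector-valued test variables (\<open>scaleR\<close>), and testing a variable against itself
  (\<open>inner\<close>).\<close>

locale contractive_bilinear = bounded_bilinear p
  for p :: "'a :: {banach, second_countable_topology} \<Rightarrow>
      'b :: {banach, second_countable_topology} \<Rightarrow> 'c :: {banach, second_countable_topology}" +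
  assumes norm_le: "norm (p a b) \<le> norm a * norm b"
begin

lemma integrable_product:
  assumes X: "square_integrable M X" and Y: "square_integrable M Y"
  shows "integrable M (\<lambda>\<omega>. p (X \<omega>) (Y \<omega>))"
proof (rule Bochner_Integration.integrable_bound)
  have [measurable]: "X \<in> borel_measurable M" "Y \<in> borel_measurable M"
    using X Y by (auto simp: square_integrable_def)
  show "integrable M (\<lambda>\<omega>. (norm (X \<omega>))\<^sup>2 + (norm (Y \<omega>))\<^sup>2)"
    using X Y by (auto simp: square_integrable_def)
  \<comment> \<open>Measurability of the product comes from joint continuity of \<open>p\<close>,
    because second countability identifies the product of the Borel algebras with the Borel algebra
    of the product.\<close>
  have "continuous_on UNIV (\<lambda>(x, y). p x y)"
    by (auto simp: split_beta intro!: continuous_on continuous_intros)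
  then have "(\<lambda>(x, y). p x y) \<in> borel_measurable (borel \<Otimes>\<^sub>M borel)"
    by (metis borel_measurable_continuous_onI borel_prod)
  from measurable_compose[OF _ this, of "\<lambda>\<omega>. (X \<omega>, Y \<omega>)" M]
  show "(\<lambda>\<omega>. p (X \<omega>) (Y \<omega>)) \<in> borel_measurable M"
    by simp
  show "AE \<omega> in M. norm (p (X \<omega>) (Y \<omega>)) \<le> norm ((norm (X \<omega>))\<^sup>2 + (norm (Y \<omega>))\<^sup>2)"
  proof (intro AE_I2)
    fix \<omega>
    have "norm (p (X \<omega>) (Y \<omega>)) \<le> norm (X \<omega>) * norm (Y \<omega>)"
      by (rule norm_le)
    also have "\<dots> \<le> (norm (X \<omega>))\<^sup>2 + (norm (Y \<omega>))\<^sup>2"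
      using sum_squares_bound[of "norm (X \<omega>)" "norm (Y \<omega>)"]
        mult_nonneg_nonneg[OF norm_ge_zero[of "X \<omega>"] norm_ge_zero[of "Y \<omega>"]]
      by linarith
    finally show "norm (p (X \<omega>) (Y \<omega>)) \<le> norm ((norm (X \<omega>))\<^sup>2 + (norm (Y \<omega>))\<^sup>2)"
      by simp
  qed
qed

lemma Cauchy_Schwarz:
  assumes X: "square_integrable M X" and Y: "square_integrable M Y"
  shows "norm (\<integral>\<omega>. p (X \<omega>) (Y \<omega>) \<partial>M) \<le> ms_norm M X * ms_norm M Y"
proof -
  have [measurable]: "X \<in> borel_measurable M" "Y \<in> borel_measurable M"
    using X Y by (auto simp: square_integrable_def)
  have "ennreal (norm (\<integral>\<omega>. p (X \<omega>) (Y \<omega>) \<partial>M)) \<le> (\<integral>\<^sup>+\<omega>. norm (p (X \<omega>) (Y \<omega>)) \<partial>M)"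
    by (rule integral_norm_bound_ennreal) (rule integrable_product[OF X Y])
  also have "\<dots> \<le> (\<integral>\<^sup>+\<omega>. ennreal (norm (X \<omega>)) * ennreal (norm (Y \<omega>)) \<partial>M)"
    by (intro nn_integral_mono) (simp flip: ennreal_mult add: norm_le)
  finally have "(ennreal (norm (\<integral>\<omega>. p (X \<omega>) (Y \<omega>) \<partial>M)))\<^sup>2 \<le>
     (\<integral>\<^sup>+\<omega>. ennreal (norm (X \<omega>)) * ennreal (norm (Y \<omega>)) \<partial>M)\<^sup>2"
    by (simp add: power_mono)
  also have "\<dots> \<le> (\<integral>\<^sup>+\<omega>. (ennreal (norm (X \<omega>)))\<^sup>2 \<partial>M) * (\<integral>\<^sup>+\<omega>. (ennreal (norm (Y \<omega>)))\<^sup>2 \<partial>M)"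
    by (rule Cauchy_Schwarz_nn_integral) auto
  also have "\<dots> = ennreal ((ms_norm M X * ms_norm M Y)\<^sup>2)"
    using X Y by (simp add: ennreal_power square_integrable_nn_integral
        ennreal_mult power_mult_distrib)
  finally have "(norm (\<integral>\<omega>. p (X \<omega>) (Y \<omega>) \<partial>M))\<^sup>2 \<le> (ms_norm M X * ms_norm M Y)\<^sup>2"
    by (simp add: ennreal_power)
  then show ?thesis
    by (rule power2_le_imp_le) simp
qed

end

global_interpretation cb_mult: contractive_bilinear
  "(*) :: 'a :: {banach, second_countable_topology, real_normed_algebra} \<Rightarrow> 'a \<Rightarrow> 'a"
  by (intro contractive_bilinear.intro bounded_bilinear_mult contractive_bilinear_axioms.intro
      norm_mult_ineq)

global_interpretation cb_scaleR: contractive_bilinear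
  "scaleR :: real \<Rightarrow> 'a \<Rightarrow> 'a :: {banach, second_countable_topology}"
  by (intro contractive_bilinear.intro bounded_bilinear_scaleR contractive_bilinear_axioms.intro)
    simp

global_interpretation cb_inner: contractive_bilinear
  "inner :: 'a \<Rightarrow> 'a :: {banach, second_countable_topology, real_inner} \<Rightarrow> real"
  by (intro contractive_bilinear.intro bounded_bilinear_inner contractive_bilinear_axioms.intro)
    (simp add: Cauchy_Schwarz_ineq2)

text \<open>Minkowski's inequality. After passage to the real variables
  \<open>norm (X \<omega>)\<close> and \<open>norm (Y \<omega>)\<close> the cross term is bounded by
  Cauchy-Schwarz, so the values may lie in any Banach space.\<close>

lemma ms_norm_triangle:
  fixes X Y :: "'w \<Rightarrow> 'b :: {banach, second_countable_topology}"
  assumes X: "square_integrable M X" and Y: "square_integrable M Y"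
  shows "ms_norm M (\<lambda>\<omega>. X \<omega> + Y \<omega>) \<le> ms_norm M X + ms_norm M Y"
proof -
  have X': "square_integrable M (\<lambda>\<omega>. norm (X \<omega>))" and Y': "square_integrable M (\<lambda>\<omega>. norm (Y \<omega>))"
    using X Y by (auto simp: square_integrable_def)
  have i: "integrable M (\<lambda>\<omega>. norm (X \<omega>) * norm (Y \<omega>))"
    using cb_mult.integrable_product[OF X' Y'] .
  have "(ms_norm M (\<lambda>\<omega>. X \<omega> + Y \<omega>))\<^sup>2 \<le>
      (\<integral>\<omega>. (norm (X \<omega>))\<^sup>2 + (norm (Y \<omega>))\<^sup>2 + 2 * (norm (X \<omega>) * norm (Y \<omega>)) \<partial>M)"
    unfolding ms_norm_power2
  proof (rule integral_mono)
    show "integrable M (\<lambda>\<omega>. (norm (X \<omega> + Y \<omega>))\<^sup>2)"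
      using square_integrable_add[OF X Y] by (simp add: square_integrable_def)
    show "integrable M (\<lambda>\<omega>. (norm (X \<omega>))\<^sup>2 + (norm (Y \<omega>))\<^sup>2 + 2 * (norm (X \<omega>) * norm (Y \<omega>)))"
      using X Y i by (auto simp: square_integrable_def)
    fix \<omega>
    have "(norm (X \<omega> + Y \<omega>))\<^sup>2 \<le> (norm (X \<omega>) + norm (Y \<omega>))\<^sup>2"
      by (intro power_mono norm_triangle_ineq) auto
    then show "(norm (X \<omega> + Y \<omega>))\<^sup>2 \<le> (norm (X \<omega>))\<^sup>2 + (norm (Y \<omega>))\<^sup>2 + 2 * (norm (X \<omega>) * norm (Y \<omega>))"
      by (simp add: power2_sum)
  qed
  also have "\<dots> = (ms_norm M X)\<^sup>2 + (ms_norm M Y)\<^sup>2 + 2 * (\<integral>\<omega>. norm (X \<omega>) * norm (Y \<omega>) \<partial>M)"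
    using X Y i by (simp add: ms_norm_power2 square_integrable_def)
  also have "\<dots> \<le> (ms_norm M X + ms_norm M Y)\<^sup>2"
    using cb_mult.Cauchy_Schwarz[OF X' Y'] by (simp add: power2_sum ms_norm_def)
  finally show ?thesis
    by (rule power2_le_imp_le) simp
qed

lemma ms_norm_triangle_diff:
  fixes X Y Z :: "'w \<Rightarrow> 'b :: {banach, second_countable_topology}"
  assumes "square_integrable M X" "square_integrable M Y" "square_integrable M Z"
  shows "ms_norm M (\<lambda>\<omega>. X \<omega> - Z \<omega>) \<le> ms_norm M (\<lambda>\<omega>. X \<omega> - Y \<omega>) + ms_norm M (\<lambda>\<omega>. Y \<omega> - Z \<omega>)"
  using ms_norm_triangle[of M "\<lambda>\<omega>. X \<omega> - Y \<omega>" "\<lambda>\<omega>. Y \<omega> - Z \<omega>"] assms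
  by (simp add: square_integrable_diff)

lemma ms_tendsto_cong_limit:
  assumes X: "ms_tendsto M X Y" and Z: "square_integrable M Z"
    and eq: "ms_norm M (\<lambda>\<omega>. Y \<omega> - Z \<omega>) = 0"
  shows "ms_tendsto M X Z"
proof -
  have "ms_norm M (\<lambda>\<omega>. X n \<omega> - Z \<omega>) \<le> ms_norm M (\<lambda>\<omega>. X n \<omega> - Y \<omega>)" for n
    using ms_norm_triangle_diff[of M "X n" Y Z] assms by (simp add: ms_tendsto_def)
  from null_sequence_le[OF ms_norm_nonneg this]
  have "(\<lambda>n. ms_norm M (\<lambda>\<omega>. X n \<omega> - Z \<omega>)) \<longlonglongrightarrow> 0"
    using X by (simp add: ms_tendsto_def)
  with X Z show ?thesis
    by (simp add: ms_tendsto_def)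
qed

text \<open>With errors \<open>D\<close> and \<open>E\<close>, the difference of the products is
  \<open>p D E + p D Y' + p X' E\<close>; Cauchy-Schwarz bounds each term by a product with at least
  one factor tending to 0.\<close>

lemma (in contractive_bilinear) ms_tendsto_integral_product:
  assumes X: "ms_tendsto M X X'" and Y: "ms_tendsto M Y Y'"
  shows "(\<lambda>n. \<integral>\<omega>. p (X n \<omega>) (Y n \<omega>) \<partial>M) \<longlonglongrightarrow> (\<integral>\<omega>. p (X' \<omega>) (Y' \<omega>) \<partial>M)"
proof -
  let ?D = "\<lambda>n. \<lambda>\<omega>. X n \<omega> - X' \<omega>" and ?E = "\<lambda>n. \<lambda>\<omega>. Y n \<omega> - Y' \<omega>"
  have sq: "square_integrable M (X n)" "square_integrable M X'"
      "square_integrable M (Y n)" "square_integrable M Y'"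
      "square_integrable M (?D n)" "square_integrable M (?E n)" for n
    using X Y by (auto simp: ms_tendsto_def)
  have lim: "(\<lambda>n. ms_norm M (?D n)) \<longlonglongrightarrow> 0" "(\<lambda>n. ms_norm M (?E n)) \<longlonglongrightarrow> 0"
    using X Y by (auto simp: ms_tendsto_def)
  have "(\<lambda>n. (\<integral>\<omega>. p (X n \<omega>) (Y n \<omega>) \<partial>M) - (\<integral>\<omega>. p (X' \<omega>) (Y' \<omega>) \<partial>M)) \<longlonglongrightarrow> 0"
  proof (rule tendsto_0_le[of "\<lambda>n. ms_norm M (?D n) * ms_norm M (?E n) +
      ms_norm M (?D n) * ms_norm M Y' + ms_norm M X' * ms_norm M (?E n)" _ _ 1])
    show "(\<lambda>n. ms_norm M (?D n) * ms_norm M (?E n) +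
      ms_norm M (?D n) * ms_norm M Y' + ms_norm M X' * ms_norm M (?E n)) \<longlonglongrightarrow> 0"
      using lim by (auto intro!: tendsto_eq_intros)
    show "\<forall>\<^sub>F n in sequentially. norm ((\<integral>\<omega>. p (X n \<omega>) (Y n \<omega>) \<partial>M) - (\<integral>\<omega>. p (X' \<omega>) (Y' \<omega>) \<partial>M)) \<le>
        norm (ms_norm M (?D n) * ms_norm M (?E n) +
          ms_norm M (?D n) * ms_norm M Y' + ms_norm M X' * ms_norm M (?E n)) * 1"
    proof (intro always_eventually allI)
      fix n
      have "p (X n \<omega>) (Y n \<omega>) - p (X' \<omega>) (Y' \<omega>) =
          p (?D n \<omega>) (?E n \<omega>) + p (?D n \<omega>) (Y' \<omega>) + p (X' \<omega>) (?E n \<omega>)" for \<omega>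
        by (simp add: diff_left diff_right)
      then have "(\<integral>\<omega>. p (X n \<omega>) (Y n \<omega>) \<partial>M) - (\<integral>\<omega>. p (X' \<omega>) (Y' \<omega>) \<partial>M) =
          (\<integral>\<omega>. p (?D n \<omega>) (?E n \<omega>) \<partial>M) + (\<integral>\<omega>. p (?D n \<omega>) (Y' \<omega>) \<partial>M) + (\<integral>\<omega>. p (X' \<omega>) (?E n \<omega>) \<partial>M)"
        using sq by (simp flip: Bochner_Integration.integral_add Bochner_Integration.integral_diff
            add: integrable_product)
      also have "norm \<dots> \<le> ms_norm M (?D n) * ms_norm M (?E n) +
          ms_norm M (?D n) * ms_norm M Y' + ms_norm M X' * ms_norm M (?E n)"
        using sq by (intro norm_triangle_le add_mono Cauchy_Schwarz)
      finally show "norm ((\<integral>\<omega>. p (X n \<omega>) (Y n \<omega>) \<partial>M) - (\<integral>\<omega>. p (X' \<omega>) (Y' \<omega>) \<partial>M)) \<le>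
        norm (ms_norm M (?D n) * ms_norm M (?E n) +
          ms_norm M (?D n) * ms_norm M Y' + ms_norm M X' * ms_norm M (?E n)) * 1"
        by simp
    qed
  qed
  then show ?thesis
    by (simp add: LIM_zero_iff)
qed

lemma ms_tendsto_const: "square_integrable M X \<Longrightarrow> ms_tendsto M (\<lambda>n. X) X"
  by (simp add: ms_tendsto_def ms_norm_def)

section \<open>Completeness of mean-square convergence\<close>

lemma (in prob_space) square_integrable_const [intro]: "square_integrable M (\<lambda>_. c)"
  by (simp add: square_integrable_def)

lemma (in prob_space) square_integrable_imp_integrable:
  assumes X: "square_integrable M X"
  shows "integrable M X"
  using cb_scaleR.integrable_product[OF square_integrable_const X, of 1] by simp

text \<open>Cauchy-Schwarz against the constant 1, which has norm 1 on a probability space. It turns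
  small mean-square increments into small expectations.\<close>

lemma (in prob_space) nn_integral_norm_le_ms_norm:
  assumes X: "square_integrable M X"
  shows "(\<integral>\<^sup>+\<omega>. ennreal (norm (X \<omega>)) \<partial>M) \<le> ennreal (ms_norm M X)"
proof -
  have X': "square_integrable M (\<lambda>\<omega>. norm (X \<omega>))"
    using X by (auto simp: square_integrable_def)
  have "norm (\<integral>\<omega>. norm (X \<omega>) * 1 \<partial>M) \<le> ms_norm M (\<lambda>\<omega>. norm (X \<omega>)) * ms_norm M (\<lambda>_. 1 :: real)"
    by (rule cb_mult.Cauchy_Schwarz[OF X']) auto
  also have "\<dots> = ms_norm M X"
    by (simp add: ms_norm_def prob_space)
  finally have "(\<integral>\<omega>. norm (X \<omega>) \<partial>M) \<le> ms_norm M X"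
    by simp
  moreover have "(\<integral>\<^sup>+\<omega>. ennreal (norm (X \<omega>)) \<partial>M) = ennreal (\<integral>\<omega>. norm (X \<omega>) \<partial>M)"
    using square_integrable_imp_integrable[OF X'] by (intro nn_integral_eq_integral) auto
  ultimately show ?thesis
    by (simp add: ennreal_leI)
qed

text \<open>
  Riesz-Fischer: along a subsequence with \<open>\<parallel>X (r (k+1)) - X (r k)\<parallel> \<le> 2 powr (-k)\<close> the
  increments are almost surely absolutely summable; Fatou's lemma then bounds the distance to
  the pointwise limit.
\<close>

lemma (in prob_space) ms_complete:
  fixes X :: "nat \<Rightarrow> 'a \<Rightarrow> 'b :: {banach, second_countable_topology}"
  assumes X: "\<And>n. square_integrable M (X n)"
    and Cauchy: "\<And>e. e > 0 \<Longrightarrow> \<exists>N. \<forall>m\<ge>N. \<forall>n\<ge>N. ms_norm M (\<lambda>\<omega>. X m \<omega> - X n \<omega>) < e"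
  shows "\<exists>Y. ms_tendsto M X Y"
proof -
  have [measurable]: "X n \<in> borel_measurable M" for n
    using X by (auto simp: square_integrable_def)
  have "\<forall>k. \<exists>N. \<forall>m\<ge>N. \<forall>n\<ge>N. ms_norm M (\<lambda>\<omega>. X m \<omega> - X n \<omega>) < (1/2) ^ k"
    by (intro allI Cauchy) simp
  then obtain N where "\<forall>k. \<forall>m\<ge>N k. \<forall>n\<ge>N k. ms_norm M (\<lambda>\<omega>. X m \<omega> - X n \<omega>) < (1/2) ^ k"
    by (rule choice[THEN exE])
  then have N: "\<And>k m n. m \<ge> N k \<Longrightarrow> n \<ge> N k \<Longrightarrow> ms_norm M (\<lambda>\<omega>. X m \<omega> - X n \<omega>) < (1/2) ^ k"
    by blast
  \<comment> \<open>Adding up all earlier thresholds makes \<open>r\<close> increasing and at least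
    \<open>N k\<close>; the summand \<open>k\<close> forces it to infinity whatever \<open>N\<close>
    is.\<close>
  define r where "r = (\<lambda>k. (\<Sum>i\<le>k. N i) + k)"
  have r_mono: "r k \<le> r (Suc k)" for k
    by (simp add: r_def)
  have r_ge: "N k \<le> r k" "k \<le> r k" for k
    using member_le_sum[of k "{..k}" N] by (auto simp: r_def)
  define D where "D = (\<lambda>k \<omega>. X (r (Suc k)) \<omega> - X (r k) \<omega>)"
  have [measurable]: "D k \<in> borel_measurable M" for k
    by (simp add: D_def)
  have D: "(\<integral>\<^sup>+\<omega>. ennreal (norm (D k \<omega>)) \<partial>M) \<le> ennreal ((1/2) ^ k)" for k
  proof -
    have "(\<integral>\<^sup>+\<omega>. ennreal (norm (D k \<omega>)) \<partial>M) \<le> ennreal (ms_norm M (D k))"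
      by (rule nn_integral_norm_le_ms_norm) (auto simp: D_def X)
    also have "\<dots> \<le> ennreal ((1/2) ^ k)"
      unfolding D_def using N[of k "r (Suc k)" "r k"] r_ge(1)[of k] r_mono[of k]
      by (intro ennreal_leI) auto
    finally show ?thesis .
  qed
  have "(\<integral>\<^sup>+\<omega>. (\<Sum>k. ennreal (norm (D k \<omega>))) \<partial>M) = (\<Sum>k. \<integral>\<^sup>+\<omega>. ennreal (norm (D k \<omega>)) \<partial>M)"
    by (rule nn_integral_suminf) simp
  also have "\<dots> \<le> (\<Sum>k. ennreal ((1/2) ^ k))"
    by (intro suminf_le D summableI)
  also have "\<dots> < \<infinity>"
    by (subst suminf_ennreal_eq[of _ 2]) (auto intro: geometric_sums[of "1/2 :: real", simplified])
  finally have "AE \<omega> in M. (\<Sum>k. ennreal (norm (D k \<omega>))) \<noteq> \<infinity>"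
    by (intro nn_integral_noteq_infinite) auto
  then have conv: "AE \<omega> in M. convergent (\<lambda>k. X (r k) \<omega>)"
  proof eventually_elim
    case (elim \<omega>)
    then have "summable (\<lambda>k. norm (D k \<omega>))"
      by (intro summable_suminf_not_top) auto
    then have "summable (\<lambda>k. D k \<omega>)"
      by (rule summable_norm_cancel)
    then have "convergent (\<lambda>n. \<Sum>k<n. D k \<omega>)"
      by (simp add: summable_iff_convergent)
    then have "convergent (\<lambda>n. X (r n) \<omega> - X (r 0) \<omega>)"
      unfolding D_def sum_lessThan_telescope[of "\<lambda>n. X (r n) \<omega>"] .
    from convergent_add[OF this convergent_const[of "X (r 0) \<omega>"]] show ?case
      by simp
  qed
  \<comment> \<open>On the null set of divergence \<open>lim\<close> still has a fixed value, so
    \<open>Y\<close> is measurable.\<close>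
  define Y where "Y = (\<lambda>\<omega>. lim (\<lambda>k. X (r k) \<omega>))"
  have [measurable]: "Y \<in> borel_measurable M"
    unfolding Y_def by measurable
  \<comment> \<open>The index \<open>n\<close> stays fixed while the subsequence runs to its limit,
    so a bound on the Cauchy tail passes to the distance from \<open>Y\<close>.\<close>
  have key: "(\<integral>\<^sup>+\<omega>. ennreal ((norm (X n \<omega> - Y \<omega>))\<^sup>2) \<partial>M) \<le> ennreal (e\<^sup>2)"
    if "\<And>m. m \<ge> n0 \<Longrightarrow> ms_norm M (\<lambda>\<omega>. X m \<omega> - X n \<omega>) < e" for n n0 e
  proof -
    have e: "e > 0"
      using that[of n0] ms_norm_nonneg[of M "\<lambda>\<omega>. X n0 \<omega> - X n \<omega>"] by linarith
    have "AE \<omega> in M. ennreal ((norm (X n \<omega> - Y \<omega>))\<^sup>2) =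
        liminf (\<lambda>k. ennreal ((norm (X (r k) \<omega> - X n \<omega>))\<^sup>2))"
      using conv
    proof eventually_elim
      case (elim \<omega>)
      then have "(\<lambda>k. X (r k) \<omega>) \<longlonglongrightarrow> Y \<omega>"
        by (simp add: Y_def convergent_LIMSEQ_iff)
      then have "(\<lambda>k. ennreal ((norm (X (r k) \<omega> - X n \<omega>))\<^sup>2)) \<longlonglongrightarrow> ennreal ((norm (Y \<omega> - X n \<omega>))\<^sup>2)"
        by (intro tendsto_intros)
      then show ?case
        using lim_imp_Liminf[OF trivial_limit_sequentially]
        by (subst norm_minus_commute) (rule sym)
    qed
    then have "(\<integral>\<^sup>+\<omega>. ennreal ((norm (X n \<omega> - Y \<omega>))\<^sup>2) \<partial>M) =
        (\<integral>\<^sup>+\<omega>. liminf (\<lambda>k. ennreal ((norm (X (r k) \<omega> - X n \<omega>))\<^sup>2)) \<partial>M)"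
      by (rule nn_integral_cong_AE)
    also have "\<dots> \<le> liminf (\<lambda>k. \<integral>\<^sup>+\<omega>. ennreal ((norm (X (r k) \<omega> - X n \<omega>))\<^sup>2) \<partial>M)"
      by (rule nn_integral_liminf) simp
    also have "\<dots> \<le> limsup (\<lambda>k. \<integral>\<^sup>+\<omega>. ennreal ((norm (X (r k) \<omega> - X n \<omega>))\<^sup>2) \<partial>M)"
      by (rule Liminf_le_Limsup) simp
    also have "\<dots> \<le> ennreal (e\<^sup>2)"
    proof (rule Limsup_bounded)
      show "\<forall>\<^sub>F k in sequentially. (\<integral>\<^sup>+\<omega>. ennreal ((norm (X (r k) \<omega> - X n \<omega>))\<^sup>2) \<partial>M) \<le> ennreal (e\<^sup>2)"
        unfolding eventually_sequentially
      proof (intro exI allI impI)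
        fix k assume "n0 \<le> k"
        then have "ms_norm M (\<lambda>\<omega>. X (r k) \<omega> - X n \<omega>) < e"
          using that r_ge(2)[of k] by auto
        then show "(\<integral>\<^sup>+\<omega>. ennreal ((norm (X (r k) \<omega> - X n \<omega>))\<^sup>2) \<partial>M) \<le> ennreal (e\<^sup>2)"
          by (subst square_integrable_nn_integral) (auto simp: X intro!: ennreal_leI power_mono)
      qed
    qed
    finally show ?thesis .
  qed
  obtain n0 where n0: "\<And>m n. m \<ge> n0 \<Longrightarrow> n \<ge> n0 \<Longrightarrow> ms_norm M (\<lambda>\<omega>. X m \<omega> - X n \<omega>) < 1"
    using Cauchy[of 1] by auto
  have "(\<integral>\<^sup>+\<omega>. ennreal ((norm (X n0 \<omega> - Y \<omega>))\<^sup>2) \<partial>M) \<le> ennreal (1\<^sup>2)"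
    by (rule key) (rule n0, auto)
  \<comment> \<open>A finite distance from one square-integrable variable is what makes
    \<open>Y\<close> square-integrable.\<close>
  then have "square_integrable M (\<lambda>\<omega>. X n0 \<omega> - Y \<omega>)"
    using le_less_trans[of _ 1 "top :: ennreal"] by (simp add: square_integrable_def integrable_iff_bounded)
  from square_integrable_diff[OF X[of n0] this] have Y: "square_integrable M Y"
    by simp
  have "(\<lambda>n. ms_norm M (\<lambda>\<omega>. X n \<omega> - Y \<omega>)) \<longlonglongrightarrow> 0"
  proof (rule LIMSEQ_I)
    fix e :: real assume e: "e > 0"
    obtain n1 where n1: "\<And>m n. m \<ge> n1 \<Longrightarrow> n \<ge> n1 \<Longrightarrow> ms_norm M (\<lambda>\<omega>. X m \<omega> - X n \<omega>) < e / 2"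
      using Cauchy[of "e / 2"] e by auto
    show "\<exists>no. \<forall>n\<ge>no. norm (ms_norm M (\<lambda>\<omega>. X n \<omega> - Y \<omega>) - 0) < e"
    proof (intro exI allI impI)
      fix n assume n: "n1 \<le> n"
      have "(\<integral>\<^sup>+\<omega>. ennreal ((norm (X n \<omega> - Y \<omega>))\<^sup>2) \<partial>M) \<le> ennreal ((e / 2)\<^sup>2)"
        using n by (intro key[of n1] n1) auto
      then have "(ms_norm M (\<lambda>\<omega>. X n \<omega> - Y \<omega>))\<^sup>2 \<le> (e / 2)\<^sup>2"
        using X Y by (subst (asm) square_integrable_nn_integral) auto
      then have "ms_norm M (\<lambda>\<omega>. X n \<omega> - Y \<omega>) \<le> e / 2"
        by (rule power2_le_imp_le) (use e in auto)
      then show "norm (ms_norm M (\<lambda>\<omega>. X n \<omega> - Y \<omega>) - 0) < e"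
        using e by simp
    qed
  qed
  then show ?thesis
    using X Y by (auto simp: ms_tendsto_def)
qed

section \<open>Mean-square integrals on the sphere\<close>

declare mem_sphere [simp del] mem_sphere_0 [simp del]

section \<open>Polar coordinates and the surface measure\<close>

lemma spherical_point_nth [simp]:
  "spherical_point (\<theta>, \<phi>) $ 1 = sin \<theta> * cos \<phi>"
  "spherical_point (\<theta>, \<phi>) $ 2 = sin \<theta> * sin \<phi>"
  "spherical_point (\<theta>, \<phi>) $ 3 = cos \<theta>"
  by (simp_all add: spherical_point_def)

lemma inner_real3: "(x :: real^3) \<bullet> y = x $ 1 * y $ 1 + x $ 2 * y $ 2 + x $ 3 * y $ 3"
  by (simp add: inner_vec_def sum_3)

lemma sphere2_iff: "x \<in> sphere2 \<longleftrightarrow> (x $ 1)\<^sup>2 + (x $ 2)\<^sup>2 + (x $ 3)\<^sup>2 = 1"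
  by (simp add: mem_sphere_0 norm_eq_1 inner_real3 power2_eq_square)

lemma spherical_point_in_sphere: "spherical_point p \<in> sphere2"
proof (cases p)
  case (Pair \<theta> \<phi>)
  have "(sin \<theta> * cos \<phi>)\<^sup>2 + (sin \<theta> * sin \<phi>)\<^sup>2 + (cos \<theta>)\<^sup>2 =
      (sin \<theta>)\<^sup>2 * ((sin \<phi>)\<^sup>2 + (cos \<phi>)\<^sup>2) + (cos \<theta>)\<^sup>2"
    by (simp only: power_mult_distrib algebra_simps)
  then show ?thesis
    by (simp add: Pair sphere2_iff)
qed

lemma continuous_on_spherical_point: "continuous_on A spherical_point"
proof -
  have "continuous_on A (\<lambda>p. spherical_point p $ i)" for i
  proof -
    have i: "i = 1 \<or> i = 2 \<or> i = 3"
      using UNIV_3 by auto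
    have "spherical_point p = spherical_point (fst p, snd p)" for p
      by simp
    then have "spherical_point p $ i = (if i = 1 then sin (fst p) * cos (snd p)
        else if i = 2 then sin (fst p) * sin (snd p) else cos (fst p))" for p
      using i spherical_point_nth[of "fst p" "snd p"] by auto
    then show ?thesis
      using i by (auto intro!: continuous_intros)
  qed
  then have "continuous_on A (\<lambda>p. \<chi> i. spherical_point p $ i)"
    by (rule continuous_on_vec_lambda)
  then show ?thesis
    by simp
qed

lemma measurable_spherical_point:
  "spherical_point \<in> measurable
     (density (restrict_space lborel ({0..pi} \<times> {0..2 * pi})) (\<lambda>(\<theta>, \<phi>). ennreal (sin \<theta>)))
     (restrict_space borel sphere2)"
proof -
  have "spherical_point \<in> borel_measurable borel"
    by (intro borel_measurable_continuous_onI continuous_on_spherical_point)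
  then show ?thesis
    by (auto intro!: measurable_restrict_space2 measurable_restrict_space1 spherical_point_in_sphere
       )
qed

lemma space_surface_measure [simp]: "space surface_measure = sphere2"
  by (simp add: surface_measure_def space_restrict_space)

lemma sets_surface_measure [measurable_cong]: "sets surface_measure = sets (restrict_space borel sphere2)"
  by (simp add: surface_measure_def)

lemma borel_measurable_surface_measure:
  "borel_measurable surface_measure = borel_measurable (restrict_space borel sphere2)"
  by (rule measurable_cong_sets) (simp_all add: sets_surface_measure)

lemma borel_measurable_surface_measureI:
  assumes "continuous_on sphere2 f"
  shows "f \<in> borel_measurable surface_measure"
  unfolding borel_measurable_surface_measure
  by (rule borel_measurable_continuous_on_restrict) (rule assms)

text \<open>The density \<open>sin \<theta>\<close> is at most 1, so the total mass is bounded by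
  the area of the parameter rectangle. The exact value follows later, in
  \<open>measure_surface_measure\<close>.\<close>

lemma finite_measure_surface_measure: "finite_measure surface_measure"
proof
  let ?D = "density (restrict_space lborel ({0..pi} \<times> {0..2 * pi})) (\<lambda>(\<theta>, \<phi>). ennreal (sin \<theta>))"
  have m: "(\<lambda>(\<theta>, \<phi>). ennreal (sin \<theta>)) \<in> borel_measurable (restrict_space lborel ({0..pi} \<times> {0..2 * pi}))"
    by (intro measurable_restrict_space1) (simp add: split_beta borel_prod[symmetric])
  have S: "{0..pi} \<times> {0..2 * pi} \<in> sets (borel :: (real \<times> real) measure)"
    by (simp add: borel_prod[symmetric])
  have "emeasure surface_measure (space surface_measure) = emeasure ?D (space ?D)"
    unfolding space_surface_measure surface_measure_def
    by (subst emeasure_distr[OF measurable_spherical_point])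
      (auto intro!: arg_cong[where f = "emeasure ?D"] spherical_point_in_sphere
        simp: sets_restrict_space image_iff intro: exI[of _ UNIV])
  also have "\<dots> = (\<integral>\<^sup>+p. (\<lambda>(\<theta>, \<phi>). ennreal (sin \<theta>)) p \<partial>restrict_space lborel ({0..pi} \<times> {0..2 * pi}))"
    by (subst emeasure_density[OF m]) (auto intro!: nn_integral_cong)
  also have "\<dots> \<le> (\<integral>\<^sup>+p. 1 \<partial>restrict_space lborel ({0..pi} \<times> {0..2 * pi}))"
    by (intro nn_integral_mono) (auto simp: ennreal_le_1)
  also have "\<dots> = emeasure (lborel :: (real \<times> real) measure) ({0..pi} \<times> {0..2 * pi})"
    using S by (simp add: emeasure_restrict_space space_restrict_space)
  also have "\<dots> = emeasure (lborel \<Otimes>\<^sub>M lborel) ({0..pi} \<times> {0..2 * pi :: real})"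
    by (simp add: lborel_prod)
  also have "\<dots> < \<infinity>"
    by (subst lborel.emeasure_pair_measure_Times) (auto simp: ennreal_mult_less_top)
  finally show "emeasure surface_measure (space surface_measure) \<noteq> \<infinity>"
    by simp
qed

interpretation surface: finite_measure surface_measure
  by (rule finite_measure_surface_measure)

section \<open>Moments of mean-square integrals\<close>

text \<open>The values of \<open>s\<close> lie in an arbitrary type, because in the application they
  are random variables; a Bochner integral makes sense only after \<open>\<phi>\<close>, there a
  moment functional, has been applied.\<close>

lemma (in finite_measure) has_bochner_integral_simple_compose:
  fixes \<phi> :: "'b \<Rightarrow> 'c :: {banach, second_countable_topology}"
  assumes s: "simple_function M s"
  shows "has_bochner_integral M (\<lambda>x. \<phi> (s x))
    (\<Sum>v\<in>s ` space M. measure M {x \<in> space M. s x = v} *\<^sub>R \<phi> v)"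
proof -
  have fin: "finite (s ` space M)"
    using s by (simp add: simple_function_def)
  have meas: "{x \<in> space M. s x = v} \<in> sets M" for v
    using measurable_sets[OF measurable_simple_function[OF s], of "{v}"]
    by (simp add: vimage_def Int_def conj_commute)
  have "has_bochner_integral M (\<lambda>x. \<Sum>v\<in>s ` space M. indicator {x \<in> space M. s x = v} x *\<^sub>R \<phi> v)
    (\<Sum>v\<in>s ` space M. measure M {x \<in> space M. s x = v} *\<^sub>R \<phi> v)"
  proof (intro has_bochner_integral_sum)
    fix v
    show "has_bochner_integral M (\<lambda>x. indicator {x \<in> space M. s x = v} x *\<^sub>R \<phi> v)
      (measure M {x \<in> space M. s x = v} *\<^sub>R \<phi> v)"
      using has_bochner_integral_real_indicator[OF meas[of v]]
      by (intro has_bochner_integral_scaleR_left) (simp add: less_top[symmetric])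
  qed
  moreover have "(\<Sum>v\<in>s ` space M. indicator {x \<in> space M. s x = v} x *\<^sub>R \<phi> v) = \<phi> (s x)"
    if "x \<in> space M" for x
  proof -
    have "(\<Sum>v\<in>s ` space M. indicator {x \<in> space M. s x = v} x *\<^sub>R \<phi> v) =
        (\<Sum>v\<in>s ` space M. if v = s x then \<phi> v else 0)"
      using that by (intro sum.cong) auto
    then show ?thesis
      using that fin by simp
  qed
  ultimately show ?thesis
    by (subst has_bochner_integral_cong[OF refl _ refl]) auto
qed

context contractive_bilinear
begin

text \<open>The moment functional acts value by value, so exchanging the expectation with the
  surface integral is an exchange with a finite sum.\<close>

lemma simple_ms_integral_product:
  assumes s: "simple_function surface_measure s"
    and sq: "\<And>x. x \<in> sphere2 \<Longrightarrow> square_integrable M (s x)" and w: "square_integrable M w"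
  shows "has_bochner_integral surface_measure (\<lambda>x. \<integral>\<omega>. p (s x \<omega>) (w \<omega>) \<partial>M)
    (\<integral>\<omega>. p (\<Sum>v\<in>s ` sphere2. measure surface_measure {x \<in> sphere2. s x = v} *\<^sub>R v \<omega>) (w \<omega>) \<partial>M)"
proof -
  let ?m = "\<lambda>v. measure surface_measure {x \<in> sphere2. s x = v}"
  have "(\<integral>\<omega>. p (\<Sum>v\<in>s ` sphere2. ?m v *\<^sub>R v \<omega>) (w \<omega>) \<partial>M) =
      (\<integral>\<omega>. (\<Sum>v\<in>s ` sphere2. ?m v *\<^sub>R p (v \<omega>) (w \<omega>)) \<partial>M)"
    by (simp add: sum_left scaleR_left)
  also have "\<dots> = (\<Sum>v\<in>s ` sphere2. ?m v *\<^sub>R (\<integral>\<omega>. p (v \<omega>) (w \<omega>) \<partial>M))"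
    using sq w by (subst Bochner_Integration.integral_sum) (auto intro!: integrable_product)
  finally show ?thesis
    using surface.has_bochner_integral_simple_compose[OF s, of "\<lambda>v. \<integral>\<omega>. p (v \<omega>) (w \<omega>) \<partial>M"]
    by simp
qed

text \<open>By Cauchy-Schwarz, pairing with \<open>w\<close> is Lipschitz with constant
  \<open>ms_norm M w\<close>, so the \<open>L^1\<close> error of the simple functions also controls
  the moments. The limit involves \<open>f\<close> and not the approximating sequence; hence all
  integrals of \<open>f\<close> have the same moments.\<close>

lemma has_ms_integral_product:
  assumes I: "has_ms_integral M f I" and w: "square_integrable M w"
    and meas: "(\<lambda>x. \<integral>\<omega>. p (f x \<omega>) (w \<omega>) \<partial>M) \<in> borel_measurable surface_measure"
  shows "has_bochner_integral surface_measure (\<lambda>x. \<integral>\<omega>. p (f x \<omega>) (w \<omega>) \<partial>M) (\<integral>\<omega>. p (I \<omega>) (w \<omega>) \<partial>M)"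
proof -
  from I obtain s where f: "\<And>x. x \<in> sphere2 \<Longrightarrow> square_integrable M (f x)"
    and s: "\<And>n. simple_function surface_measure (s n)"
    and sq: "\<And>n x. x \<in> sphere2 \<Longrightarrow> square_integrable M (s n x)"
    and int: "\<And>n. integrable surface_measure (\<lambda>x. ms_norm M (\<lambda>\<omega>. f x \<omega> - s n x \<omega>))"
    and lim: "(\<lambda>n. \<integral>x. ms_norm M (\<lambda>\<omega>. f x \<omega> - s n x \<omega>) \<partial>surface_measure) \<longlonglongrightarrow> 0"
    and ms: "ms_tendsto M (\<lambda>n \<omega>. \<Sum>v\<in>s n ` sphere2.
        measure surface_measure {x \<in> sphere2. s n x = v} *\<^sub>R v \<omega>) I"
    unfolding has_ms_integral_def by blast
  let ?F = "\<lambda>x. \<integral>\<omega>. p (f x \<omega>) (w \<omega>) \<partial>M" and ?S = "\<lambda>n x. \<integral>\<omega>. p (s n x \<omega>) (w \<omega>) \<partial>M"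
  let ?I = "\<lambda>n \<omega>. \<Sum>v\<in>s n ` sphere2. measure surface_measure {x \<in> sphere2. s n x = v} *\<^sub>R v \<omega>"
  have S: "has_bochner_integral surface_measure (?S n) (\<integral>\<omega>. p (?I n \<omega>) (w \<omega>) \<partial>M)" for n
    by (rule simple_ms_integral_product[OF s sq w])
  have bound: "norm (?F x - ?S n x) \<le> ms_norm M (\<lambda>\<omega>. f x \<omega> - s n x \<omega>) * ms_norm M w"
    if x: "x \<in> sphere2" for x n
  proof -
    have "?F x - ?S n x = (\<integral>\<omega>. p (f x \<omega> - s n x \<omega>) (w \<omega>) \<partial>M)"
      using f[OF x] sq[OF x] w
      by (simp add: diff_left Bochner_Integration.integral_diff integrable_product)
    then show ?thesis
      using f[OF x] sq[OF x] w Cauchy_Schwarz[of M "\<lambda>\<omega>. f x \<omega> - s n x \<omega>" w]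
      by (simp add: square_integrable_diff)
  qed
  have intD: "integrable surface_measure (\<lambda>x. ?F x - ?S n x)" for n
  proof (rule Bochner_Integration.integrable_bound)
    show "integrable surface_measure (\<lambda>x. ms_norm M (\<lambda>\<omega>. f x \<omega> - s n x \<omega>) * ms_norm M w)"
      by (intro integrable_mult_left int)
    show "(\<lambda>x. ?F x - ?S n x) \<in> borel_measurable surface_measure"
      using meas S by (intro borel_measurable_diff) (auto elim: has_bochner_integral.cases)
  qed (use bound in \<open>auto intro!: AE_I2\<close>)
  have intF: "integrable surface_measure ?F"
    using Bochner_Integration.integrable_add[OF intD[of 0] integrable.intros[OF S[of 0]]] by simp
  have "(\<lambda>n. (\<integral>x. ?F x \<partial>surface_measure) - (\<integral>x. ?S n x \<partial>surface_measure)) \<longlonglongrightarrow> 0"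
  proof (rule tendsto_0_le[of "\<lambda>n. (\<integral>x. ms_norm M (\<lambda>\<omega>. f x \<omega> - s n x \<omega>) \<partial>surface_measure) * ms_norm M w" _ _ 1])
    show "(\<lambda>n. (\<integral>x. ms_norm M (\<lambda>\<omega>. f x \<omega> - s n x \<omega>) \<partial>surface_measure) * ms_norm M w) \<longlonglongrightarrow> 0"
      by (intro tendsto_mult_left_zero lim)
    show "\<forall>\<^sub>F n in sequentially. norm ((\<integral>x. ?F x \<partial>surface_measure) - (\<integral>x. ?S n x \<partial>surface_measure)) \<le>
        norm ((\<integral>x. ms_norm M (\<lambda>\<omega>. f x \<omega> - s n x \<omega>) \<partial>surface_measure) * ms_norm M w) * 1"
    proof (intro always_eventually allI)
      fix n
      have "norm ((\<integral>x. ?F x \<partial>surface_measure) - (\<integral>x. ?S n x \<partial>surface_measure)) =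
          norm (\<integral>x. ?F x - ?S n x \<partial>surface_measure)"
        using intF integrable.intros[OF S[of n]] by simp
      also have "\<dots> \<le> (\<integral>x. ms_norm M (\<lambda>\<omega>. f x \<omega> - s n x \<omega>) * ms_norm M w \<partial>surface_measure)"
        using bound by (intro Bochner_Integration.integral_norm_bound_integral intD integrable_mult_left int) auto
      finally show "norm ((\<integral>x. ?F x \<partial>surface_measure) - (\<integral>x. ?S n x \<partial>surface_measure)) \<le>
        norm ((\<integral>x. ms_norm M (\<lambda>\<omega>. f x \<omega> - s n x \<omega>) \<partial>surface_measure) * ms_norm M w) * 1"
        by simp
    qed
  qed
  moreover have "(\<lambda>n. \<integral>x. ?S n x \<partial>surface_measure) \<longlonglongrightarrow> (\<integral>\<omega>. p (I \<omega>) (w \<omega>) \<partial>M)"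
    using ms_tendsto_integral_product[OF ms ms_tendsto_const[OF w]]
    by (simp add: has_bochner_integral_integral_eq[OF S])
  ultimately have "(\<lambda>n. (\<integral>x. ?F x \<partial>surface_measure)) \<longlonglongrightarrow> (\<integral>\<omega>. p (I \<omega>) (w \<omega>) \<partial>M)"
    using tendsto_add by fastforce
  then have "(\<integral>x. ?F x \<partial>surface_measure) = (\<integral>\<omega>. p (I \<omega>) (w \<omega>) \<partial>M)"
    by (simp add: LIMSEQ_const_iff)
  with intF show ?thesis
    by (simp add: has_bochner_integral_iff)
qed

end

text \<open>Two simple functions with different level sets are compared by duality: the squared norm
  of the difference \<open>?w\<close> of their integrals is a moment, hence a surface integral of
  the moments of \<open>s - t\<close> against \<open>?w\<close>, to which the triangle inequality
  through \<open>f\<close> applies. The inner product on the values makes this possible.\<close>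

lemma ms_norm_simple_ms_integral_diff_le:
  fixes s t :: "real^3 \<Rightarrow> 'w \<Rightarrow> 'b :: {banach, second_countable_topology, real_inner}"
    and f :: "real^3 \<Rightarrow> 'w \<Rightarrow> 'b"
  assumes f: "\<And>x. x \<in> sphere2 \<Longrightarrow> square_integrable M (f x)"
    and s: "simple_function surface_measure s" "\<And>x. x \<in> sphere2 \<Longrightarrow> square_integrable M (s x)"
      "integrable surface_measure (\<lambda>x. ms_norm M (\<lambda>\<omega>. f x \<omega> - s x \<omega>))"
    and t: "simple_function surface_measure t" "\<And>x. x \<in> sphere2 \<Longrightarrow> square_integrable M (t x)"
      "integrable surface_measure (\<lambda>x. ms_norm M (\<lambda>\<omega>. f x \<omega> - t x \<omega>))"
  shows "ms_norm M (\<lambda>\<omega>.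
      (\<Sum>v\<in>s ` sphere2. measure surface_measure {x \<in> sphere2. s x = v} *\<^sub>R v \<omega>) -
      (\<Sum>v\<in>t ` sphere2. measure surface_measure {x \<in> sphere2. t x = v} *\<^sub>R v \<omega>)) \<le>
    (\<integral>x. ms_norm M (\<lambda>\<omega>. f x \<omega> - s x \<omega>) \<partial>surface_measure) +
    (\<integral>x. ms_norm M (\<lambda>\<omega>. f x \<omega> - t x \<omega>) \<partial>surface_measure)" (is "ms_norm M (\<lambda>\<omega>. ?I \<omega> - ?J \<omega>) \<le> ?e")
proof -
  have sq: "square_integrable M ?I" "square_integrable M ?J"
    using s t by (auto intro!: square_integrable_sum square_integrable_scaleR)
  let ?w = "\<lambda>\<omega>. ?I \<omega> - ?J \<omega>"
  have w: "square_integrable M ?w"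
    using sq by (rule square_integrable_diff)
  note hs = cb_inner.simple_ms_integral_product[OF s(1,2) w]
  note ht = cb_inner.simple_ms_integral_product[OF t(1,2) w]
  have "(ms_norm M ?w)\<^sup>2 = (\<integral>\<omega>. ?w \<omega> \<bullet> ?w \<omega> \<partial>M)"
    by (simp add: ms_norm_power2 power2_norm_eq_inner)
  also have "\<dots> = (\<integral>\<omega>. ?I \<omega> \<bullet> ?w \<omega> \<partial>M) - (\<integral>\<omega>. ?J \<omega> \<bullet> ?w \<omega> \<partial>M)"
    by (subst Bochner_Integration.integral_diff[symmetric])
      (auto intro!: cb_inner.integrable_product sq w simp: inner_diff_left)
  also have "\<dots> = (\<integral>x. (\<integral>\<omega>. s x \<omega> \<bullet> ?w \<omega> \<partial>M) - (\<integral>\<omega>. t x \<omega> \<bullet> ?w \<omega> \<partial>M) \<partial>surface_measure)"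
    using hs ht by (simp add: has_bochner_integral_iff)
  also have "\<dots> \<le> (\<integral>x. (ms_norm M (\<lambda>\<omega>. f x \<omega> - s x \<omega>) + ms_norm M (\<lambda>\<omega>. f x \<omega> - t x \<omega>)) * ms_norm M ?w \<partial>surface_measure)"
  proof (rule integral_mono)
    show "integrable surface_measure (\<lambda>x. (\<integral>\<omega>. s x \<omega> \<bullet> ?w \<omega> \<partial>M) - (\<integral>\<omega>. t x \<omega> \<bullet> ?w \<omega> \<partial>M))"
      using hs ht by (simp add: has_bochner_integral_iff)
    show "integrable surface_measure (\<lambda>x. (ms_norm M (\<lambda>\<omega>. f x \<omega> - s x \<omega>) + ms_norm M (\<lambda>\<omega>. f x \<omega> - t x \<omega>)) * ms_norm M ?w)"
      by (intro integrable_mult_left Bochner_Integration.integrable_add s(3) t(3))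
    fix x assume "x \<in> space surface_measure"
    then have x: "x \<in> sphere2"
      by simp
    have "(\<integral>\<omega>. s x \<omega> \<bullet> ?w \<omega> \<partial>M) - (\<integral>\<omega>. t x \<omega> \<bullet> ?w \<omega> \<partial>M) = (\<integral>\<omega>. (s x \<omega> - t x \<omega>) \<bullet> ?w \<omega> \<partial>M)"
      by (subst Bochner_Integration.integral_diff[symmetric])
        (auto intro!: cb_inner.integrable_product s(2)[OF x] t(2)[OF x] w simp: inner_diff_left)
    also have "\<dots> \<le> ms_norm M (\<lambda>\<omega>. s x \<omega> - t x \<omega>) * ms_norm M ?w"
      using cb_inner.Cauchy_Schwarz[OF square_integrable_diff[OF s(2)[OF x] t(2)[OF x]] w] by simp
    also have "\<dots> \<le> (ms_norm M (\<lambda>\<omega>. f x \<omega> - s x \<omega>) + ms_norm M (\<lambda>\<omega>. f x \<omega> - t x \<omega>)) * ms_norm M ?w"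
      using ms_norm_triangle_diff[OF s(2)[OF x] f[OF x] t(2)[OF x]]
      by (intro mult_right_mono) (simp_all add: ms_norm_commute[of M "s x" "f x"])
    finally show "(\<integral>\<omega>. s x \<omega> \<bullet> ?w \<omega> \<partial>M) - (\<integral>\<omega>. t x \<omega> \<bullet> ?w \<omega> \<partial>M) \<le> \<dots>" .
  qed
  also have "\<dots> = ?e * ms_norm M ?w"
    using s(3) t(3) by simp
  finally have "ms_norm M ?w * ms_norm M ?w \<le> ?e * ms_norm M ?w"
    by (simp add: power2_eq_square)
  moreover have "0 \<le> ?e"
    by (simp add: integral_nonneg_AE)
  \<comment> \<open>The common factor \<open>ms_norm M ?w\<close> is cancelled; if it is 0, the
    claim is \<open>0 \<le> ?e\<close>.\<close>
  ultimately show ?thesis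
    by (cases "ms_norm M ?w = 0")
      (auto simp: mult_le_cancel_right order.strict_iff_order)
qed

section \<open>Existence of integrals of a mean-square continuous field\<close>

text \<open>Continuity is required of the second moments, since this is what a covariance provides,
  both for the given field and for the convolved one, where the locale is interpreted again. By
  \<open>ms_norm_diff_power2\<close> it amounts to continuity in mean square.\<close>

locale ms_continuous_field = prob_space M for M :: "'w measure" +
  fixes T :: "real^3 \<Rightarrow> 'w \<Rightarrow> real"
  assumes square_integrable: "x \<in> sphere2 \<Longrightarrow> square_integrable M (T x)"
    and continuous_product:
      "continuous_on (sphere2 \<times> sphere2) (\<lambda>(x, y). \<integral>\<omega>. T x \<omega> * T y \<omega> \<partial>M)"
begin

definition K :: "real^3 \<Rightarrow> real^3 \<Rightarrow> real" where
  "K x y = (\<integral>\<omega>. T x \<omega> * T y \<omega> \<partial>M)"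

lemma continuous_on_K:
  assumes "continuous_on A f" "continuous_on A g" "f ` A \<subseteq> sphere2" "g ` A \<subseteq> sphere2"
  shows "continuous_on A (\<lambda>x. K (f x) (g x))"
proof -
  have "continuous_on (sphere2 \<times> sphere2) (\<lambda>(x, y). K x y)"
    using continuous_product by (simp add: K_def)
  from continuous_on_compose2[OF this continuous_on_Pair[OF assms(1,2)]] show ?thesis
    using assms(3,4) by auto
qed

lemma measurable_K:
  assumes "f \<in> measurable N (restrict_space borel sphere2)"
    and "g \<in> measurable N (restrict_space borel sphere2)"
  shows "(\<lambda>x. K (f x) (g x)) \<in> borel_measurable N"
proof -
  have "continuous_on (sphere2 \<times> sphere2) (\<lambda>(x, y). K x y)"
    using continuous_product by (simp add: K_def)
  then have K: "(\<lambda>(x, y). K x y) \<in> borel_measurable (restrict_space borel (sphere2 \<times> sphere2))"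
    by (rule borel_measurable_continuous_on_restrict)
  have "(\<lambda>x. (f x, g x)) \<in> measurable N (restrict_space borel (sphere2 \<times> sphere2))"
  proof (rule measurable_restrict_space2)
    show "(\<lambda>x. (f x, g x)) \<in> space N \<rightarrow> sphere2 \<times> sphere2"
      using measurable_space[OF assms(1)] measurable_space[OF assms(2)]
      by (auto simp: space_restrict_space)
    have "f \<in> borel_measurable N" "g \<in> borel_measurable N"
      using assms by (auto simp: measurable_restrict_space2_iff)
    then show "(\<lambda>x. (f x, g x)) \<in> borel_measurable N"
      by simp
  qed
  from measurable_compose[OF this K] show ?thesis
    by simp
qed

lemma ms_norm_diff_power2:
  assumes "x \<in> sphere2" "y \<in> sphere2"
  shows "(ms_norm M (\<lambda>\<omega>. T x \<omega> - T y \<omega>))\<^sup>2 = K x x - 2 * K x y + K y y"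
proof -
  have sq: "square_integrable M (T x)" "square_integrable M (T y)"
    using assms by (auto intro: square_integrable)
  have i: "integrable M (\<lambda>\<omega>. T x \<omega> * T x \<omega>)" "integrable M (\<lambda>\<omega>. T x \<omega> * T y \<omega>)"
      "integrable M (\<lambda>\<omega>. T y \<omega> * T y \<omega>)"
    by (intro cb_mult.integrable_product sq)+
  have "(ms_norm M (\<lambda>\<omega>. T x \<omega> - T y \<omega>))\<^sup>2 =
      (\<integral>\<omega>. T x \<omega> * T x \<omega> - 2 * (T x \<omega> * T y \<omega>) + T y \<omega> * T y \<omega> \<partial>M)"
    unfolding ms_norm_power2 by (intro Bochner_Integration.integral_cong) (simp_all add: power2_eq_square algebra_simps)
  also have "\<dots> = K x x - 2 * K x y + K y y"
    using i by (simp add: K_def)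
  finally show ?thesis .
qed

lemma ms_norm_power2_K: "(ms_norm M (T x))\<^sup>2 = K x x"
  by (simp only: ms_norm_power2 K_def real_norm_def power2_abs) (simp add: power2_eq_square)

lemma tendsto_ms_norm_diff:
  assumes c: "(c \<longlongrightarrow> x) F" "\<And>n. c n \<in> sphere2" and x: "x \<in> sphere2"
  shows "((\<lambda>n. ms_norm M (\<lambda>\<omega>. T x \<omega> - T (c n) \<omega>)) \<longlongrightarrow> 0) F"
proof -
  have "continuous_on sphere2 (\<lambda>y. K x x - 2 * K x y + K y y)"
    using x by (intro continuous_intros continuous_on_K) auto
  from continuous_on_tendsto_compose[OF this c(1) x always_eventually] c(2)
  have "((\<lambda>n. (ms_norm M (\<lambda>\<omega>. T x \<omega> - T (c n) \<omega>))\<^sup>2) \<longlongrightarrow> 0) F"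
    using x by (simp add: ms_norm_diff_power2)
  from tendsto_real_sqrt[OF this] show ?thesis
    by simp
qed

text \<open>This supplies Borel measurability of moments as functions on the sphere. Continuity is
  checked along sequences because \<open>ms_tendsto\<close> speaks of sequences.\<close>

lemma continuous_on_product:
  fixes w :: "'w \<Rightarrow> 'b :: {banach, second_countable_topology}"
  assumes w: "square_integrable M w"
  shows "continuous_on sphere2 (\<lambda>x. \<integral>\<omega>. T x \<omega> *\<^sub>R w \<omega> \<partial>M)"
  unfolding continuous_on_sequentially
proof (intro allI ballI impI, elim conjE)
  fix c x assume x: "x \<in> sphere2" and c: "\<forall>n. c n \<in> sphere2" "c \<longlonglongrightarrow> x"
  have "ms_tendsto M (\<lambda>n. T (c n)) (T x)"
    using tendsto_ms_norm_diff[OF c(2) _ x] c(1) square_integrable x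
    by (simp add: ms_tendsto_def ms_norm_commute[of M "T x"])
  from cb_scaleR.ms_tendsto_integral_product[OF this ms_tendsto_const[OF w]]
  show "((\<lambda>x. \<integral>\<omega>. T x \<omega> *\<^sub>R w \<omega> \<partial>M) \<circ> c) \<longlonglongrightarrow> (\<integral>\<omega>. T x \<omega> *\<^sub>R w \<omega> \<partial>M)"
    by (simp add: o_def)
qed

lemma ms_norm_bounded:
  obtains R where "R \<ge> 0" "\<And>x. x \<in> sphere2 \<Longrightarrow> ms_norm M (T x) \<le> R"
proof -
  have "compact ((\<lambda>x. K x x) ` sphere2)"
    by (intro compact_continuous_image continuous_on_K continuous_on_id) auto
  then obtain R where R: "\<And>x. x \<in> sphere2 \<Longrightarrow> \<bar>K x x\<bar> \<le> R"
    using compact_imp_bounded by (fastforce simp: bounded_iff)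
  have "ms_norm M (T x) \<le> sqrt \<bar>R\<bar>" if "x \<in> sphere2" for x
  proof (rule real_le_rsqrt)
    show "(ms_norm M (T x))\<^sup>2 \<le> \<bar>R\<bar>"
      using R[OF that] by (simp add: ms_norm_power2_K)
  qed
  then show ?thesis
    using that[of "sqrt \<bar>R\<bar>"] by simp
qed

text \<open>The explicit expression in \<open>K\<close> serves to show that the mean-square error of
  an approximation is a measurable function of the point.\<close>

lemma ms_norm_scaleR_diff:
  fixes a b :: "'b :: {banach, second_countable_topology, real_inner}"
  assumes "x \<in> sphere2" "y \<in> sphere2"
  shows "ms_norm M (\<lambda>\<omega>. T x \<omega> *\<^sub>R a - T y \<omega> *\<^sub>R b) =
    sqrt (K x x * (a \<bullet> a) - 2 * (K x y * (a \<bullet> b)) + K y y * (b \<bullet> b))"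
proof -
  have sq: "square_integrable M (T x)" "square_integrable M (T y)"
    using assms by (auto intro: square_integrable)
  have i: "integrable M (\<lambda>\<omega>. T x \<omega> * T x \<omega>)" "integrable M (\<lambda>\<omega>. T x \<omega> * T y \<omega>)"
      "integrable M (\<lambda>\<omega>. T y \<omega> * T y \<omega>)"
    by (intro cb_mult.integrable_product sq)+
  have eq: "(norm (T x \<omega> *\<^sub>R a - T y \<omega> *\<^sub>R b))\<^sup>2 = T x \<omega> * T x \<omega> * (a \<bullet> a) -
      2 * (T x \<omega> * T y \<omega> * (a \<bullet> b)) + T y \<omega> * T y \<omega> * (b \<bullet> b)" for \<omega>
    by (simp add: power2_norm_eq_inner inner_diff_left inner_diff_right inner_commute[of b a] algebra_simps)
  show ?thesis
    unfolding ms_norm_def eq using i by (simp add: K_def)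
qed

text \<open>\<open>T\<close> is continuous but \<open>g\<close> is merely integrable, so the two are
  approximated separately: \<open>g\<close> by simple functions \<open>G n\<close> in
  \<open>L^1\<close>, and the point at which \<open>T\<close> is evaluated by simple functions
  \<open>c n\<close>. The product \<open>s n\<close> is simple, and its error splits into one term
  for each approximation.\<close>

lemma has_ms_integral_exists:
  fixes g :: "real^3 \<Rightarrow> 'b :: {banach, second_countable_topology, real_inner}"
  assumes g: "integrable surface_measure g"
  shows "\<exists>I. has_ms_integral M (\<lambda>x \<omega>. T x \<omega> *\<^sub>R g x) I"
proof -
  from g have g_meas [measurable]: "g \<in> borel_measurable surface_measure"
    by simp
  from g obtain G where G: "\<And>n. Bochner_Integration.simple_bochner_integrable surface_measure (G n)"
    and G_lim: "(\<lambda>n. \<integral>\<^sup>+x. norm (g x - G n x) \<partial>surface_measure) \<longlonglongrightarrow> 0"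
    by (auto elim!: integrable.cases has_bochner_integral.cases)
  have G_simple: "simple_function surface_measure (G n)" for n
    using G by (auto elim: simple_bochner_integrable.cases)
  have G_meas [measurable]: "G n \<in> borel_measurable surface_measure" for n
    by (rule borel_measurable_simple_function) (rule G_simple)
  have G_int: "integrable surface_measure (G n)" for n
    by (rule integrable.intros) (rule has_bochner_integral_simple_bochner_integrable[OF G])
  have id_meas: "(\<lambda>x. x) \<in> borel_measurable surface_measure"
    by (intro borel_measurable_surface_measureI continuous_intros)
  obtain F :: "nat \<Rightarrow> real^3 \<Rightarrow> real^3" where F: "\<And>n. simple_function surface_measure (F n)"
    and F_lim: "\<And>x. x \<in> sphere2 \<Longrightarrow> (\<lambda>n. F n x) \<longlonglongrightarrow> x"
    using borel_measurable_implies_sequence_metric[OF id_meas, of 0] by auto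
  \<comment> \<open>The approximations \<open>F n\<close> of the identity may leave the sphere,
    where nothing is known about \<open>T\<close>; \<open>\<phi>\<close> projects them back radially
    and sends 0 to the north pole.\<close>
  define \<phi> :: "real^3 \<Rightarrow> real^3" where "\<phi> = (\<lambda>v. if v = 0 then spherical_point (0, 0) else sgn v)"
  have \<phi>: "\<phi> v \<in> sphere2" for v
    by (simp add: \<phi>_def spherical_point_in_sphere) (simp add: mem_sphere_0 norm_sgn)
  define c where "c = (\<lambda>n x. \<phi> (F n x))"
  have c_simple: "simple_function surface_measure (c n)" for n
    unfolding c_def by (rule simple_function_compose1[OF F])
  have c: "c n x \<in> sphere2" for n x
    by (simp add: c_def \<phi>)
  have c_lim: "(\<lambda>n. c n x) \<longlonglongrightarrow> x" if x: "x \<in> sphere2" for x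
  proof -
    have "x \<noteq> 0" "sgn x = x"
      using x by (auto simp: mem_sphere_0 sgn_div_norm)
    then have "(\<lambda>n. sgn (F n x)) \<longlonglongrightarrow> x"
      using tendsto_sgn[OF F_lim[OF x]] by simp
    moreover have "\<forall>\<^sub>F n in sequentially. sgn (F n x) = c n x"
      using tendsto_imp_eventually_ne[OF F_lim[OF x] \<open>x \<noteq> 0\<close>]
      by eventually_elim (simp add: c_def \<phi>_def)
    ultimately show ?thesis
      by (rule Lim_transform_eventually)
  qed
  have c_meas: "c n \<in> measurable surface_measure (restrict_space borel sphere2)" for n
    using c borel_measurable_simple_function[OF c_simple] by (intro measurable_restrict_space2) auto
  have id_meas': "(\<lambda>x. x) \<in> measurable surface_measure (restrict_space borel sphere2)"
    using id_meas by (intro measurable_restrict_space2) auto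
  have K_meas [measurable]: "(\<lambda>x. K x x) \<in> borel_measurable surface_measure"
    "(\<lambda>x. K x (c n x)) \<in> borel_measurable surface_measure"
    "(\<lambda>x. K (c n x) (c n x)) \<in> borel_measurable surface_measure" for n
    by (intro measurable_K id_meas' c_meas)+
  obtain R where R0: "R \<ge> 0" and R: "\<And>x. x \<in> sphere2 \<Longrightarrow> ms_norm M (T x) \<le> R"
    using ms_norm_bounded by blast
  define s where "s = (\<lambda>n x \<omega>. T (c n x) \<omega> *\<^sub>R G n x)"
  have s_simple: "simple_function surface_measure (s n)" for n
    unfolding s_def by (rule simple_function_compose2[OF c_simple G_simple])
  have s_sq: "square_integrable M (s n x)" for n x
    unfolding s_def by (intro square_integrable_scaleR_left square_integrable c)
  have f_sq: "square_integrable M (\<lambda>\<omega>. T x \<omega> *\<^sub>R g x)" if "x \<in> sphere2" for x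
    by (intro square_integrable_scaleR_left square_integrable that)
  define e where "e = (\<lambda>n x. ms_norm M (\<lambda>\<omega>. T x \<omega> *\<^sub>R g x - s n x \<omega>))"
  define d where "d = (\<lambda>n x. ms_norm M (\<lambda>\<omega>. T x \<omega> - T (c n x) \<omega>))"
  have e_nonneg: "0 \<le> e n x" for n x
    by (simp add: e_def)
  have d_le: "\<bar>d n x\<bar> \<le> 2 * R" if x: "x \<in> sphere2" for n x
    using ms_norm_triangle[OF square_integrable[OF x] square_integrable_scaleR[OF square_integrable[OF c[of n x]], of "-1"]]
      R[OF x] R[OF c[of n x]] by (simp add: d_def ms_norm_def)
  \<comment> \<open>The intermediate variable has the point already changed to \<open>c n x\<close>
    but still the factor \<open>g x\<close>.\<close>
  have e_le: "e n x \<le> d n x * norm (g x) + R * norm (g x - G n x)" if x: "x \<in> sphere2" for n x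
  proof -
    have "e n x \<le> ms_norm M (\<lambda>\<omega>. T x \<omega> *\<^sub>R g x - T (c n x) \<omega> *\<^sub>R g x) +
        ms_norm M (\<lambda>\<omega>. T (c n x) \<omega> *\<^sub>R g x - s n x \<omega>)"
      unfolding e_def
      by (rule ms_norm_triangle_diff) (intro square_integrable_scaleR_left square_integrable c x s_sq)+
    also have "ms_norm M (\<lambda>\<omega>. T x \<omega> *\<^sub>R g x - T (c n x) \<omega> *\<^sub>R g x) = d n x * norm (g x)"
      by (simp add: d_def ms_norm_scaleR_left[symmetric] scaleR_diff_left)
    also have "ms_norm M (\<lambda>\<omega>. T (c n x) \<omega> *\<^sub>R g x - s n x \<omega>) =
        ms_norm M (T (c n x)) * norm (g x - G n x)"
      by (simp add: s_def ms_norm_scaleR_left[symmetric] scaleR_diff_right)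
    finally show ?thesis
      using R[OF c[of n x]] by (meson add_left_mono mult_right_mono norm_ge_zero order_trans)
  qed
  have e_meas: "e n \<in> borel_measurable surface_measure" for n
  proof -
    have "(\<lambda>x. sqrt (K x x * (g x \<bullet> g x) - 2 * (K x (c n x) * (g x \<bullet> G n x)) +
        K (c n x) (c n x) * (G n x \<bullet> G n x))) \<in> borel_measurable surface_measure"
      by measurable
    then show ?thesis
      by (rule measurable_cong[THEN iffD1, rotated])
        (simp add: e_def s_def ms_norm_scaleR_diff c)
  qed
  have d_meas: "d n \<in> borel_measurable surface_measure" for n
  proof -
    have "(\<lambda>x. sqrt (K x x - 2 * K x (c n x) + K (c n x) (c n x))) \<in> borel_measurable surface_measure"
      by measurable
    then show ?thesis
      by (rule measurable_cong[THEN iffD1, rotated])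
        (simp add: d_def c ms_norm_diff_power2[symmetric])
  qed
  \<comment> \<open>Since \<open>g\<close> may be unbounded, pointwise convergence of
    \<open>d n\<close> is combined with the integrable majorant
    \<open>2 * R * norm (g x)\<close>.\<close>
  have dg: "integrable surface_measure (\<lambda>x. d n x * norm (g x))"
    and dg_lim: "(\<lambda>n. \<integral>x. d n x * norm (g x) \<partial>surface_measure) \<longlonglongrightarrow> (\<integral>x. 0 \<partial>surface_measure)" for n
  proof -
    have *: "(\<lambda>x. d n x * norm (g x)) \<in> borel_measurable surface_measure" for n
      using d_meas[of n] by measurable
    have **: "AE x in surface_measure. (\<lambda>n. d n x * norm (g x)) \<longlonglongrightarrow> 0"
      unfolding d_def using c by (intro AE_I2 tendsto_mult_left_zero tendsto_ms_norm_diff c_lim) auto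
    have ***: "AE x in surface_measure. norm (d n x * norm (g x)) \<le> 2 * R * norm (g x)" for n
      using d_le by (intro AE_I2) (simp add: abs_mult mult_right_mono)
    have ****: "integrable surface_measure (\<lambda>x. 2 * R * norm (g x))"
      using g by (intro integrable_mult_right integrable_norm)
    show "integrable surface_measure (\<lambda>x. d n x * norm (g x))"
      by (rule integrable_dominated_convergence2[OF _ * **** ** ***]) simp
    show "(\<lambda>n. \<integral>x. d n x * norm (g x) \<partial>surface_measure) \<longlonglongrightarrow> (\<integral>x. 0 \<partial>surface_measure)"
      by (rule integral_dominated_convergence[OF _ * **** ** ***]) simp
  qed
  have gG: "integrable surface_measure (\<lambda>x. norm (g x - G n x))" for n
    using g G_int by (intro integrable_norm Bochner_Integration.integrable_diff)
  have gG_lim: "(\<lambda>n. \<integral>x. norm (g x - G n x) \<partial>surface_measure) \<longlonglongrightarrow> 0"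
    using G_lim by (simp add: nn_integral_eq_integral[OF gG] ennreal_tendsto_0_iff)
  have bound_int: "integrable surface_measure (\<lambda>x. d n x * norm (g x) + R * norm (g x - G n x))" for n
    by (intro Bochner_Integration.integrable_add dg integrable_mult_right gG)
  have e_int: "integrable surface_measure (e n)" for n
    by (rule Bochner_Integration.integrable_bound[OF bound_int e_meas])
      (use e_le e_nonneg in \<open>auto intro!: AE_I2 order_trans[OF _ abs_ge_self]\<close>)
  have e_lim: "(\<lambda>n. \<integral>x. e n x \<partial>surface_measure) \<longlonglongrightarrow> 0"
  proof (rule null_sequence_le)
    show "0 \<le> (\<integral>x. e n x \<partial>surface_measure)" for n
      by (intro integral_nonneg_AE AE_I2 e_nonneg)
    show "(\<integral>x. e n x \<partial>surface_measure) \<le>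
        (\<integral>x. d n x * norm (g x) \<partial>surface_measure) + R * (\<integral>x. norm (g x - G n x) \<partial>surface_measure)" for n
      using integral_mono[OF e_int bound_int e_le] dg gG by simp
    show "(\<lambda>n. (\<integral>x. d n x * norm (g x) \<partial>surface_measure) +
        R * (\<integral>x. norm (g x - G n x) \<partial>surface_measure)) \<longlonglongrightarrow> 0"
      using dg_lim by (auto intro!: tendsto_eq_intros gG_lim)
  qed
  define I where "I = (\<lambda>n \<omega>. \<Sum>v\<in>s n ` sphere2. measure surface_measure {x \<in> sphere2. s n x = v} *\<^sub>R v \<omega>)"
  have "\<exists>Y. ms_tendsto M I Y"
  proof (rule ms_complete)
    show "square_integrable M (I n)" for n
      unfolding I_def using s_sq by (auto intro!: square_integrable_sum square_integrable_scaleR)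
    fix \<epsilon> :: real assume "\<epsilon> > 0"
    then obtain N where N: "\<And>n. n \<ge> N \<Longrightarrow> (\<integral>x. e n x \<partial>surface_measure) < \<epsilon> / 2"
      using order_tendstoD(2)[OF e_lim, of "\<epsilon> / 2"] by (auto simp: eventually_sequentially)
    have "ms_norm M (\<lambda>\<omega>. I m \<omega> - I n \<omega>) \<le> (\<integral>x. e m x \<partial>surface_measure) + (\<integral>x. e n x \<partial>surface_measure)" for m n
      unfolding I_def e_def
      by (rule ms_norm_simple_ms_integral_diff_le)
        (use f_sq s_simple s_sq e_int in \<open>simp_all add: e_def\<close>)
    then show "\<exists>N. \<forall>m\<ge>N. \<forall>n\<ge>N. ms_norm M (\<lambda>\<omega>. I m \<omega> - I n \<omega>) < \<epsilon>"
      using N by (intro exI[of _ N] allI impI) (smt (verit, best) field_sum_of_halves)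
  qed
  then obtain Y where "ms_tendsto M I Y" ..
  then show ?thesis
    using f_sq s_simple s_sq e_int e_lim unfolding has_ms_integral_def I_def e_def by blast
qed

text \<open>The scalar products with all square-integrable \<open>w\<close> determine the integral almost surely.\<close>

lemma has_ms_integral_scaleR:
  fixes g :: "real^3 \<Rightarrow> 'b :: {banach, second_countable_topology}"
    and w :: "'w \<Rightarrow> 'c :: {banach, second_countable_topology}"
  assumes p: "contractive_bilinear p" and I: "has_ms_integral M (\<lambda>x \<omega>. T x \<omega> *\<^sub>R g x) I"
    and g: "g \<in> borel_measurable surface_measure" and w: "square_integrable M w"
  shows "has_bochner_integral surface_measure (\<lambda>x. p (g x) (\<integral>\<omega>. T x \<omega> *\<^sub>R w \<omega> \<partial>M))
    (\<integral>\<omega>. p (I \<omega>) (w \<omega>) \<partial>M)"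
proof -
  interpret p: contractive_bilinear p by (rule p)
  have eq: "(\<integral>\<omega>. p (T x \<omega> *\<^sub>R g x) (w \<omega>) \<partial>M) = p (g x) (\<integral>\<omega>. T x \<omega> *\<^sub>R w \<omega> \<partial>M)"
    if "x \<in> sphere2" for x
  proof -
    \<comment> \<open>The scalar \<open>T x \<omega>\<close> is real and can move to the test
      variable; what remains is the bounded linear map \<open>p (g x)\<close>, which commutes with
      the expectation.\<close>
    have "p (T x \<omega> *\<^sub>R g x) (w \<omega>) = p (g x) (T x \<omega> *\<^sub>R w \<omega>)" for \<omega>
      by (simp add: p.scaleR_left p.scaleR_right)
    then show ?thesis
      using p.bounded_linear_right[THEN integral_bounded_linear,
          OF cb_scaleR.integrable_product[OF square_integrable[OF that] w]] by simp
  qed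
  have "continuous_on UNIV (\<lambda>(x, y). p x y)"
    by (auto simp: split_beta intro!: p.continuous_on continuous_intros)
  then have "(\<lambda>(x, y). p x y) \<in> borel_measurable (borel \<Otimes>\<^sub>M borel)"
    by (metis borel_measurable_continuous_onI borel_prod)
  from measurable_compose[OF _ this, of "\<lambda>x. (g x, \<integral>\<omega>. T x \<omega> *\<^sub>R w \<omega> \<partial>M)" surface_measure]
  have "(\<lambda>x. p (g x) (\<integral>\<omega>. T x \<omega> *\<^sub>R w \<omega> \<partial>M)) \<in> borel_measurable surface_measure"
    using g borel_measurable_surface_measureI[OF continuous_on_product[OF w]] by simp
  then have "(\<lambda>x. \<integral>\<omega>. p (T x \<omega> *\<^sub>R g x) (w \<omega>) \<partial>M) \<in> borel_measurable surface_measure"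
    by (rule measurable_cong[THEN iffD1, rotated]) (simp add: eq)
  from p.has_ms_integral_product[OF I w this] show ?thesis
    by (rule has_bochner_integral_cong[THEN iffD1, rotated -1]) (simp_all add: eq)
qed

end

section \<open>Legendre polynomials\<close>

lemma pderiv_funpow_Suc: "pderiv ((pderiv ^^ k) p) = (pderiv ^^ Suc k) p"
  by simp

lemma poly_eqI_eval:
  fixes p q :: "real poly"
  assumes "\<And>z. poly p z = poly q z"
  shows "p = q"
  using assms by (simp flip: poly_eq_poly_eq_iff add: fun_eq_iff)

section \<open>The Legendre equation\<close>

text \<open>The power \<open>w\<close> satisfies the first-order equation
  \<open>(z^2 - 1) w' = 2 l z w\<close>. Differentiating it once gives the case
  \<open>k = 0\<close>, and each further derivative raises \<open>k\<close> by 1.\<close>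

lemma Rodrigues_ode:
  fixes w :: "real poly" and l :: nat
  defines "w \<equiv> [:-1, 0, 1:] ^ l"
  shows "[:-1, 0, 1:] * (pderiv ^^ Suc (Suc k)) w + smult (2 * (real k + 1) - 2 * real l) ([:0, 1:] * (pderiv ^^ Suc k) w)
    = smult ((real k + 1) * (2 * real l - real k)) ((pderiv ^^ k) w)"
proof (induction k)
  case 0
  have "[:-1, 0, 1:] * pderiv w = smult (2 * real l) ([:0, 1:] * w)"
  proof (cases l)
    case (Suc n)
    then show ?thesis
      unfolding w_def Suc pderiv_power_Suc
      by (intro poly_eqI_eval) (simp add: pderiv_pCons algebra_simps)
  qed (simp add: w_def)
  then have "pderiv ([:-1, 0, 1:] * pderiv w) = pderiv (smult (2 * real l) ([:0, 1:] * w))"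
    by simp
  then have "poly (pderiv ([:-1, 0, 1:] * pderiv w)) z = poly (pderiv (smult (2 * real l) ([:0, 1:] * w))) z" for z
    by simp
  then have "poly ([:-1, 0, 1:] * (pderiv ^^ Suc (Suc 0)) w + smult (2 * (real 0 + 1) - 2 * real l) ([:0, 1:] * (pderiv ^^ Suc 0) w)) z
    = poly (smult ((real 0 + 1) * (2 * real l - real 0)) ((pderiv ^^ 0) w)) z" for z
    by (simp add: pderiv_mult pderiv_smult pderiv_pCons algebra_simps del: mult_pCons_left mult_pCons_right)
  then show ?case
    by (intro poly_eqI_eval) 
next
  case (Suc k)
  then have "poly (pderiv ([:-1, 0, 1:] * (pderiv ^^ Suc (Suc k)) w + smult (2 * (real k + 1) - 2 * real l) ([:0, 1:] * (pderiv ^^ Suc k) w))) z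
    = poly (pderiv (smult ((real k + 1) * (2 * real l - real k)) ((pderiv ^^ k) w))) z" for z
    by simp
  then have "poly ([:-1, 0, 1:] * (pderiv ^^ Suc (Suc (Suc k))) w + smult (2 * (real (Suc k) + 1) - 2 * real l) ([:0, 1:] * (pderiv ^^ Suc (Suc k)) w)) z
    = poly (smult ((real (Suc k) + 1) * (2 * real l - real (Suc k))) ((pderiv ^^ Suc k) w)) z" for z
    by (simp add: pderiv_mult pderiv_smult pderiv_add pderiv_pCons algebra_simps del: mult_pCons_left mult_pCons_right)
  then show ?case
    by (intro poly_eqI_eval)
qed

abbreviation Legendre_deriv :: "nat \<Rightarrow> nat \<Rightarrow> real poly" where
  "Legendre_deriv l k \<equiv> (pderiv ^^ k) (Legendre_poly l)"

lemma Legendre_deriv_Rodrigues: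
  "Legendre_deriv l k = smult (1 / (2 ^ l * fact l)) ((pderiv ^^ (k + l)) ([:-1, 0, 1:] ^ l))"
  by (simp only: Legendre_poly_def higher_pderiv_smult funpow_add o_def)

text \<open>The case \<open>k + l\<close> of \<open>Rodrigues_ode\<close>: there
  \<open>2 (k + l + 1) - 2 l = 2 (k + 1)\<close>, and the factor on the right becomes
  \<open>(k + l + 1) (l - k)\<close>.\<close>

lemma Legendre_ode:
  "(z\<^sup>2 - 1) * poly (Legendre_deriv l (Suc (Suc k))) z + 2 * (real k + 1) * z * poly (Legendre_deriv l (Suc k)) z =
    (real l + real k + 1) * (real l - real k) * poly (Legendre_deriv l k) z"
proof -
  obtain c :: real where c: "c = 1 / (2 ^ l * fact l)"
    by blast
  let ?W = "\<lambda>j. poly ((pderiv ^^ j) ([:-1, 0, 1:] ^ l)) z"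
  have "(z\<^sup>2 - 1) * ?W (Suc (Suc (k + l))) + 2 * (real k + 1) * z * ?W (Suc (k + l)) =
    (real l + real k + 1) * (real l - real k) * ?W (k + l)"
    using arg_cong[OF Rodrigues_ode[where l = l and k = "k + l"], of "\<lambda>p. poly p z"]
    by (simp add: algebra_simps power2_eq_square del: funpow.simps mult_pCons_left mult_pCons_right)
  then have "c * ((z\<^sup>2 - 1) * ?W (Suc (Suc (k + l))) + 2 * (real k + 1) * z * ?W (Suc (k + l))) =
    c * ((real l + real k + 1) * (real l - real k) * ?W (k + l))"
    by simp
  then show ?thesis
    unfolding Legendre_deriv_Rodrigues c[symmetric] by (simp add: algebra_simps del: funpow.simps)
qed

lemma degree_higher_pderiv_le: "degree ((pderiv ^^ k) p) = degree p - k" for p :: "real poly"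
  by (induction k) (simp_all add: degree_pderiv)

lemma Legendre_deriv_eq_0: "Legendre_deriv l (Suc l) = 0"
proof -
  have "degree ([:-1, 0, 1:] ^ l :: real poly) = 2 * l"
    by (simp add: degree_power_eq)
  then have "degree ((pderiv ^^ (l + l)) ([:-1, 0, 1:] ^ l) :: real poly) = 0"
    by (simp add: degree_higher_pderiv_le)
  then have "(pderiv ^^ Suc (l + l)) ([:-1, 0, 1:] ^ l :: real poly) = 0"
    by (simp add: pderiv_eq_0_iff)
  then show ?thesis
    unfolding Legendre_deriv_Rodrigues by simp
qed

text \<open>The cofactor \<open>q\<close> is generalised: one derivative leaves the power
  \<open>n\<close> times a new cofactor, whose value at \<open>c\<close> is \<open>Suc n\<close>
  times that of \<open>q\<close>.\<close>

lemma higher_pderiv_linear_power: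
  "poly ((pderiv ^^ n) ([:-c, 1:] ^ n * q)) c = fact n * poly q c" for c :: real
proof (induction n arbitrary: q)
  case (Suc n)
  have "pderiv ([:-c, 1:] ^ Suc n * q) = [:-c, 1:] ^ n * (smult (real (Suc n)) q + [:-c, 1:] * pderiv q)"
    by (simp only: pderiv_mult pderiv_power_Suc) (simp add: pderiv_pCons algebra_simps)
  then show ?case
    by (simp only: funpow_Suc_right o_def Suc.IH) (simp add: algebra_simps)
qed simp

text \<open>Splitting \<open>x^2 - 1\<close> into \<open>(x - 1) (x + 1)\<close> gives the value
  \<open>l! 2^l\<close> at 1, which the constant in Rodrigues' formula cancels.\<close>

lemma Legendre_poly_1: "poly (Legendre_poly l) 1 = 1"
proof -
  have "[:-1, 0, 1:] = [:-1, 1:] * [:1, 1 :: real:]"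
    by simp
  then have "([:-1, 0, 1:] :: real poly) ^ l = [:-1, 1:] ^ l * [:1, 1:] ^ l"
    by (simp only: power_mult_distrib)
  then show ?thesis
    using higher_pderiv_linear_power[of l 1 "[:1, 1:] ^ l"]
    by (simp add: Legendre_poly_def)
qed

section \<open>The zonal sum and its rotation invariance\<close>

text \<open>The squared normalising factor of the harmonic of order \<open>k\<close>, apart from
  \<open>(2 * l + 1) / (4 * pi)\<close>, which depends on the degree only.\<close>

definition harmonic_weight :: "nat \<Rightarrow> nat \<Rightarrow> real" where
  "harmonic_weight l k = fact (l - k) / fact (l + k)"

lemma harmonic_weight_0 [simp]: "harmonic_weight l 0 = 1"
  by (simp add: harmonic_weight_def)

lemma harmonic_weight_nonneg: "0 \<le> harmonic_weight l k"
  by (simp add: harmonic_weight_def)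

text \<open>The factor is the coefficient in \<open>Legendre_ode\<close>. Its absorption by the
  weights makes both the derivative of the zonal sum telescope and the recursion of
  \<open>assoc_inner\<close> collapse.\<close>

lemma harmonic_weight_Suc:
  assumes "k < l"
  shows "harmonic_weight l (Suc k) * ((real l + real k + 1) * (real l - real k)) = harmonic_weight l k"
proof -
  have "l - k = Suc (l - Suc k)"
    using assms by simp
  then have "fact (l - k) = (real l - real k) * fact (l - Suc k)"
    using assms by (simp add: of_nat_diff)
  moreover have "fact (l + Suc k) = (real l + real k + 1) * fact (l + k)" "real l + real k + 1 \<noteq> 0"
    by (simp_all add: add_nonneg_eq_0_iff)
  ultimately show ?thesis
    unfolding harmonic_weight_def by (simp only:) (simp add: divide_simps del: fact_Suc)
qed

text \<open>
  Up to normalisation the value of \<open>Y_{lk}\<close> at the point with coordinates \<open>(Re u, Im u, z)\<close>.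
\<close>

definition solid :: "nat \<Rightarrow> nat \<Rightarrow> complex \<Rightarrow> real \<Rightarrow> complex" where
  "solid l k u z = u ^ k * complex_of_real (poly (Legendre_deriv l k) z)"

text \<open>The sum over all orders in real form, without the factor
  \<open>(2 * l + 1) / (4 * pi)\<close>: orders \<open>k\<close> and \<open>-k\<close> give
  conjugate terms, whence twice the real part for \<open>k > 0\<close>.\<close>

definition zonal :: "nat \<Rightarrow> complex \<Rightarrow> real \<Rightarrow> complex \<Rightarrow> real \<Rightarrow> real" where
  "zonal l u z v w = Re (solid l 0 u z * cnj (solid l 0 v w)) +
     (\<Sum>k = 1..l. 2 * harmonic_weight l k * Re (solid l k u z * cnj (solid l k v w)))"

text \<open>The hypotheses describe a rotation in the plane of the first and third axes: the real
  part of \<open>u\<close> changes at rate \<open>z\<close>, and its imaginary part is constant. At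
  \<open>k = 0\<close> the truncated exponent \<open>k - 1\<close> is harmless, because its term
  carries the factor \<open>k\<close>.\<close>

lemma solid_has_vector_derivative:
  assumes u: "(u has_vector_derivative complex_of_real (z t)) (at t)"
    and z: "(z has_real_derivative - Re (u t)) (at t)"
  shows "((\<lambda>t. solid l k (u t) (z t)) has_vector_derivative
    of_nat k * complex_of_real (z t) * u t ^ (k - 1) * complex_of_real (poly (Legendre_deriv l k) (z t))
     - complex_of_real (Re (u t)) * u t ^ k * complex_of_real (poly (Legendre_deriv l (Suc k)) (z t))) (at t)"
proof -
  have "((\<lambda>u. u ^ k) has_field_derivative of_nat k * u t ^ (k - 1)) (at (u t))"
    by (auto intro!: derivative_eq_intros)
  from field_vector_diff_chain_at[OF u this]
  have 1: "((\<lambda>t. u t ^ k) has_vector_derivative complex_of_real (z t) * (of_nat k * u t ^ (k - 1))) (at t)"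
    by (simp add: o_def)
  have "((\<lambda>t. poly (Legendre_deriv l k) (z t)) has_real_derivative
      poly (Legendre_deriv l (Suc k)) (z t) * - Re (u t)) (at t)"
    using DERIV_chain2[OF poly_DERIV z] by simp
  then have 2: "((\<lambda>t. complex_of_real (poly (Legendre_deriv l k) (z t))) has_vector_derivative
      complex_of_real (poly (Legendre_deriv l (Suc k)) (z t) * - Re (u t))) (at t)"
    by (intro has_vector_derivative_of_real) (simp add: has_real_derivative_iff_has_vector_derivative)
  show ?thesis
    unfolding solid_def
    by (rule has_vector_derivative_eq_rhs[OF has_vector_derivative_mult[OF 1 2]]) (simp add: algebra_simps)
qed

text \<open>At order 0 the lower neighbour would have order \<open>-1\<close>; the conjugate of
  order 1 stands for it.\<close>

lemma solid_derivative_0: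
  "complex_of_real (Re u) * complex_of_real (poly (Legendre_deriv l (Suc 0)) z) =
   (solid l 1 u z + cnj (solid l 1 u z)) / 2"
  by (simp add: solid_def complex_eq_iff)

text \<open>A ladder relation. On the sphere \<open>u * cnj u = 1 - z^2\<close>, so
  \<open>Re u * u ^ Suc k\<close> is a combination of \<open>u ^ (k + 2)\<close> and
  \<open>(1 - z^2) * u ^ k\<close>; the Legendre equation absorbs the factor \<open>1 - z^2\<close>,
  and only the neighbouring orders \<open>k\<close> and \<open>k + 2\<close> remain.\<close>

lemma solid_derivative_Suc:
  assumes "(norm u)\<^sup>2 + z\<^sup>2 = 1"
  shows "of_nat (Suc k) * complex_of_real z * u ^ k * complex_of_real (poly (Legendre_deriv l (Suc k)) z)
     - complex_of_real (Re u) * u ^ Suc k * complex_of_real (poly (Legendre_deriv l (Suc (Suc k))) z) =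
     (complex_of_real ((real l + real k + 1) * (real l - real k)) * solid l k u z - solid l (Suc (Suc k)) u z) / 2"
proof -
  have "u * cnj u = complex_of_real (1 - z\<^sup>2)"
  proof -
    have "(norm u)\<^sup>2 = 1 - z\<^sup>2"
      using assms by simp
    then show ?thesis
      by (simp only: complex_norm_square[symmetric])
  qed
  moreover have "complex_of_real (Re u) = (u + cnj u) / 2"
    by (simp add: complex_eq_iff)
  then have "complex_of_real (Re u) * u ^ Suc k = (u ^ Suc (Suc k) + (u * cnj u) * u ^ k) / 2"
    by (simp only:) (simp add: algebra_simps)
  ultimately have re: "complex_of_real (Re u) * u ^ Suc k = (u ^ Suc (Suc k) + complex_of_real (1 - z\<^sup>2) * u ^ k) / 2"
    by simp
  let ?q = "\<lambda>k. complex_of_real (poly (Legendre_deriv l k) z)"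
  have "complex_of_real ((real l + real k + 1) * (real l - real k)) * ?q k =
      complex_of_real ((z\<^sup>2 - 1) * poly (Legendre_deriv l (Suc (Suc k))) z
        + 2 * (real k + 1) * z * poly (Legendre_deriv l (Suc k)) z)"
    unfolding Legendre_ode by simp
  also have "\<dots> = 2 * of_nat (Suc k) * complex_of_real z * ?q (Suc k) -
      complex_of_real (1 - z\<^sup>2) * ?q (Suc (Suc k))"
    by (simp add: algebra_simps del: funpow.simps)
  finally have ode: "complex_of_real ((real l + real k + 1) * (real l - real k)) * ?q k =
      2 * of_nat (Suc k) * complex_of_real z * ?q (Suc k) - complex_of_real (1 - z\<^sup>2) * ?q (Suc (Suc k))" .
  have sol: "complex_of_real ((real l + real k + 1) * (real l - real k)) * solid l k u z =
      u ^ k * (2 * of_nat (Suc k) * complex_of_real z * ?q (Suc k) - complex_of_real (1 - z\<^sup>2) * ?q (Suc (Suc k)))"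
    by (simp only: ode[symmetric] solid_def) (simp add: algebra_simps del: funpow.simps)
  show ?thesis
    unfolding re sol by (simp add: solid_def field_simps del: funpow.simps of_nat_Suc)
qed

text \<open>
  The zonal sum is invariant under simultaneous rotation of both points about the second axis:
  by the Legendre equation its derivative telescopes.
\<close>

lemma zonal_has_derivative_0:
  assumes u: "(u has_vector_derivative complex_of_real (z t)) (at t)"
    and z: "(z has_real_derivative - Re (u t)) (at t)" and uz: "(norm (u t))\<^sup>2 + (z t)\<^sup>2 = 1"
    and v: "(v has_vector_derivative complex_of_real (w t)) (at t)"
    and w: "(w has_real_derivative - Re (v t)) (at t)" and vw: "(norm (v t))\<^sup>2 + (w t)\<^sup>2 = 1"
  shows "((\<lambda>t. zonal l (u t) (z t) (v t) (w t)) has_real_derivative 0) (at t)"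
proof -
  define y where "y = (\<lambda>k. solid l k (u t) (z t))"
  define x where "x = (\<lambda>k. solid l k (v t) (w t))"
  define c where "c = harmonic_weight l"
  define a where "a = (\<lambda>k. (real l + real k + 1) * (real l - real k))"
  define dy where "dy = (\<lambda>k. if k = 0 then - (y 1 + cnj (y 1)) / 2
    else (complex_of_real (a (k - 1)) * y (k - 1) - y (Suc k)) / 2)"
  define dx where "dx = (\<lambda>k. if k = 0 then - (x 1 + cnj (x 1)) / 2
    else (complex_of_real (a (k - 1)) * x (k - 1) - x (Suc k)) / 2)"
  have dy: "((\<lambda>t. solid l k (u t) (z t)) has_vector_derivative dy k) (at t)" for k
  proof (cases k)
    case 0
    have "dy 0 = - (complex_of_real (Re (u t)) * complex_of_real (poly (Legendre_deriv l (Suc 0)) (z t)))"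
      unfolding solid_derivative_0 by (simp add: dy_def y_def field_simps del: funpow.simps)
    then show ?thesis
      using solid_has_vector_derivative[OF u z, of l 0] by (simp add: 0 del: funpow.simps)
  next
    case (Suc j)
    show ?thesis
      using solid_has_vector_derivative[OF u z, of l k]
      unfolding Suc diff_Suc_1 solid_derivative_Suc[OF uz]
      by (simp add: dy_def y_def a_def del: funpow.simps)
  qed
  have dx: "((\<lambda>t. solid l k (v t) (w t)) has_vector_derivative dx k) (at t)" for k
  proof (cases k)
    case 0
    have "dx 0 = - (complex_of_real (Re (v t)) * complex_of_real (poly (Legendre_deriv l (Suc 0)) (w t)))"
      unfolding solid_derivative_0 by (simp add: dx_def x_def field_simps del: funpow.simps)
    then show ?thesis
      using solid_has_vector_derivative[OF v w, of l 0] by (simp add: 0 del: funpow.simps)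
  next
    case (Suc j)
    show ?thesis
      using solid_has_vector_derivative[OF v w, of l k]
      unfolding Suc diff_Suc_1 solid_derivative_Suc[OF vw]
      by (simp add: dx_def x_def a_def del: funpow.simps)
  qed
  have d: "((\<lambda>t. Re (solid l k (u t) (z t) * cnj (solid l k (v t) (w t)))) has_real_derivative
      Re (y k * cnj (dx k) + dy k * cnj (x k))) (at t)" for k
    unfolding has_real_derivative_iff_has_vector_derivative x_def y_def
    by (intro bounded_linear.has_vector_derivative[OF bounded_linear_Re] has_vector_derivative_mult
        has_vector_derivative_cnj dx dy)
  \<comment> \<open>\<open>R k\<close> mixes the orders \<open>k\<close> and \<open>k + 1\<close>;
    the weighted derivative of each summand of positive order is a difference of two consecutive
    mixed terms.\<close>
  define R where "R = (\<lambda>k. Re (y k * cnj (x (Suc k)) + y (Suc k) * cnj (x k)))"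
  have real0: "Im (y 0) = 0" "Im (x 0) = 0"
    by (simp_all add: y_def x_def solid_def)
  have first: "Re (y 0 * cnj (dx 0) + dy 0 * cnj (x 0)) = - R 0"
    using real0 by (simp add: dx_def dy_def R_def)
  have step: "2 * c (Suc k) * Re (y (Suc k) * cnj (dx (Suc k)) + dy (Suc k) * cnj (x (Suc k))) =
      c k * R k - c (Suc k) * R (Suc k)" if "k < l" for k
  proof -
    have "2 * dx (Suc k) = complex_of_real (a k) * x k - x (Suc (Suc k))"
      "2 * dy (Suc k) = complex_of_real (a k) * y k - y (Suc (Suc k))"
      by (simp_all add: dx_def dy_def)
    moreover have "2 * Re (y (Suc k) * cnj (dx (Suc k)) + dy (Suc k) * cnj (x (Suc k))) =
        Re (y (Suc k) * cnj (2 * dx (Suc k)) + 2 * dy (Suc k) * cnj (x (Suc k)))"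
      by (simp add: algebra_simps)
    ultimately have "2 * Re (y (Suc k) * cnj (dx (Suc k)) + dy (Suc k) * cnj (x (Suc k))) = a k * R k - R (Suc k)"
      by (simp only:) (simp add: R_def algebra_simps)
    moreover have "2 * E = X \<Longrightarrow> 2 * r * E = r * X" for r E X :: real
      by auto
    ultimately have "2 * c (Suc k) * Re (y (Suc k) * cnj (dx (Suc k)) + dy (Suc k) * cnj (x (Suc k))) =
        c (Suc k) * (a k * R k - R (Suc k))"
      by blast
    moreover have "c (Suc k) * a k = c k"
      using harmonic_weight_Suc[OF that] by (simp add: c_def a_def)
    ultimately show ?thesis
      by (simp only: right_diff_distrib mult.assoc[symmetric])
  qed
  have "(\<Sum>k = 1..l. 2 * c k * Re (y k * cnj (dx k) + dy k * cnj (x k))) =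
      (\<Sum>k<l. c k * R k - c (Suc k) * R (Suc k))"
  proof -
    have "{1..l} = Suc ` {..<l}"
      by (simp add: lessThan_atLeast0 image_Suc_atLeastLessThan atLeastLessThanSuc_atLeastAtMost)
    then show ?thesis
      using step by (simp add: sum.reindex)
  qed
  also have "\<dots> = c 0 * R 0 - c l * R l"
    by (rule sum_lessThan_telescope')
  \<comment> \<open>The derivative of order \<open>l + 1\<close> of \<open>P_l\<close> vanishes,
    which removes the upper end of the telescoping sum; the lower end \<open>c 0 * R 0\<close>
    cancels against the summand of order 0.\<close>
  also have "R l = 0"
    by (simp add: R_def x_def y_def solid_def Legendre_deriv_eq_0 del: funpow.simps)
  finally have "Re (y 0 * cnj (dx 0) + dy 0 * cnj (x 0)) +
      (\<Sum>k = 1..l. 2 * c k * Re (y k * cnj (dx k) + dy k * cnj (x k))) = 0"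
    using first by (simp add: c_def)
  moreover have "((\<lambda>t. zonal l (u t) (z t) (v t) (w t)) has_real_derivative
      Re (y 0 * cnj (dx 0) + dy 0 * cnj (x 0)) +
      (\<Sum>k = 1..l. 2 * c k * Re (y k * cnj (dx k) + dy k * cnj (x k)))) (at t)"
    unfolding zonal_def c_def by (intro DERIV_add DERIV_sum DERIV_cmult d)
  ultimately show ?thesis
    by simp
qed

text \<open>Here the second point has second coordinate 0, so a rotation about the second axis alone
  takes it to the pole.\<close>

lemma zonal_real:
  assumes uz: "(norm u)\<^sup>2 + z\<^sup>2 = 1"
  shows "zonal l u z (complex_of_real (sin \<tau>)) (cos \<tau>) = poly (Legendre_poly l) (Re u * sin \<tau> + z * cos \<tau>)"
proof -
  \<comment> \<open>\<open>U\<close> and \<open>Z\<close> are the coordinates of the point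
    \<open>(x, y, z)\<close> after rotation by the angle \<open>t\<close>.\<close>
  define U where "U = (\<lambda>(x::real) y z t. Complex (x * cos t + z * sin t) y)"
  define Z where "Z = (\<lambda>(x::real) z t. - x * sin t + z * cos t :: real)"
  have dU: "(U x y z has_vector_derivative complex_of_real (Z x z t)) (at t)" for x y z t
  proof -
    have "((\<lambda>t. complex_of_real (x * cos t + z * sin t)) has_vector_derivative complex_of_real (Z x z t)) (at t)"
      unfolding Z_def
      by (intro has_vector_derivative_of_real) (auto intro!: derivative_eq_intros
          simp: has_real_derivative_iff_has_vector_derivative[symmetric])
    from has_vector_derivative_add[OF this has_vector_derivative_const[of "Complex 0 y"]]
    have "((\<lambda>t. complex_of_real (x * cos t + z * sin t) + Complex 0 y) has_vector_derivative complex_of_real (Z x z t)) (at t)"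
      by simp
    also have "(\<lambda>t. complex_of_real (x * cos t + z * sin t) + Complex 0 y) = U x y z"
      by (simp add: U_def fun_eq_iff complex_eq_iff)
    finally show ?thesis .
  qed
  have dZ: "(Z x z has_real_derivative - Re (U x y z t)) (at t)" for x y z t
    unfolding Z_def U_def by (auto intro!: derivative_eq_intros)
  have nrm: "(norm (U x y z t))\<^sup>2 + (Z x z t)\<^sup>2 = 1" if "x\<^sup>2 + y\<^sup>2 + z\<^sup>2 = 1" for x y z t
  proof -
    have "(x * cos t + z * sin t)\<^sup>2 + y\<^sup>2 + (- x * sin t + z * cos t)\<^sup>2 = 1"
      using that sin_cos_squared_add[of t] by algebra
    then show ?thesis
      by (simp add: U_def Z_def cmod_power2)
  qed
  let ?f = "\<lambda>t. zonal l (U (Re u) (Im u) z t) (Z (Re u) z t) (U (sin \<tau>) 0 (cos \<tau>) t) (Z (sin \<tau>) (cos \<tau>) t)"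
  have "DERIV ?f t :> 0" for t
  proof (rule zonal_has_derivative_0[OF dU dZ _ dU dZ])
    show "(norm (U (Re u) (Im u) z t))\<^sup>2 + (Z (Re u) z t)\<^sup>2 = 1"
      using uz by (intro nrm) (simp add: cmod_power2)
    show "(norm (U (sin \<tau>) 0 (cos \<tau>) t))\<^sup>2 + (Z (sin \<tau>) (cos \<tau>) t)\<^sup>2 = 1"
      by (intro nrm) simp
  qed
  then have "?f 0 = ?f (- \<tau>)"
    by (intro DERIV_isconst_all) auto
  moreover have "U (Re u) (Im u) z 0 = u" "Z (Re u) z 0 = z"
    "U (sin \<tau>) 0 (cos \<tau>) 0 = complex_of_real (sin \<tau>)" "Z (sin \<tau>) (cos \<tau>) 0 = cos \<tau>"
    by (simp_all add: U_def Z_def complex_eq_iff)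
  \<comment> \<open>The angle \<open>-\<tau>\<close> moves the second point to the pole, and the
    third coordinate of the first point becomes the inner product of the two.\<close>
  moreover have "U (sin \<tau>) 0 (cos \<tau>) (- \<tau>) = 0" "Z (sin \<tau>) (cos \<tau>) (- \<tau>) = 1"
    "Z (Re u) z (- \<tau>) = Re u * sin \<tau> + z * cos \<tau>"
    by (simp_all add: U_def Z_def complex_eq_iff flip: power2_eq_square)
  moreover have "zonal l u' z' 0 1 = poly (Legendre_poly l) z'" for u' z'
    by (auto simp: zonal_def solid_def Legendre_poly_1 power_0_left intro!: sum.neutral)
  ultimately show ?thesis
    by simp
qed

text \<open>A rotation about the third axis multiplies \<open>u\<close> and \<open>v\<close> by the
  same unit \<open>e\<close> and leaves each \<open>u ^ k * cnj (v ^ k)\<close> unchanged. With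
  \<open>e = cis (- Arg v)\<close> the second point takes the form treated in
  \<open>zonal_real\<close>.\<close>

lemma zonal_eq:
  assumes uz: "(norm u)\<^sup>2 + z\<^sup>2 = 1" and vw: "(norm v)\<^sup>2 + w\<^sup>2 = 1"
  shows "zonal l u z v w = poly (Legendre_poly l) (Re (u * cnj v) + z * w)"
proof -
  obtain \<tau> where \<tau>: "norm v = sin \<tau>" "w = cos \<tau>"
    using sincos_total_2pi[of w "norm v"] vw by (metis add.commute)
  define e where "e = cis (- Arg v)"
  have e: "norm e = 1" "e * cnj e = 1"
    by (simp_all add: e_def cis_cnj cis_mult)
  have v: "e * v = complex_of_real (sin \<tau>)"
    using rcis_cmod_Arg[of v] by (metis e_def \<tau>(1) cis_mult[of "- Arg v" "Arg v"] rcis_def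
        add.left_inverse cis_zero mult.left_commute mult.right_neutral)
  have inv: "(e * u) ^ k * cnj ((e * v) ^ k) = u ^ k * cnj (v ^ k)" for k
  proof -
    have "(e * u) ^ k * cnj ((e * v) ^ k) = (e * cnj e) ^ k * (u ^ k * cnj (v ^ k))"
      by (simp add: power_mult_distrib algebra_simps)
    then show ?thesis
      by (simp add: e)
  qed
  have "solid l k a z * cnj (solid l k b w) = a ^ k * cnj (b ^ k) *
      complex_of_real (poly (Legendre_deriv l k) z * poly (Legendre_deriv l k) w)" for k a b
    by (simp add: solid_def)
  then have "solid l k (e * u) z * cnj (solid l k (e * v) w) = solid l k u z * cnj (solid l k v w)" for k
    by (simp only: inv)
  then have "zonal l u z v w = zonal l (e * u) z (e * v) w"
    by (simp add: zonal_def)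
  also have "\<dots> = poly (Legendre_poly l) (Re (e * u) * sin \<tau> + z * cos \<tau>)"
    unfolding v \<tau>(2) using uz by (intro zonal_real) (simp add: norm_mult e)
  also have "Re (e * u) * sin \<tau> = Re ((e * u) * cnj (e * v))"
    by (simp add: v)
  also have "\<dots> = Re (u * cnj v)"
    by (simp only: inv[of 1, unfolded power_one_right])
  finally show ?thesis
    by (simp add: \<tau>(2))
qed

section \<open>Spherical harmonics\<close>

definition equatorial :: "real^3 \<Rightarrow> complex" where
  "equatorial x = Complex (x $ 1) (x $ 2)"

lemma equatorial_sphere: "x \<in> sphere2 \<Longrightarrow> (norm (equatorial x))\<^sup>2 + (x $ 3)\<^sup>2 = 1"
  by (simp add: equatorial_def sphere2_iff cmod_power2)

lemma inner_equatorial: "x \<bullet> y = Re (equatorial x * cnj (equatorial y)) + x $ 3 * y $ 3"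
  by (simp add: equatorial_def inner_real3)

lemma abs_nth_le_1: "x \<in> sphere2 \<Longrightarrow> \<bar>x $ i\<bar> \<le> 1"
  using component_le_norm_cart[of x i] by (simp add: mem_sphere_0)

lemma abs_inner_le_1: "x \<in> sphere2 \<Longrightarrow> y \<in> sphere2 \<Longrightarrow> \<bar>x \<bullet> y\<bar> \<le> 1"
  using Cauchy_Schwarz_ineq2[of x y] by (simp add: mem_sphere_0)

lemma cos_great_circle_dist: "x \<in> sphere2 \<Longrightarrow> y \<in> sphere2 \<Longrightarrow> cos (great_circle_dist x y) = x \<bullet> y"
  using abs_inner_le_1[of x y] by (simp add: great_circle_dist_def cos_arccos_abs)

definition harmonic_const :: "nat \<Rightarrow> nat \<Rightarrow> real" where
  "harmonic_const l k = (-1) ^ k * sqrt ((2 * real l + 1) / (4 * pi) * harmonic_weight l k)"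

lemma harmonic_const_power2: "(harmonic_const l k)\<^sup>2 = (2 * real l + 1) / (4 * pi) * harmonic_weight l k"
  by (simp add: harmonic_const_def power_mult_distrib harmonic_weight_nonneg flip: power_mult)

text \<open>The powers of \<open>sin \<theta>\<close> and of the phase combine to a power of
  \<open>equatorial x\<close>. In this form the jump of \<open>Arg\<close> and its conventional
  value at the poles have disappeared, and continuity is evident.\<close>

lemma sph_harmonic_of_nat:
  assumes x: "x \<in> sphere2"
  shows "sph_harmonic l (int k) x = complex_of_real (harmonic_const l k) * solid l k (equatorial x) (x $ 3)"
proof -
  have "1 - (x $ 3)\<^sup>2 = (norm (equatorial x))\<^sup>2"
    using equatorial_sphere[OF x] by simp
  then have s: "sqrt (1 - (x $ 3)\<^sup>2) = norm (equatorial x)"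
    by simp
  have "equatorial x ^ k = rcis (norm (equatorial x)) (Arg (equatorial x)) ^ k"
    by (simp add: rcis_cmod_Arg)
  also have "\<dots> = complex_of_real (norm (equatorial x) ^ k) * cis (real k * Arg (equatorial x))"
    by (simp only: DeMoivre2) (simp add: rcis_def)
  finally show ?thesis
    using abs_nth_le_1[OF x, of 3]
    by (simp add: sph_harmonic_def Let_def equatorial_def[symmetric] assoc_Legendre_def s
        cos_arccos_abs solid_def harmonic_const_def harmonic_weight_def)
qed

lemma sph_harmonic_minus:
  assumes "k > 0"
  shows "sph_harmonic l (- int k) x = (-1) ^ k * cnj (sph_harmonic l (int k) x)"
  using assms by (simp add: sph_harmonic_def Let_def)

lemma sum_symmetric_int:
  fixes f :: "int \<Rightarrow> 'a :: comm_monoid_add"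
  shows "(\<Sum>m = - int l..int l. f m) = f 0 + (\<Sum>k = 1..l. f (int k) + f (- int k))"
proof (induction l)
  case (Suc l)
  have "{- int (Suc l)..int (Suc l)} = insert (int (Suc l)) (insert (- int (Suc l)) {- int l..int l})"
    by auto
  then have "(\<Sum>m = - int (Suc l)..int (Suc l). f m) =
      f (int (Suc l)) + (f (- int (Suc l)) + (\<Sum>m = - int l..int l. f m))"
    by (simp only:) (subst sum.insert; simp)+
  then show ?case
    by (simp only: Suc.IH) (simp add: ac_simps)
qed simp

section \<open>The addition theorem and bounds from it\<close>

text \<open>The terms of orders \<open>k\<close> and \<open>-k\<close> are conjugate, so their sum
  is twice a real part and the whole is a multiple of \<open>zonal\<close>, which
  \<open>zonal_eq\<close> evaluates.\<close>

theorem addition_theorem: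
  assumes x: "x \<in> sphere2" and y: "y \<in> sphere2"
  shows "(\<Sum>m = - int l..int l. sph_harmonic l m x * cnj (sph_harmonic l m y)) =
    complex_of_real ((2 * real l + 1) / (4 * pi) * poly (Legendre_poly l) (x \<bullet> y))"
proof -
  let ?c = "(2 * real l + 1) / (4 * pi)"
  let ?p = "\<lambda>k. solid l k (equatorial x) (x $ 3) * cnj (solid l k (equatorial y) (y $ 3))"
  have pos: "sph_harmonic l (int k) x * cnj (sph_harmonic l (int k) y) =
      complex_of_real (?c * harmonic_weight l k) * ?p k" for k
  proof -
    have "sph_harmonic l (int k) x * cnj (sph_harmonic l (int k) y) =
        complex_of_real ((harmonic_const l k)\<^sup>2) * ?p k"
      by (simp add: sph_harmonic_of_nat[OF x] sph_harmonic_of_nat[OF y] power2_eq_square)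
    then show ?thesis
      by (simp only: harmonic_const_power2)
  qed
  have neg: "sph_harmonic l (- int k) x * cnj (sph_harmonic l (- int k) y) =
      cnj (sph_harmonic l (int k) x * cnj (sph_harmonic l (int k) y))" if "k > 0" for k
    using that by (simp add: sph_harmonic_minus flip: power_mult_distrib)
  have pair: "sph_harmonic l (int k) x * cnj (sph_harmonic l (int k) y) +
      sph_harmonic l (- int k) x * cnj (sph_harmonic l (- int k) y) =
      complex_of_real (?c * (2 * harmonic_weight l k * Re (?p k)))" if "k > 0" for k
  proof -
    have re: "Re (complex_of_real r * z) = r * Re z" for r z
      by simp
    show ?thesis
      unfolding neg[OF that] complex_add_cnj pos re by (simp only: mult_ac)
  qed
  have "?p 0 = complex_of_real (Re (?p 0))"
    by (simp add: solid_def)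
  then have zero: "sph_harmonic l 0 x * cnj (sph_harmonic l 0 y) = complex_of_real (?c * Re (?p 0))"
    using pos[of 0] by simp
  have "(\<Sum>m = - int l..int l. sph_harmonic l m x * cnj (sph_harmonic l m y)) =
      complex_of_real (?c * Re (?p 0)) +
      (\<Sum>k = 1..l. complex_of_real (?c * (2 * harmonic_weight l k * Re (?p k))))"
    unfolding sum_symmetric_int zero by (intro arg_cong2[of _ _ _ _ "(+)"] sum.cong refl pair) simp
  also have "\<dots> = complex_of_real (?c * zonal l (equatorial x) (x $ 3) (equatorial y) (y $ 3))"
    unfolding zonal_def by (simp only: of_real_add[symmetric] of_real_sum[symmetric] sum_distrib_left distrib_left)
  also have "\<dots> = complex_of_real (?c * poly (Legendre_poly l) (x \<bullet> y))"
    by (simp add: zonal_eq equatorial_sphere x y inner_equatorial)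
  finally show ?thesis .
qed

text \<open>On the diagonal the addition theorem gives \<open>(2 * l + 1) / (4 * pi)\<close> as the
  sum of the squared moduli; off the diagonal \<open>2 a b \<le> a^2 + b^2\<close> bounds the sum by
  the same number. The bound later provides a majorant for the covariance series.\<close>

lemma abs_Legendre_poly_le_1:
  assumes x: "x \<in> sphere2" and y: "y \<in> sphere2"
  shows "\<bar>poly (Legendre_poly l) (x \<bullet> y)\<bar> \<le> 1"
proof -
  let ?c = "(2 * real l + 1) / (4 * pi)"
  have c: "?c > 0"
    by (intro divide_pos_pos) auto
  have self: "(\<Sum>m = - int l..int l. (norm (sph_harmonic l m z))\<^sup>2) = ?c" if z: "z \<in> sphere2" for z
  proof -
    have "complex_of_real (\<Sum>m = - int l..int l. (norm (sph_harmonic l m z))\<^sup>2) = complex_of_real ?c"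
      using addition_theorem[OF z z, of l] z
      by (simp only: of_real_sum complex_norm_square)
        (simp add: mem_sphere_0 Legendre_poly_1 flip: power2_norm_eq_inner)
    then show ?thesis
      by (simp only: of_real_eq_iff)
  qed
  have "\<bar>?c * poly (Legendre_poly l) (x \<bullet> y)\<bar> =
      norm (\<Sum>m = - int l..int l. sph_harmonic l m x * cnj (sph_harmonic l m y))"
    unfolding addition_theorem[OF x y] by (simp only: norm_of_real)
  also have "\<dots> \<le> (\<Sum>m = - int l..int l. ((norm (sph_harmonic l m x))\<^sup>2 + (norm (sph_harmonic l m y))\<^sup>2) / 2)"
  proof (intro sum_norm_le)
    fix m
    show "norm (sph_harmonic l m x * cnj (sph_harmonic l m y)) \<le>
        ((norm (sph_harmonic l m x))\<^sup>2 + (norm (sph_harmonic l m y))\<^sup>2) / 2"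
      using sum_squares_bound[of "norm (sph_harmonic l m x)" "norm (sph_harmonic l m y)"]
      by (simp add: norm_mult)
  qed
  also have "\<dots> = ?c"
    by (simp only: sum_divide_distrib[symmetric] sum.distrib self[OF x] self[OF y]) simp
  finally have "?c * \<bar>poly (Legendre_poly l) (x \<bullet> y)\<bar> \<le> ?c * 1"
    using c by (simp only: abs_mult abs_of_pos)
  then show ?thesis
    using c by (simp only: mult_le_cancel_left_pos)
qed

lemma continuous_on_sph_harmonic: "continuous_on sphere2 (sph_harmonic l m)"
proof -
  have pos: "continuous_on sphere2 (sph_harmonic l (int k))" for k
  proof -
    have "continuous_on sphere2 (\<lambda>x. complex_of_real (harmonic_const l k) *
        ((complex_of_real (x $ 1) + \<i> * complex_of_real (x $ 2)) ^ k *
          complex_of_real (poly (Legendre_deriv l k) (x $ 3))))"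
      by (intro continuous_intros)
    then show ?thesis
      by (rule continuous_on_cong[OF refl, THEN iffD2, rotated])
        (simp add: sph_harmonic_of_nat solid_def equatorial_def Complex_eq)
  qed
  show ?thesis
  proof (cases "m \<ge> 0")
    case True
    then show ?thesis
      using pos[of "nat m"] by simp
  next
    case False
    then have "m = - int (nat (- m))" "nat (- m) > 0"
      by auto
    then have "sph_harmonic l m = (\<lambda>x. (-1) ^ nat (- m) * cnj (sph_harmonic l (int (nat (- m))) x))"
      using sph_harmonic_minus by metis
    then show ?thesis
      by (simp only:) (intro continuous_intros pos)
  qed
qed

section \<open>Integration over the sphere\<close>

lemma bounded_sphere_continuous:
  fixes f :: "real^3 \<Rightarrow> 'b :: real_normed_vector"
  assumes "continuous_on sphere2 f"
  obtains R where "\<And>x. x \<in> sphere2 \<Longrightarrow> norm (f x) \<le> R"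
  using compact_imp_bounded[OF compact_continuous_image[OF assms]] by (auto simp: bounded_iff)

lemma integrable_continuous_sphere:
  fixes f :: "real^3 \<Rightarrow> 'b :: {banach, second_countable_topology}"
  assumes f: "continuous_on sphere2 f"
  shows "integrable surface_measure f"
proof -
  obtain R where "\<And>x. x \<in> sphere2 \<Longrightarrow> norm (f x) \<le> R"
    using bounded_sphere_continuous[OF f] by blast
  then show ?thesis
    using borel_measurable_surface_measureI[OF f] by (intro surface.integrable_const_bound[of _ R]) auto
qed

lemma integral_cis:
  fixes n :: int
  shows "(\<integral>\<phi>. indicator {0..2 * pi} \<phi> *\<^sub>R cis (real_of_int n * \<phi>) \<partial>lborel) = (if n = 0 then complex_of_real (2 * pi) else 0)"
proof (cases "n = 0")
  case True
  have "(\<integral>\<phi>. indicator {0..2 * pi} \<phi> *\<^sub>R (1 :: complex) \<partial>lborel) = of_real (2 * pi) - of_real 0"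
  proof (rule integral_FTC_Icc)
    show "(complex_of_real has_vector_derivative 1) (at \<phi> within {0..2 * pi})" for \<phi>
      using has_vector_derivative_of_real[OF DERIV_ident] by simp
  qed (auto intro!: continuous_intros)
  then show ?thesis
    using True by simp
next
  case False
  let ?F = "\<lambda>\<phi>. exp (\<i> * of_int n * of_real \<phi>) / (\<i> * of_int n)"
  have "(\<integral>\<phi>. indicator {0..2 * pi} \<phi> *\<^sub>R cis (real_of_int n * \<phi>) \<partial>lborel) = ?F (2 * pi) - ?F 0"
  proof (rule integral_FTC_Icc)
    fix \<phi> :: real
    have "((\<lambda>z. exp (\<i> * of_int n * z) / (\<i> * of_int n)) has_field_derivative
        exp (\<i> * of_int n * of_real \<phi>)) (at (of_real \<phi>))"
      using False by (auto intro!: derivative_eq_intros)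
    from has_vector_derivative_real_field[OF this]
    show "(?F has_vector_derivative cis (real_of_int n * \<phi>)) (at \<phi> within {0..2 * pi})"
      by (simp add: cis_conv_exp mult.assoc)
  qed (auto intro!: continuous_intros)
  also have "exp (\<i> * of_int n * of_real (2 * pi)) = 1"
    using cis_multiple_2pi[of "real_of_int n"] by (simp add: cis_conv_exp mult_ac)
  finally show ?thesis
    using False by simp
qed

text \<open>Fubini on the parameter rectangle. Products of harmonics have this separated form, so
  the azimuthal integral alone settles orthogonality between different orders.\<close>

lemma integral_surface_measure_product:
  fixes f :: "real^3 \<Rightarrow> complex" and n :: int
  assumes f: "continuous_on sphere2 f"
    and eq: "\<And>\<theta> \<phi>. \<theta> \<in> {0..pi} \<Longrightarrow> \<phi> \<in> {0..2 * pi} \<Longrightarrow>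
      f (spherical_point (\<theta>, \<phi>)) = complex_of_real (A \<theta>) * cis (real_of_int n * \<phi>)"
  shows "(\<integral>x. f x \<partial>surface_measure) =
    complex_of_real (\<integral>\<theta>. indicator {0..pi} \<theta> *\<^sub>R (sin \<theta> * A \<theta>) \<partial>lborel) *
      (if n = 0 then complex_of_real (2 * pi) else 0)"
proof -
  let ?S = "{0..pi} \<times> {0..2 * pi}"
  have dens: "(\<lambda>(\<theta>, \<phi>). ennreal (sin \<theta>)) = (\<lambda>p :: real \<times> real. ennreal (sin (fst p)))"
    by auto
  have S: "?S \<in> sets (lborel :: (real \<times> real) measure)"
    by (simp add: borel_prod[symmetric])
  have cont: "continuous_on ?S (\<lambda>p. sin (fst p) *\<^sub>R f (spherical_point p))"
    by (intro continuous_intros continuous_on_compose2[OF f continuous_on_spherical_point])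
      (auto intro: spherical_point_in_sphere)
  have f_meas: "f \<in> borel_measurable (restrict_space borel sphere2)"
    using borel_measurable_surface_measureI[OF f] by (simp add: borel_measurable_surface_measure)
  have int: "integrable (lborel \<Otimes>\<^sub>M lborel) (\<lambda>p. indicator ?S p *\<^sub>R (sin (fst p) *\<^sub>R f (spherical_point p)))"
    unfolding lborel_prod by (intro borel_integrable_compact compact_Times compact_Icc cont)
  have "(\<integral>x. f x \<partial>surface_measure) =
      (\<integral>p. f (spherical_point p) \<partial>density (restrict_space lborel ?S) (\<lambda>p. ennreal (sin (fst p))))"
    unfolding surface_measure_def using measurable_spherical_point f_meas
    by (subst integral_distr) (simp_all only: dens)
  also have "\<dots> = (\<integral>p. sin (fst p) *\<^sub>R f (spherical_point p) \<partial>restrict_space lborel ?S)"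
  proof (rule integral_density)
    have "spherical_point \<in> measurable (restrict_space lborel ?S) (restrict_space borel sphere2)"
      using measurable_spherical_point by (simp add: measurable_def)
    from measurable_compose[OF this f_meas]
    show "(\<lambda>p. f (spherical_point p)) \<in> borel_measurable (restrict_space lborel ?S)" .
    have "(\<lambda>p :: real \<times> real. sin (fst p)) \<in> borel_measurable borel"
      by (intro borel_measurable_continuous_onI continuous_intros)
    then show "(\<lambda>p. sin (fst p)) \<in> borel_measurable (restrict_space lborel ?S)"
      by (intro measurable_restrict_space1) simp
    show "AE p in restrict_space lborel ?S. 0 \<le> sin (fst p)"
      by (intro AE_I2) (auto simp: space_restrict_space sin_ge_zero)
  qed
  also have "\<dots> = (\<integral>p. indicator ?S p *\<^sub>R (sin (fst p) *\<^sub>R f (spherical_point p)) \<partial>lborel)"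
    using S by (intro integral_restrict_space) simp
  also have "\<dots> = (\<integral>\<theta>. (\<integral>\<phi>. indicator ?S (\<theta>, \<phi>) *\<^sub>R (sin \<theta> *\<^sub>R f (spherical_point (\<theta>, \<phi>))) \<partial>lborel) \<partial>lborel)"
    using lborel_pair.integral_fst'[OF int] by (simp add: lborel_prod)
  also have "\<dots> = (\<integral>\<theta>. (\<integral>\<phi>. complex_of_real (indicator {0..pi} \<theta> *\<^sub>R (sin \<theta> * A \<theta>)) *
      (indicator {0..2 * pi} \<phi> *\<^sub>R cis (real_of_int n * \<phi>)) \<partial>lborel) \<partial>lborel)"
    by (intro Bochner_Integration.integral_cong refl)
      (auto simp: indicator_def eq scaleR_conv_of_real mult.assoc)
  also have "\<dots> = (\<integral>\<theta>. complex_of_real (indicator {0..pi} \<theta> *\<^sub>R (sin \<theta> * A \<theta>)) *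
      (if n = 0 then complex_of_real (2 * pi) else 0) \<partial>lborel)"
    by (simp only: integral_mult_right_zero integral_cis)
  also have "\<dots> = complex_of_real (\<integral>\<theta>. indicator {0..pi} \<theta> *\<^sub>R (sin \<theta> * A \<theta>) \<partial>lborel) *
      (if n = 0 then complex_of_real (2 * pi) else 0)"
    by (simp only: integral_mult_left_zero integral_complex_of_real)
  finally show ?thesis .
qed

text \<open>\<open>polar_integral p\<close> is the integral of \<open>p\<close> over \<open>[-1, 1]\<close>, substituting \<open>z = cos \<theta>\<close>.\<close>

definition polar_integral :: "real poly \<Rightarrow> real" where
  "polar_integral p = (\<integral>\<theta>. indicator {0..pi} \<theta> *\<^sub>R (sin \<theta> * poly p (cos \<theta>)) \<partial>lborel)"

lemma integrable_polar: "integrable lborel (\<lambda>\<theta>. indicator {0..pi} \<theta> *\<^sub>R (sin \<theta> * poly p (cos \<theta>)))"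
  by (intro borel_integrable_compact compact_Icc continuous_intros)

lemma polar_integral_add: "polar_integral (p + q) = polar_integral p + polar_integral q"
  using integrable_polar[of p] integrable_polar[of q]
  by (simp add: polar_integral_def distrib_left)

lemma polar_integral_smult: "polar_integral (smult c p) = c * polar_integral p"
proof -
  have "(\<lambda>\<theta>. indicator {0..pi} \<theta> *\<^sub>R (sin \<theta> * poly (smult c p) (cos \<theta>))) =
      (\<lambda>\<theta>. c * (indicator {0..pi} \<theta> *\<^sub>R (sin \<theta> * poly p (cos \<theta>))))"
    by (auto simp: mult_ac)
  then show ?thesis
    unfolding polar_integral_def by (simp only: integral_mult_right_zero)
qed

lemma polar_integral_pderiv: "polar_integral (pderiv p) = poly p 1 - poly p (- 1)"
proof -
  have "polar_integral (pderiv p) = (- poly p (cos pi)) - (- poly p (cos 0))"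
    unfolding polar_integral_def
  proof (rule integral_FTC_Icc)
    fix \<theta> :: real
    have "((\<lambda>\<theta>. - poly p (cos \<theta>)) has_real_derivative sin \<theta> * poly (pderiv p) (cos \<theta>)) (at \<theta>)"
      by (auto intro!: derivative_eq_intros DERIV_chain2[OF poly_DERIV])
    then show "((\<lambda>\<theta>. - poly p (cos \<theta>)) has_vector_derivative sin \<theta> * poly (pderiv p) (cos \<theta>)) (at \<theta> within {0..pi})"
      by (simp add: has_real_derivative_iff_has_vector_derivative has_vector_derivative_at_within)
  qed (auto intro!: continuous_intros)
  then show ?thesis
    by simp
qed

section \<open>Orthogonality of the associated Legendre functions\<close>

text \<open>The inner product of two associated Legendre functions of order \<open>k\<close>: their
  factors \<open>sin \<theta> ^ k\<close> multiply to the polynomial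
  \<open>(1 - z^2) ^ k\<close>.\<close>

definition assoc_inner :: "nat \<Rightarrow> nat \<Rightarrow> nat \<Rightarrow> real" where
  "assoc_inner k l l' = polar_integral ([:1, 0, -1:] ^ k * Legendre_deriv l k * Legendre_deriv l' k)"

lemma assoc_inner_commute: "assoc_inner k l l' = assoc_inner k l' l"
  by (simp add: assoc_inner_def mult_ac)

text \<open>Integration by parts against the self-adjoint form of the Legendre equation.\<close>

lemma assoc_inner_Suc:
  "assoc_inner (Suc k) l l' = (real l + real k + 1) * (real l - real k) * assoc_inner k l l'"
proof -
  let ?A = "[:1, 0, -1:] :: real poly" and ?Q = "Legendre_deriv l" and ?R = "Legendre_deriv l'"
  let ?a = "(real l + real k + 1) * (real l - real k)"
  have sl: "pderiv (?A ^ Suc k * ?Q (Suc k)) = smult (- ?a) (?A ^ k * ?Q k)"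
  proof (rule poly_eqI_eval)
    fix z
    have "poly (pderiv (?A ^ Suc k * ?Q (Suc k))) z = - (poly ?A z ^ k * ((z\<^sup>2 - 1) * poly (?Q (Suc (Suc k))) z
        + 2 * (real k + 1) * z * poly (?Q (Suc k)) z))"
      by (simp only: pderiv_mult pderiv_power_Suc pderiv_funpow_Suc)
        (simp add: pderiv_pCons algebra_simps power2_eq_square del: funpow.simps)
    then show "poly (pderiv (?A ^ Suc k * ?Q (Suc k))) z = poly (smult (- ?a) (?A ^ k * ?Q k)) z"
      unfolding Legendre_ode by (simp add: algebra_simps del: funpow.simps)
  qed
  have "pderiv (?A ^ Suc k * ?Q (Suc k) * ?R k) =
      smult (- ?a) (?A ^ k * ?Q k * ?R k) + ?A ^ Suc k * ?Q (Suc k) * ?R (Suc k)"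
    unfolding pderiv_mult[of "?A ^ Suc k * ?Q (Suc k)" "?R k"] sl pderiv_funpow_Suc
    by (simp only: mult_smult_right mult_smult_left ac_simps)
  then have "polar_integral (pderiv (?A ^ Suc k * ?Q (Suc k) * ?R k)) =
      - ?a * assoc_inner k l l' + assoc_inner (Suc k) l l'"
    by (simp only: assoc_inner_def polar_integral_add polar_integral_smult)
  \<comment> \<open>The exponent \<open>Suc k\<close> is positive, so both boundary terms contain a
    factor that vanishes at \<open>1\<close> and \<open>-1\<close>.\<close>
  moreover have "polar_integral (pderiv (?A ^ Suc k * ?Q (Suc k) * ?R k)) = 0"
    unfolding polar_integral_pderiv by simp
  ultimately show ?thesis
    by simp
qed

text \<open>The recursions of the weight and of the inner product cancel. As a consequence all
  harmonics of one degree have the same norm.\<close>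

lemma assoc_inner_eq:
  assumes "k \<le> l"
  shows "harmonic_weight l k * assoc_inner k l l' = assoc_inner 0 l l'"
  using assms
proof (induction k)
  case (Suc k)
  have "harmonic_weight l (Suc k) * assoc_inner (Suc k) l l' =
      harmonic_weight l (Suc k) * ((real l + real k + 1) * (real l - real k)) * assoc_inner k l l'"
    unfolding assoc_inner_Suc by (simp only: mult.assoc)
  also have "\<dots> = harmonic_weight l k * assoc_inner k l l'"
    using Suc.prems by (subst harmonic_weight_Suc) auto
  finally show ?case
    using Suc by simp
qed simp

text \<open>\<open>assoc_inner 1\<close> is symmetric in the degrees, so the eigenvalues
  \<open>l (l + 1)\<close> and \<open>l' (l' + 1)\<close> act equally on
  \<open>assoc_inner 0\<close>; being distinct, they force it to be 0. The positive weight carries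
  this over to order \<open>k\<close>.\<close>

lemma assoc_inner_orthogonal:
  assumes "l \<noteq> l'" "k \<le> l"
  shows "assoc_inner k l l' = 0"
proof -
  have "real l * (real l + 1) * assoc_inner 0 l l' = real l' * (real l' + 1) * assoc_inner 0 l l'"
    using assoc_inner_Suc[of 0 l l'] assoc_inner_Suc[of 0 l' l]
    by (simp add: assoc_inner_commute[of _ l' l] mult_ac)
  moreover have "real l * (real l + 1) \<noteq> real l' * (real l' + 1)"
  proof -
    have "real l * (real l + 1) - real l' * (real l' + 1) = (real l - real l') * (real l + real l' + 1)"
      by (simp add: algebra_simps)
    moreover have "real l + real l' + 1 \<noteq> 0"
      by (simp add: add_nonneg_eq_0_iff)
    ultimately show ?thesis
      using assms(1) by auto
  qed
  ultimately have "assoc_inner 0 l l' = 0"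
    by simp
  then show ?thesis
    using assoc_inner_eq[OF assms(2), of l'] by (simp add: harmonic_weight_def)
qed

lemma equatorial_spherical_point: "equatorial (spherical_point (\<theta>, \<phi>)) = complex_of_real (sin \<theta>) * cis \<phi>"
  by (simp add: equatorial_def complex_eq_iff)

definition harmonic_amplitude :: "nat \<Rightarrow> int \<Rightarrow> real \<Rightarrow> real" where
  "harmonic_amplitude l m \<theta> = (if m < 0 then (-1) ^ nat \<bar>m\<bar> else 1) * harmonic_const l (nat \<bar>m\<bar>) *
     (sin \<theta> ^ nat \<bar>m\<bar> * poly (Legendre_deriv l (nat \<bar>m\<bar>)) (cos \<theta>))"

lemma sph_harmonic_spherical_point:
  "sph_harmonic l m (spherical_point (\<theta>, \<phi>)) =
    complex_of_real (harmonic_amplitude l m \<theta>) * cis (real_of_int m * \<phi>)"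
proof -
  have pos: "sph_harmonic l (int k) (spherical_point (\<theta>, \<phi>)) =
      complex_of_real (harmonic_const l k * (sin \<theta> ^ k * poly (Legendre_deriv l k) (cos \<theta>))) * cis (real k * \<phi>)" for k
    unfolding sph_harmonic_of_nat[OF spherical_point_in_sphere] solid_def equatorial_spherical_point
      power_mult_distrib by (simp add: Complex.DeMoivre)
  show ?thesis
  proof (cases "m \<ge> 0")
    case True
    then show ?thesis
      using pos[of "nat m"] by (simp add: harmonic_amplitude_def)
  next
    case False
    then have m: "m = - int (nat \<bar>m\<bar>)" "nat \<bar>m\<bar> > 0"
      by auto
    have "sph_harmonic l (- int (nat \<bar>m\<bar>)) (spherical_point (\<theta>, \<phi>)) =
        complex_of_real (harmonic_amplitude l m \<theta>) * cis (- (real (nat \<bar>m\<bar>) * \<phi>))"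
      using False m(2) by (simp only: sph_harmonic_minus pos) (simp add: harmonic_amplitude_def cis_cnj)
    then show ?thesis
      using m(1) by (metis mult_minus_left of_int_minus of_int_of_nat_eq)
  qed
qed

text \<open>What matters about the value on the diagonal is that it depends on the degree only; it
  is found to be 1 by summing over the orders.\<close>

lemma integral_sph_harmonic_product:
  assumes "nat \<bar>m\<bar> \<le> l"
  shows "(\<integral>x. sph_harmonic l m x * cnj (sph_harmonic l' m' x) \<partial>surface_measure) =
    (if l = l' \<and> m = m' then complex_of_real ((2 * real l + 1) / 2 * assoc_inner 0 l l) else 0)"
proof -
  let ?k = "nat \<bar>m\<bar>"
  have cont: "continuous_on sphere2 (\<lambda>x. sph_harmonic l m x * cnj (sph_harmonic l' m' x))"
    by (intro continuous_intros continuous_on_sph_harmonic)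
  have eq: "sph_harmonic l m (spherical_point (\<theta>, \<phi>)) * cnj (sph_harmonic l' m' (spherical_point (\<theta>, \<phi>))) =
      complex_of_real (harmonic_amplitude l m \<theta> * harmonic_amplitude l' m' \<theta>) * cis (real_of_int (m - m') * \<phi>)" for \<theta> \<phi>
    by (simp add: sph_harmonic_spherical_point cis_cnj cis_mult left_diff_distrib)
  note int = integral_surface_measure_product[OF cont eq]
  show ?thesis
  proof (cases "m = m'")
    case False
    then show ?thesis
      using int by simp
  next
    case True
    have amp: "sin \<theta> * (harmonic_amplitude l m \<theta> * harmonic_amplitude l' m \<theta>) =
        harmonic_const l ?k * harmonic_const l' ?k *
        (sin \<theta> * poly ([:1, 0, -1:] ^ ?k * Legendre_deriv l ?k * Legendre_deriv l' ?k) (cos \<theta>))" for \<theta>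
    proof -
      have "sin \<theta> ^ ?k * sin \<theta> ^ ?k = (1 - cos \<theta> * cos \<theta>) ^ ?k"
        using sin_cos_squared_add[of \<theta>]
        by (simp add: power2_eq_square flip: power_mult_distrib)
          (metis add_diff_cancel_right')
      \<comment> \<open>The sign attached to negative orders is common to both amplitudes, so it
        enters squared.\<close>
      moreover obtain s where s: "s * s = 1"
        "\<And>l. harmonic_amplitude l m \<theta> = s * harmonic_const l ?k * (sin \<theta> ^ ?k * poly (Legendre_deriv l ?k) (cos \<theta>))"
      proof
        show "(if m < 0 then (-1) ^ ?k else 1) * (if m < 0 then (-1) ^ ?k else 1) = (1 :: real)"
          by (simp flip: power_mult_distrib)
      qed (simp only: harmonic_amplitude_def)
      have "sin \<theta> * (harmonic_amplitude l m \<theta> * harmonic_amplitude l' m \<theta>) = (s * s) *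
          (harmonic_const l ?k * harmonic_const l' ?k * (sin \<theta> * ((sin \<theta> ^ ?k * sin \<theta> ^ ?k) *
            poly (Legendre_deriv l ?k) (cos \<theta>) * poly (Legendre_deriv l' ?k) (cos \<theta>))))"
        unfolding s(2) by (simp only: mult_ac)
      ultimately show ?thesis
        by (simp add: s(1) del: funpow.simps)
    qed
    have "(\<lambda>\<theta>. indicator {0..pi} \<theta> *\<^sub>R (sin \<theta> * (harmonic_amplitude l m \<theta> * harmonic_amplitude l' m \<theta>))) =
        (\<lambda>\<theta>. harmonic_const l ?k * harmonic_const l' ?k * (indicator {0..pi} \<theta> *\<^sub>R
          (sin \<theta> * poly ([:1, 0, -1:] ^ ?k * Legendre_deriv l ?k * Legendre_deriv l' ?k) (cos \<theta>))))"
      unfolding amp by (simp only: real_scaleR_def mult_ac)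
    then have amp_int: "(\<integral>\<theta>. indicator {0..pi} \<theta> *\<^sub>R
          (sin \<theta> * (harmonic_amplitude l m \<theta> * harmonic_amplitude l' m \<theta>)) \<partial>lborel) =
        harmonic_const l ?k * harmonic_const l' ?k * assoc_inner ?k l l'"
      by (simp only: assoc_inner_def polar_integral_def integral_mult_right_zero)
    have "(\<integral>x. sph_harmonic l m x * cnj (sph_harmonic l' m' x) \<partial>surface_measure) =
        complex_of_real (harmonic_const l ?k * harmonic_const l' ?k * assoc_inner ?k l l') * complex_of_real (2 * pi)"
      unfolding int unfolding True[symmetric] amp_int by simp
    moreover have "harmonic_const l ?k * harmonic_const l ?k * assoc_inner ?k l l * (2 * pi) =
        (2 * real l + 1) / 2 * assoc_inner 0 l l"
    proof -
      have "harmonic_const l ?k * harmonic_const l ?k * assoc_inner ?k l l * (2 * pi) =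
          (2 * real l + 1) / (4 * pi) * (harmonic_weight l ?k * assoc_inner ?k l l) * (2 * pi)"
        by (simp only: harmonic_const_power2[unfolded power2_eq_square] mult.assoc)
      then show ?thesis
        unfolding assoc_inner_eq[OF assms] by simp
    qed
    ultimately have "l = l' \<Longrightarrow> (\<integral>x. sph_harmonic l m x * cnj (sph_harmonic l' m' x) \<partial>surface_measure) =
        complex_of_real ((2 * real l + 1) / 2 * assoc_inner 0 l l)"
      by (simp only: of_real_mult[symmetric])
    then show ?thesis
      using True int assoc_inner_orthogonal[OF _ assms, of l'] amp_int by (cases "l = l'") simp_all
  qed
qed

lemma measure_surface_measure: "measure surface_measure sphere2 = 4 * pi"
proof -
  have "complex_of_real (measure surface_measure sphere2) = (\<integral>x. 1 \<partial>surface_measure)"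
    by (simp add: scaleR_conv_of_real)
  also have "\<dots> = complex_of_real (\<integral>\<theta>. indicator {0..pi} \<theta> *\<^sub>R (sin \<theta> * 1) \<partial>lborel) * complex_of_real (2 * pi)"
    using integral_surface_measure_product[of "\<lambda>x. 1" "\<lambda>_. 1" 0] by simp
  also have "(\<integral>\<theta>. indicator {0..pi} \<theta> *\<^sub>R (sin \<theta> * 1) \<partial>lborel) = 2"
    using polar_integral_pderiv[of "[:0, 1:]"] by (simp add: polar_integral_def pderiv_pCons)
  finally have "complex_of_real (measure surface_measure sphere2) = complex_of_real (4 * pi)"
    by simp
  then show ?thesis
    by (simp only: of_real_eq_iff)
qed

text \<open>
  All \<open>Y_{lm}\<close> of the same degree have the same norm by the previous lemmas, and the addition
  theorem on the diagonal gives the sum of their squares.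
\<close>

theorem sph_harmonic_orthonormal:
  assumes "m \<in> {- int l..int l}"
  shows "(\<integral>x. sph_harmonic l m x * cnj (sph_harmonic l' m' x) \<partial>surface_measure) = (if l = l' \<and> m = m' then 1 else 0)"
proof -
  define \<beta> where "\<beta> = complex_of_real ((2 * real l + 1) / 2 * assoc_inner 0 l l)"
  have "(\<Sum>m = - int l..int l. \<beta>) =
      (\<Sum>m = - int l..int l. \<integral>x. sph_harmonic l m x * cnj (sph_harmonic l m x) \<partial>surface_measure)"
    by (intro sum.cong refl) (auto simp: integral_sph_harmonic_product \<beta>_def)
  also have "\<dots> = (\<integral>x. (\<Sum>m = - int l..int l. sph_harmonic l m x * cnj (sph_harmonic l m x)) \<partial>surface_measure)"
    by (intro Bochner_Integration.integral_sum[symmetric] integrable_continuous_sphere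
        continuous_intros continuous_on_sph_harmonic)
  also have "\<dots> = (\<integral>x. complex_of_real ((2 * real l + 1) / (4 * pi)) \<partial>surface_measure)"
    by (intro Bochner_Integration.integral_cong refl)
      (simp add: addition_theorem Legendre_poly_1 mem_sphere_0 flip: power2_norm_eq_inner)
  also have "\<dots> = of_nat (2 * l + 1)"
    by (simp add: measure_surface_measure scaleR_conv_of_real)
  finally have "(\<Sum>m = - int l..int l. \<beta>) = of_nat (2 * l + 1) * 1"
    by (simp only: mult_1_right)
  moreover have "(\<Sum>m = - int l..int l. \<beta>) = of_nat (2 * l + 1) * \<beta>"
    by simp
  moreover have "of_nat (2 * l + 1) \<noteq> (0 :: complex)"
    by (simp only: of_nat_eq_0_iff)
  ultimately have \<beta>: "\<beta> = 1"
    by (metis mult_left_cancel)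
  have "nat \<bar>m\<bar> \<le> l"
    using assms by auto
  from integral_sph_harmonic_product[OF this] show ?thesis
    unfolding \<beta>_def[symmetric] \<beta> .
qed

section \<open>Convolution\<close>

lemma has_ms_integral_square_integrable: "has_ms_integral M f I \<Longrightarrow> square_integrable M I"
  by (auto simp: has_ms_integral_def ms_tendsto_def)

text \<open>This permits replacing an integral known only by existence with an explicit variable at
  mean-square distance 0 from it.\<close>

lemma has_ms_integral_cong_AE:
  assumes I: "has_ms_integral M f I" and J: "square_integrable M J"
    and eq: "ms_norm M (\<lambda>\<omega>. I \<omega> - J \<omega>) = 0"
  shows "has_ms_integral M f J"
  using I ms_tendsto_cong_limit[OF _ J eq] unfolding has_ms_integral_def by blast

lemma ms_tendsto_cnj:
  assumes "ms_tendsto M X Y"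
  shows "ms_tendsto M (\<lambda>n \<omega>. cnj (X n \<omega>)) (\<lambda>\<omega>. cnj (Y \<omega>))"
proof -
  have "ms_norm M (\<lambda>\<omega>. cnj (X n \<omega>) - cnj (Y \<omega>)) = ms_norm M (\<lambda>\<omega>. X n \<omega> - Y \<omega>)" for n
    by (rule ms_norm_eqI) (simp flip: complex_cnj_diff)
  then show ?thesis
    using assms by (simp add: ms_tendsto_def square_integrable_cnj)
qed

lemma integral_mult_cnj: "(\<integral>\<omega>. X \<omega> * cnj (X \<omega>) \<partial>M) = complex_of_real ((ms_norm M X)\<^sup>2)"
  unfolding ms_norm_power2 complex_norm_square[symmetric] by (rule integral_complex_of_real)

lemma integral_cnj_product: "(\<integral>\<omega>. X \<omega> * cnj (Y \<omega>) \<partial>M) = cnj (\<integral>\<omega>. Y \<omega> * cnj (X \<omega>) \<partial>M)"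
  unfolding Bochner_Integration.integral_cnj[symmetric] complex_cnj_mult complex_cnj_cnj by (simp only: mult.commute)

section \<open>The convolved field and its kernel\<close>

locale convolution = ms_continuous_field M T for M :: "'w measure" and T +
  fixes H :: "real \<Rightarrow> real" and C h :: "nat \<Rightarrow> real"
  assumes zero_mean: "zero_mean_field M T"
    and spectrum: "angular_power_spectrum M (harmonic_coeff M T) C"
    and H_measurable: "H \<in> borel_measurable (restrict_space borel {0..pi})"
    and H_representation: "Legendre_representation H h"
begin

abbreviation a :: "nat \<Rightarrow> int \<Rightarrow> 'w \<Rightarrow> complex" where
  "a \<equiv> harmonic_coeff M T"

abbreviation Tc :: "real^3 \<Rightarrow> 'w \<Rightarrow> real" where
  "Tc \<equiv> convolved_field M T H"

text \<open>The cosine of the distance is written as an inner product, so every partial sum is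
  visibly continuous.\<close>

definition kernel :: "nat \<Rightarrow> real^3 \<Rightarrow> real^3 \<Rightarrow> real" where
  "kernel n x y = (\<Sum>l\<le>n. (2 * real l + 1) / (4 * pi) * h l * poly (Legendre_poly l) (x \<bullet> y))"

definition partial :: "nat \<Rightarrow> real^3 \<Rightarrow> 'w \<Rightarrow> complex" where
  "partial n x \<omega> = (\<Sum>l\<le>n. \<Sum>m = - int l..int l. (a l m \<omega> * complex_of_real (h l)) * sph_harmonic l m x)"

text \<open>\<open>harmonic_coeff\<close> is a Hilbert choice, so existence of some integral has to
  come first; the same holds for \<open>convolved_field\<close> below.\<close>

lemma has_ms_integral_coeff: "has_ms_integral M (\<lambda>x \<omega>. T x \<omega> *\<^sub>R cnj (sph_harmonic l m x)) (a l m)"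
proof -
  have "\<exists>I. has_ms_integral M (\<lambda>x \<omega>. T x \<omega> *\<^sub>R cnj (sph_harmonic l m x)) I"
    by (intro has_ms_integral_exists integrable_continuous_sphere continuous_intros continuous_on_sph_harmonic)
  from someI_ex[OF this] show ?thesis
    by (simp add: harmonic_coeff_def ms_integral_def scaleR_conv_of_real)
qed

lemma coeff_square_integrable: "square_integrable M (a l m)"
  by (rule has_ms_integral_square_integrable[OF has_ms_integral_coeff])

lemma coeff_product:
  assumes w: "square_integrable M w"
  shows "has_bochner_integral surface_measure
    (\<lambda>y. cnj (sph_harmonic l m y) * (\<integral>\<omega>. T y \<omega> *\<^sub>R w \<omega> \<partial>M)) (\<integral>\<omega>. a l m \<omega> * w \<omega> \<partial>M)"
  by (rule has_ms_integral_scaleR[OF cb_mult.contractive_bilinear_axioms has_ms_integral_coeff _ w])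
    (intro borel_measurable_surface_measureI continuous_intros continuous_on_sph_harmonic)

lemma continuous_on_kernel: "continuous_on A (kernel n x)"
  unfolding kernel_def by (intro continuous_intros)

lemma kernel_measurable: "x \<in> sphere2 \<Longrightarrow> (\<lambda>y. H (great_circle_dist x y)) \<in> borel_measurable surface_measure"
proof (rule measurable_compose[OF _ H_measurable], rule measurable_restrict_space2)
  assume x: "x \<in> sphere2"
  have "continuous_on sphere2 (\<lambda>y. arccos (x \<bullet> y))"
    by (rule continuous_on_compose2[OF continuous_on_arccos'])
      (use abs_inner_le_1[OF x] in \<open>auto intro!: continuous_intros simp: abs_le_iff minus_le_iff\<close>)
  then show "great_circle_dist x \<in> borel_measurable surface_measure"
    unfolding great_circle_dist_def by (rule borel_measurable_surface_measureI)
  show "great_circle_dist x \<in> space surface_measure \<rightarrow> {0..pi}"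
    using abs_inner_le_1[OF x] by (auto simp: great_circle_dist_def arccos_lbound arccos_ubound abs_le_iff minus_le_iff)
qed

text \<open>The representation speaks of nonnegative integrals, which may be infinite; integrability
  of the kernel is derived from it together with measurability.\<close>

lemma kernel_convergence:
  assumes x: "x \<in> sphere2"
  shows kernel_integrable: "integrable surface_measure (\<lambda>y. H (great_circle_dist x y))"
    and kernel_limit: "(\<lambda>n. \<integral>y. \<bar>H (great_circle_dist x y) - kernel n x y\<bar> \<partial>surface_measure) \<longlonglongrightarrow> 0"
proof -
  have lim: "(\<lambda>n. \<integral>\<^sup>+y. ennreal \<bar>H (great_circle_dist x y) - kernel n x y\<bar> \<partial>surface_measure) \<longlonglongrightarrow> 0"
  proof -
    have "(\<integral>\<^sup>+y. ennreal \<bar>H (great_circle_dist x y) - kernel n x y\<bar> \<partial>surface_measure) =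
        (\<integral>\<^sup>+y. ennreal \<bar>H (great_circle_dist x y) - (\<Sum>l\<le>n. (2 * real l + 1) / (4 * pi) * h l *
          poly (Legendre_poly l) (cos (great_circle_dist x y)))\<bar> \<partial>surface_measure)" for n
      using x by (intro nn_integral_cong) (simp add: kernel_def cos_great_circle_dist)
    then show ?thesis
      using H_representation x by (simp add: Legendre_representation_def)
  qed
  have kern: "integrable surface_measure (kernel n x)" for n
    by (rule integrable_continuous_sphere[OF continuous_on_kernel])
  \<comment> \<open>One partial sum at finite distance suffices, since partial sums are integrable
    themselves.\<close>
  obtain n where "(\<integral>\<^sup>+y. ennreal \<bar>H (great_circle_dist x y) - kernel n x y\<bar> \<partial>surface_measure) < 1"
    using order_tendstoD(2)[OF lim, of 1] by (auto simp: eventually_sequentially)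
  then have "(\<integral>\<^sup>+y. ennreal \<bar>H (great_circle_dist x y) - kernel n x y\<bar> \<partial>surface_measure) < \<infinity>"
    by (rule order.strict_trans) simp
  then have "integrable surface_measure (\<lambda>y. H (great_circle_dist x y) - kernel n x y)"
    using borel_measurable_diff[OF kernel_measurable[OF x] borel_measurable_integrable[OF kern]]
    by (simp add: integrable_iff_bounded)
  from Bochner_Integration.integrable_add[OF this kern[of n]]
  show int: "integrable surface_measure (\<lambda>y. H (great_circle_dist x y))"
    by simp
  have "integrable surface_measure (\<lambda>y. \<bar>H (great_circle_dist x y) - kernel n x y\<bar>)" for n
    by (intro integrable_abs Bochner_Integration.integrable_diff int kern)
  from nn_integral_eq_integral[OF this]
  show "(\<lambda>n. \<integral>y. \<bar>H (great_circle_dist x y) - kernel n x y\<bar> \<partial>surface_measure) \<longlonglongrightarrow> 0"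
    using lim by (simp add: ennreal_tendsto_0_iff)
qed

lemma has_ms_integral_conv:
  assumes "x \<in> sphere2"
  shows "has_ms_integral M (\<lambda>y \<omega>. T y \<omega> * H (great_circle_dist x y)) (Tc x)"
proof -
  have "\<exists>I. has_ms_integral M (\<lambda>y \<omega>. T y \<omega> *\<^sub>R H (great_circle_dist x y)) I"
    by (rule has_ms_integral_exists[OF kernel_integrable[OF assms]])
  from someI_ex[OF this] show ?thesis
    by (simp add: convolved_field_def ms_integral_def)
qed

lemma conv_square_integrable: "x \<in> sphere2 \<Longrightarrow> square_integrable M (Tc x)"
  by (rule has_ms_integral_square_integrable[OF has_ms_integral_conv])

lemma conv_product:
  fixes w :: "'w \<Rightarrow> 'b :: {banach, second_countable_topology}"
  assumes x: "x \<in> sphere2" and w: "square_integrable M w"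
  shows "has_bochner_integral surface_measure
    (\<lambda>y. H (great_circle_dist x y) *\<^sub>R (\<integral>\<omega>. T y \<omega> *\<^sub>R w \<omega> \<partial>M)) (\<integral>\<omega>. Tc x \<omega> *\<^sub>R w \<omega> \<partial>M)"
  by (rule has_ms_integral_scaleR[OF cb_scaleR.contractive_bilinear_axioms _ kernel_measurable[OF x] w])
    (use has_ms_integral_conv[OF x] in simp)

text \<open>Testing against the constant 1 turns the mean into a surface integral of the means of
  \<open>T\<close>. The coefficients are treated in the same way.\<close>

lemma zero_mean_conv: "x \<in> sphere2 \<Longrightarrow> (\<integral>\<omega>. Tc x \<omega> \<partial>M) = 0"
proof -
  assume x: "x \<in> sphere2"
  have "(\<integral>\<omega>. Tc x \<omega> *\<^sub>R (1 :: real) \<partial>M) =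
      (\<integral>y. H (great_circle_dist x y) *\<^sub>R (\<integral>\<omega>. T y \<omega> *\<^sub>R 1 \<partial>M) \<partial>surface_measure)"
    using has_bochner_integral_integral_eq[OF conv_product[OF x square_integrable_const[of "1 :: real"]]] ..
  also have "\<dots> = (\<integral>y. 0 \<partial>surface_measure)"
    using zero_mean by (intro Bochner_Integration.integral_cong refl) (simp add: zero_mean_field_def)
  finally show ?thesis
    by simp
qed

lemma zero_mean_coeff: "(\<integral>\<omega>. a l m \<omega> \<partial>M) = 0"
proof -
  have "(\<integral>\<omega>. a l m \<omega> * 1 \<partial>M) =
      (\<integral>y. cnj (sph_harmonic l m y) * (\<integral>\<omega>. T y \<omega> *\<^sub>R 1 \<partial>M) \<partial>surface_measure)"
    using has_bochner_integral_integral_eq[OF coeff_product[OF square_integrable_const[of 1]]] ..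
  also have "\<dots> = (\<integral>y. 0 \<partial>surface_measure)"
    using zero_mean by (intro Bochner_Integration.integral_cong refl)
      (simp add: zero_mean_field_def scaleR_conv_of_real integral_complex_of_real)
  finally show ?thesis
    by simp
qed

section \<open>Partial sums and their second moments\<close>

lemma coeff_orthogonal:
  assumes "m \<in> {- int l..int l}" "m' \<in> {- int l'..int l'}"
  shows "(\<integral>\<omega>. a l m \<omega> * cnj (a l' m' \<omega>) \<partial>M) = (if l = l' \<and> m = m' then complex_of_real (C l) else 0)"
  using spectrum assms by (simp add: angular_power_spectrum_def)

text \<open>Order 0 is admissible for every degree, and \<open>C l\<close> is the squared norm of
  that coefficient.\<close>

lemma C_nonneg: "0 \<le> C l"
proof -
  have "complex_of_real (C l) = complex_of_real ((ms_norm M (a l 0))\<^sup>2)"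
    using coeff_orthogonal[of 0 l 0 l] unfolding integral_mult_cnj by simp
  then show ?thesis
    by (simp only: of_real_eq_iff) simp
qed

lemma partial_square_integrable: "square_integrable M (partial n x)"
  unfolding partial_def
  by (intro square_integrable_sum square_integrable_mult_right coeff_square_integrable)

lemma integral_partial:
  assumes w: "square_integrable M w"
  shows "(\<integral>\<omega>. partial n x \<omega> * w \<omega> \<partial>M) =
    (\<Sum>l\<le>n. \<Sum>m = - int l..int l. (\<integral>\<omega>. a l m \<omega> * w \<omega> \<partial>M) * (complex_of_real (h l) * sph_harmonic l m x))"
proof -
  have "partial n x \<omega> * w \<omega> =
      (\<Sum>l\<le>n. \<Sum>m = - int l..int l. (a l m \<omega> * w \<omega>) * (complex_of_real (h l) * sph_harmonic l m x))" for \<omega>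
    by (simp add: partial_def sum_distrib_left sum_distrib_right mult_ac)
  then show ?thesis
    using cb_mult.integrable_product[OF coeff_square_integrable w]
    by (simp add: Bochner_Integration.integral_sum)
qed

lemma partial_product:
  assumes x: "x \<in> sphere2" and w: "square_integrable M w"
  shows "has_bochner_integral surface_measure
    (\<lambda>y. kernel n x y *\<^sub>R (\<integral>\<omega>. T y \<omega> *\<^sub>R w \<omega> \<partial>M)) (\<integral>\<omega>. partial n x \<omega> * w \<omega> \<partial>M)"
proof -
  let ?g = "\<lambda>y. \<integral>\<omega>. T y \<omega> *\<^sub>R w \<omega> \<partial>M"
  have hb: "has_bochner_integral surface_measure
    (\<lambda>y. \<Sum>l\<le>n. \<Sum>m = - int l..int l. cnj (sph_harmonic l m y) * ?g y * (complex_of_real (h l) * sph_harmonic l m x))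
    (\<integral>\<omega>. partial n x \<omega> * w \<omega> \<partial>M)"
    unfolding integral_partial[OF w]
    by (intro has_bochner_integral_sum has_bochner_integral_mult_left coeff_product w)
  have eq: "(\<Sum>l\<le>n. \<Sum>m = - int l..int l.
      cnj (sph_harmonic l m y) * ?g y * (complex_of_real (h l) * sph_harmonic l m x)) = kernel n x y *\<^sub>R ?g y"
    if y: "y \<in> sphere2" for y
  proof -
    have "(\<Sum>m = - int l..int l. cnj (sph_harmonic l m y) * ?g y * (complex_of_real (h l) * sph_harmonic l m x)) =
        complex_of_real ((2 * real l + 1) / (4 * pi) * h l * poly (Legendre_poly l) (x \<bullet> y)) * ?g y" for l
    proof -
      have "(\<Sum>m = - int l..int l. cnj (sph_harmonic l m y) * ?g y * (complex_of_real (h l) * sph_harmonic l m x)) =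
          complex_of_real (h l) * (\<Sum>m = - int l..int l. sph_harmonic l m x * cnj (sph_harmonic l m y)) * ?g y"
        by (simp only: sum_distrib_left sum_distrib_right mult_ac)
      then show ?thesis
        unfolding addition_theorem[OF x y] by simp
    qed
    then show ?thesis
      by (simp only: kernel_def scaleR_conv_of_real of_real_sum sum_distrib_right)
  qed
  from hb show ?thesis
    by (rule has_bochner_integral_cong[THEN iffD1, rotated -1]) (simp_all only: eq space_surface_measure)
qed

lemma ms_tendsto_partial:
  assumes x: "x \<in> sphere2"
  shows "ms_tendsto M (\<lambda>n. partial n x) (\<lambda>\<omega>. complex_of_real (Tc x \<omega>))"
proof -
  have sq: "square_integrable M (\<lambda>\<omega>. complex_of_real (Tc x \<omega>))"
    by (intro square_integrable_of_real conv_square_integrable x)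
  obtain R where R0: "R \<ge> 0" and R: "\<And>x. x \<in> sphere2 \<Longrightarrow> ms_norm M (T x) \<le> R"
    using ms_norm_bounded by blast
  let ?e = "\<lambda>n. \<integral>y. \<bar>H (great_circle_dist x y) - kernel n x y\<bar> \<partial>surface_measure"
  have bound: "ms_norm M (\<lambda>\<omega>. partial n x \<omega> - complex_of_real (Tc x \<omega>)) \<le> R * ?e n" for n
  proof -
    define D where "D = (\<lambda>\<omega>. partial n x \<omega> - complex_of_real (Tc x \<omega>))"
    have D: "square_integrable M D"
      unfolding D_def by (intro square_integrable_diff partial_square_integrable sq)
    \<comment> \<open>For the conjugate of the error as test variable, the moment of
      \<open>D\<close> is the squared norm of \<open>D\<close>; so the weak identities for the two
      integrals yield a bound in mean square.\<close>
    define w where "w = (\<lambda>\<omega>. cnj (D \<omega>))"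
    have w: "square_integrable M w"
      unfolding w_def by (intro square_integrable_cnj D)
    have norm_w: "ms_norm M w = ms_norm M D"
      unfolding w_def by (rule ms_norm_eqI) simp
    let ?g = "\<lambda>y. \<integral>\<omega>. T y \<omega> *\<^sub>R w \<omega> \<partial>M"
    have int1: "integrable M (\<lambda>\<omega>. partial n x \<omega> * w \<omega>)" "integrable M (\<lambda>\<omega>. Tc x \<omega> *\<^sub>R w \<omega>)"
      by (rule cb_mult.integrable_product[OF partial_square_integrable w],
          rule cb_scaleR.integrable_product[OF conv_square_integrable[OF x] w])
    have "(\<integral>\<omega>. D \<omega> * w \<omega> \<partial>M) = (\<integral>\<omega>. partial n x \<omega> * w \<omega> - Tc x \<omega> *\<^sub>R w \<omega> \<partial>M)"
      by (simp add: D_def left_diff_distrib scaleR_conv_of_real)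
    then have "(\<integral>\<omega>. D \<omega> * w \<omega> \<partial>M) = (\<integral>\<omega>. partial n x \<omega> * w \<omega> \<partial>M) - (\<integral>\<omega>. Tc x \<omega> *\<^sub>R w \<omega> \<partial>M)"
      using int1 by simp
    then have hb: "has_bochner_integral surface_measure
        (\<lambda>y. kernel n x y *\<^sub>R ?g y - H (great_circle_dist x y) *\<^sub>R ?g y) (\<integral>\<omega>. D \<omega> * w \<omega> \<partial>M)"
      by (simp only:) (intro has_bochner_integral_diff partial_product conv_product x w)
    have "norm (\<integral>\<omega>. D \<omega> * w \<omega> \<partial>M) =
        norm (\<integral>y. kernel n x y *\<^sub>R ?g y - H (great_circle_dist x y) *\<^sub>R ?g y \<partial>surface_measure)"
      by (simp only: has_bochner_integral_integral_eq[OF hb])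
    also have "\<dots> \<le> (\<integral>y. \<bar>H (great_circle_dist x y) - kernel n x y\<bar> * (R * ms_norm M D) \<partial>surface_measure)"
    proof (rule Bochner_Integration.integral_norm_bound_integral)
      show "integrable surface_measure (\<lambda>y. kernel n x y *\<^sub>R ?g y - H (great_circle_dist x y) *\<^sub>R ?g y)"
        using hb by (rule integrable.intros)
      show "integrable surface_measure (\<lambda>y. \<bar>H (great_circle_dist x y) - kernel n x y\<bar> * (R * ms_norm M D))"
        by (intro integrable_mult_left integrable_abs Bochner_Integration.integrable_diff kernel_integrable x
            integrable_continuous_sphere[OF continuous_on_kernel])
      fix y assume "y \<in> space surface_measure"
      then have y: "y \<in> sphere2"
        by simp
      have "norm (?g y) \<le> ms_norm M (T y) * ms_norm M w"
        by (rule cb_scaleR.Cauchy_Schwarz[OF square_integrable[OF y] w])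
      also have "\<dots> \<le> R * ms_norm M D"
        unfolding norm_w by (intro mult_right_mono R y) simp
      finally show "norm (kernel n x y *\<^sub>R ?g y - H (great_circle_dist x y) *\<^sub>R ?g y) \<le>
          \<bar>H (great_circle_dist x y) - kernel n x y\<bar> * (R * ms_norm M D)"
        by (simp only: scaleR_diff_left[symmetric] norm_scaleR abs_minus_commute mult_left_mono abs_ge_zero)
    qed
    also have "\<dots> = ?e n * (R * ms_norm M D)"
      by simp
    finally have "(ms_norm M D)\<^sup>2 \<le> ?e n * (R * ms_norm M D)"
      unfolding w_def integral_mult_cnj by (simp only: norm_of_real abs_power2)
    then have "ms_norm M D * ms_norm M D \<le> (R * ?e n) * ms_norm M D"
      by (simp add: power2_eq_square mult_ac)
    moreover have "0 \<le> R * ?e n"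
      using R0 by (intro mult_nonneg_nonneg integral_nonneg_AE AE_I2) auto
    ultimately have "ms_norm M D \<le> R * ?e n"
      by (cases "ms_norm M D = 0") (auto simp: mult_le_cancel_right order.strict_iff_order)
    then show ?thesis
      by (simp only: D_def)
  qed
  have "(\<lambda>n. R * ?e n) \<longlonglongrightarrow> 0"
    using tendsto_mult_right_zero[OF kernel_limit[OF x]] .
  from null_sequence_le[OF ms_norm_nonneg bound this] show ?thesis
    using sq partial_square_integrable by (simp add: ms_tendsto_def)
qed

text \<open>Orthogonality leaves a single term, present as soon as \<open>n\<close> reaches
  \<open>l\<close>; in the limit the moment with \<open>Tc x\<close> is obtained without any
  estimate.\<close>

lemma integral_partial_coeff:
  assumes "m \<in> {- int l..int l}"
  shows "(\<integral>\<omega>. partial n x \<omega> * cnj (a l m \<omega>) \<partial>M) =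
    (if l \<le> n then complex_of_real (C l * h l) * sph_harmonic l m x else 0)"
proof -
  have "(\<integral>\<omega>. partial n x \<omega> * cnj (a l m \<omega>) \<partial>M) =
      (\<Sum>l'\<le>n. \<Sum>m' = - int l'..int l'. (\<integral>\<omega>. a l' m' \<omega> * cnj (a l m \<omega>) \<partial>M) *
        (complex_of_real (h l') * sph_harmonic l' m' x))"
    by (rule integral_partial[OF square_integrable_cnj[OF coeff_square_integrable]])
  also have "\<dots> = (\<Sum>l'\<le>n. if l' = l then complex_of_real (C l * h l) * sph_harmonic l m x else 0)"
  proof (intro sum.cong refl)
    fix l'
    have "(\<Sum>m' = - int l'..int l'. (\<integral>\<omega>. a l' m' \<omega> * cnj (a l m \<omega>) \<partial>M) *
        (complex_of_real (h l') * sph_harmonic l' m' x)) =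
        (\<Sum>m' = - int l'..int l'. if m' = m then
          (if l' = l then complex_of_real (C l * h l) * sph_harmonic l m x else 0) else 0)"
      using assms by (intro sum.cong refl) (auto simp: coeff_orthogonal)
    also have "\<dots> = (if l' = l then complex_of_real (C l * h l) * sph_harmonic l m x else 0)"
      using assms by (auto simp: sum.delta)
    finally show "(\<Sum>m' = - int l'..int l'. (\<integral>\<omega>. a l' m' \<omega> * cnj (a l m \<omega>) \<partial>M) *
        (complex_of_real (h l') * sph_harmonic l' m' x)) = \<dots>" .
  qed
  also have "\<dots> = (if l \<le> n then complex_of_real (C l * h l) * sph_harmonic l m x else 0)"
    by (simp add: sum.delta)
  finally show ?thesis .
qed

lemma integral_partial_cnj:
  assumes w: "square_integrable M w"
  shows "(\<integral>\<omega>. w \<omega> * cnj (partial n y \<omega>) \<partial>M) =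
    (\<Sum>l\<le>n. \<Sum>m = - int l..int l. (\<integral>\<omega>. w \<omega> * cnj (a l m \<omega>) \<partial>M) * (complex_of_real (h l) * cnj (sph_harmonic l m y)))"
proof -
  have cnj_int: "(\<integral>\<omega>. w \<omega> * cnj (f \<omega>) \<partial>M) = cnj (\<integral>\<omega>. f \<omega> * cnj (w \<omega>) \<partial>M)" for f
    by (rule integral_cnj_product)
  show ?thesis
    unfolding cnj_int integral_partial[OF square_integrable_cnj[OF w]] by simp
qed

lemma integral_partial_partial:
  assumes x: "x \<in> sphere2" and y: "y \<in> sphere2"
  shows "(\<integral>\<omega>. partial n x \<omega> * cnj (partial n y \<omega>) \<partial>M) = complex_of_real
    (\<Sum>l\<le>n. (2 * real l + 1) / (4 * pi) * (C l * (h l)\<^sup>2) * poly (Legendre_poly l) (x \<bullet> y))"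
proof -
  have "(\<integral>\<omega>. partial n x \<omega> * cnj (partial n y \<omega>) \<partial>M) = (\<Sum>l\<le>n. \<Sum>m = - int l..int l.
      (complex_of_real (C l * h l) * sph_harmonic l m x) * (complex_of_real (h l) * cnj (sph_harmonic l m y)))"
    unfolding integral_partial_cnj[OF partial_square_integrable]
    by (intro sum.cong refl) (simp add: integral_partial_coeff)
  also have "\<dots> = (\<Sum>l\<le>n. complex_of_real (C l * (h l)\<^sup>2) *
      (\<Sum>m = - int l..int l. sph_harmonic l m x * cnj (sph_harmonic l m y)))"
    by (simp add: sum_distrib_left power2_eq_square mult_ac)
  also have "\<dots> = complex_of_real
    (\<Sum>l\<le>n. (2 * real l + 1) / (4 * pi) * (C l * (h l)\<^sup>2) * poly (Legendre_poly l) (x \<bullet> y))"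
    unfolding addition_theorem[OF x y] by (simp only: of_real_sum of_real_mult mult_ac)
  finally show ?thesis .
qed

text \<open>The second moments of the partial sums are exact finite sums and pass to mean-square
  limits, so convergence of the series is part of the conclusion.\<close>

lemma conv_covariance_sums:
  assumes x: "x \<in> sphere2" and y: "y \<in> sphere2"
  shows "(\<lambda>l. (2 * real l + 1) / (4 * pi) * (C l * (h l)\<^sup>2) * poly (Legendre_poly l) (x \<bullet> y))
    sums (\<integral>\<omega>. Tc x \<omega> * Tc y \<omega> \<partial>M)"
proof -
  have "(\<lambda>n. \<integral>\<omega>. partial n x \<omega> * cnj (partial n y \<omega>) \<partial>M) \<longlonglongrightarrow>
      (\<integral>\<omega>. complex_of_real (Tc x \<omega>) * cnj (complex_of_real (Tc y \<omega>)) \<partial>M)"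
    by (rule cb_mult.ms_tendsto_integral_product[OF ms_tendsto_partial[OF x] ms_tendsto_cnj[OF ms_tendsto_partial[OF y]]])
  also have "(\<integral>\<omega>. complex_of_real (Tc x \<omega>) * cnj (complex_of_real (Tc y \<omega>)) \<partial>M) =
      complex_of_real (\<integral>\<omega>. Tc x \<omega> * Tc y \<omega> \<partial>M)"
    by (simp flip: of_real_mult add: integral_complex_of_real)
  finally show ?thesis
    unfolding integral_partial_partial[OF x y] tendsto_of_real_iff sums_def_le .
qed

text \<open>The purpose is to apply the existence and moment lemmas to \<open>Tc\<close> in place of
  \<open>T\<close>. The bound \<open>abs_Legendre_poly_le_1\<close> makes the covariance series
  uniformly convergent.\<close>

lemma conv_ms_continuous_field: "ms_continuous_field M Tc"
proof
  show "square_integrable M (Tc x)" if "x \<in> sphere2" for x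
    by (rule conv_square_integrable[OF that])
  let ?\<sigma> = "\<lambda>l. (2 * real l + 1) / (4 * pi) * (C l * (h l)\<^sup>2)"
  have \<sigma>: "0 \<le> ?\<sigma> l" for l
    using C_nonneg[of l] by simp
  \<comment> \<open>All \<open>P_l\<close> have value 1 on the diagonal, so the covariance series at
    a single point, here the north pole, is the series of majorants.\<close>
  have "spherical_point (0, 0) \<bullet> spherical_point (0, 0) = 1"
    using spherical_point_in_sphere[of "(0, 0)"] by (simp add: mem_sphere_0 flip: power2_norm_eq_inner)
  then have summable: "summable ?\<sigma>"
    using conv_covariance_sums[OF spherical_point_in_sphere spherical_point_in_sphere, of "(0, 0)" "(0, 0)"]
    by (simp add: Legendre_poly_1 sums_iff)
  have "uniform_limit (sphere2 \<times> sphere2) (\<lambda>n (x, y). \<Sum>l<n. ?\<sigma> l * poly (Legendre_poly l) (x \<bullet> y))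
      (\<lambda>(x, y). \<Sum>l. ?\<sigma> l * poly (Legendre_poly l) (x \<bullet> y)) sequentially"
    unfolding split_beta
  proof (rule Weierstrass_m_test[OF _ summable])
    fix l and p :: "(real^3) \<times> (real^3)"
    assume "p \<in> sphere2 \<times> sphere2"
    then have "\<bar>poly (Legendre_poly l) (fst p \<bullet> snd p)\<bar> \<le> 1"
      by (intro abs_Legendre_poly_le_1) auto
    then show "norm (?\<sigma> l * poly (Legendre_poly l) (fst p \<bullet> snd p)) \<le> ?\<sigma> l"
      unfolding real_norm_def abs_mult[of "?\<sigma> l"] abs_of_nonneg[OF \<sigma>] by (rule mult_left_le[OF _ \<sigma>])
  qed
  then have "continuous_on (sphere2 \<times> sphere2) (\<lambda>(x, y). \<Sum>l. ?\<sigma> l * poly (Legendre_poly l) (x \<bullet> y))"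
    by (rule uniform_limit_theorem[rotated]) (auto simp: split_beta intro!: always_eventually continuous_intros)
  then show "continuous_on (sphere2 \<times> sphere2) (\<lambda>(x, y). \<integral>\<omega>. Tc x \<omega> * Tc y \<omega> \<partial>M)"
    by (rule continuous_on_cong[OF refl, THEN iffD1, rotated])
      (erule SigmaE, simp only: prod.case sums_unique[OF conv_covariance_sums])
qed

text \<open>
  For a mean-square integral \<open>J\<close> of \<open>Tc * cnj Y_{lm}\<close> and \<open>b = h l * a l m\<close>, the moments
  \<open>E J cnj J\<close>, \<open>E J cnj b\<close> and \<open>E b cnj b\<close> all equal \<open>C l * (h l)\<^sup>2\<close>, so \<open>J = b\<close> almost surely.
\<close>

lemma has_ms_integral_conv_coeff:
  assumes lm: "m \<in> {- int l..int l}"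
  shows "has_ms_integral M (\<lambda>x \<omega>. complex_of_real (Tc x \<omega>) * cnj (sph_harmonic l m x))
    (\<lambda>\<omega>. a l m \<omega> * complex_of_real (h l))"
proof -
  interpret conv: ms_continuous_field M Tc
    by (rule conv_ms_continuous_field)
  obtain J where J: "has_ms_integral M (\<lambda>x \<omega>. Tc x \<omega> *\<^sub>R cnj (sph_harmonic l m x)) J"
    using conv.has_ms_integral_exists[of "\<lambda>x. cnj (sph_harmonic l m x)"]
    by (auto intro!: integrable_continuous_sphere continuous_intros continuous_on_sph_harmonic)
  have J_sq: "square_integrable M J"
    by (rule has_ms_integral_square_integrable[OF J])
  have J_product: "(\<integral>\<omega>. J \<omega> * w \<omega> \<partial>M) =
      (\<integral>x. cnj (sph_harmonic l m x) * (\<integral>\<omega>. Tc x \<omega> *\<^sub>R w \<omega> \<partial>M) \<partial>surface_measure)"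
    if "square_integrable M w" for w
    by (rule has_bochner_integral_integral_eq[symmetric],
        rule conv.has_ms_integral_scaleR[OF cb_mult.contractive_bilinear_axioms J _ that])
      (intro borel_measurable_surface_measureI continuous_intros continuous_on_sph_harmonic)
  have integral_scaled: "(\<integral>x. cnj (sph_harmonic l m x) * (c * sph_harmonic l' m' x) \<partial>surface_measure) =
      (if l = l' \<and> m = m' then c else 0)" if "m' \<in> {- int l'..int l'}" for c l' m'
  proof -
    have "(\<integral>x. cnj (sph_harmonic l m x) * (c * sph_harmonic l' m' x) \<partial>surface_measure) =
        c * (\<integral>x. sph_harmonic l' m' x * cnj (sph_harmonic l m x) \<partial>surface_measure)"
      by (simp only: integral_mult_right_zero[symmetric] mult_ac)
    then show ?thesis
      unfolding sph_harmonic_orthonormal[OF that] by auto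
  qed
  \<comment> \<open>The moments of the partial sums with \<open>a l' m'\<close> are constant from
    \<open>n = l'\<close> on, so the limit can be read off.\<close>
  have conv_coeff: "(\<integral>\<omega>. Tc x \<omega> *\<^sub>R cnj (a l' m' \<omega>) \<partial>M) = complex_of_real (C l' * h l') * sph_harmonic l' m' x"
    if x: "x \<in> sphere2" and "m' \<in> {- int l'..int l'}" for x l' m'
  proof (rule LIMSEQ_unique)
    show "(\<lambda>n. \<integral>\<omega>. partial n x \<omega> * cnj (a l' m' \<omega>) \<partial>M) \<longlonglongrightarrow> (\<integral>\<omega>. Tc x \<omega> *\<^sub>R cnj (a l' m' \<omega>) \<partial>M)"
      unfolding scaleR_conv_of_real
      by (intro cb_mult.ms_tendsto_integral_product ms_tendsto_partial x ms_tendsto_const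
          square_integrable_cnj coeff_square_integrable)
    show "(\<lambda>n. \<integral>\<omega>. partial n x \<omega> * cnj (a l' m' \<omega>) \<partial>M) \<longlonglongrightarrow> complex_of_real (C l' * h l') * sph_harmonic l' m' x"
      by (rule tendsto_eventually) (use that(2) in \<open>auto simp: integral_partial_coeff
          eventually_sequentially intro!: exI[of _ l']\<close>)
  qed
  have J_coeff: "(\<integral>\<omega>. J \<omega> * cnj (a l' m' \<omega>) \<partial>M) = (if l = l' \<and> m = m' then complex_of_real (C l * h l) else 0)"
    if "m' \<in> {- int l'..int l'}" for l' m'
  proof -
    have "(\<integral>\<omega>. J \<omega> * cnj (a l' m' \<omega>) \<partial>M) = (\<integral>x. cnj (sph_harmonic l m x) *
        (complex_of_real (C l' * h l') * sph_harmonic l' m' x) \<partial>surface_measure)"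
      unfolding J_product[OF square_integrable_cnj[OF coeff_square_integrable]]
      by (intro Bochner_Integration.integral_cong refl) (simp add: conv_coeff[OF _ that])
    then show ?thesis
      unfolding integral_scaled[OF that] by auto
  qed
  \<comment> \<open>By \<open>J_coeff\<close> the only coefficient correlated with \<open>J\<close>
    is the one of degree \<open>l\<close> and order \<open>m\<close>, so the expansion of
    \<open>Tc y\<close> contributes a single term.\<close>
  have J_conv: "(\<integral>\<omega>. J \<omega> * complex_of_real (Tc y \<omega>) \<partial>M) =
      complex_of_real (C l * (h l)\<^sup>2) * cnj (sph_harmonic l m y)" if y: "y \<in> sphere2" for y
  proof (rule LIMSEQ_unique)
    show "(\<lambda>n. \<integral>\<omega>. J \<omega> * cnj (partial n y \<omega>) \<partial>M) \<longlonglongrightarrow> (\<integral>\<omega>. J \<omega> * complex_of_real (Tc y \<omega>) \<partial>M)"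
      using cb_mult.ms_tendsto_integral_product[OF ms_tendsto_const[OF J_sq] ms_tendsto_cnj[OF ms_tendsto_partial[OF y]]]
      by simp
    have "(\<integral>\<omega>. J \<omega> * cnj (partial n y \<omega>) \<partial>M) = complex_of_real (C l * (h l)\<^sup>2) * cnj (sph_harmonic l m y)"
      if n: "n \<ge> l" for n
    proof -
      let ?c = "complex_of_real (C l * (h l)\<^sup>2) * cnj (sph_harmonic l m y)"
      have "(\<integral>\<omega>. J \<omega> * cnj (partial n y \<omega>) \<partial>M) = (\<Sum>l'\<le>n. \<Sum>m' = - int l'..int l'.
          if m' = m then (if l' = l then ?c else 0) else 0)"
        unfolding integral_partial_cnj[OF J_sq]
        by (intro sum.cong refl) (auto simp: J_coeff power2_eq_square)
      also have "\<dots> = (\<Sum>l'\<le>n. if l' = l then ?c else 0)"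
        using lm by (intro sum.cong refl) (auto simp: sum.delta)
      also have "\<dots> = ?c"
        using n by (simp add: sum.delta)
      finally show ?thesis .
    qed
    then show "(\<lambda>n. \<integral>\<omega>. J \<omega> * cnj (partial n y \<omega>) \<partial>M) \<longlonglongrightarrow>
        complex_of_real (C l * (h l)\<^sup>2) * cnj (sph_harmonic l m y)"
      by (intro tendsto_eventually) (auto simp: eventually_sequentially)
  qed
  \<comment> \<open>\<open>J\<close> is tested against its own conjugate: the inner moments are
    known from \<open>J_conv\<close>, and orthonormality evaluates their surface integral.\<close>
  have J_J: "(\<integral>\<omega>. J \<omega> * cnj (J \<omega>) \<partial>M) = complex_of_real (C l * (h l)\<^sup>2)"
  proof -
    have "(\<integral>\<omega>. Tc x \<omega> *\<^sub>R cnj (J \<omega>) \<partial>M) = complex_of_real (C l * (h l)\<^sup>2) * sph_harmonic l m x"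
      if "x \<in> sphere2" for x
    proof -
      have "(\<integral>\<omega>. Tc x \<omega> *\<^sub>R cnj (J \<omega>) \<partial>M) = cnj (\<integral>\<omega>. J \<omega> * complex_of_real (Tc x \<omega>) \<partial>M)"
        by (simp only: scaleR_conv_of_real integral_cnj_product[where Y = J] complex_cnj_complex_of_real)
      then show ?thesis
        unfolding J_conv[OF that] by simp
    qed
    then have "(\<integral>\<omega>. J \<omega> * cnj (J \<omega>) \<partial>M) = (\<integral>x. cnj (sph_harmonic l m x) *
        (complex_of_real (C l * (h l)\<^sup>2) * sph_harmonic l m x) \<partial>surface_measure)"
      unfolding J_product[OF square_integrable_cnj[OF J_sq]]
      by (intro Bochner_Integration.integral_cong refl) simp
    then show ?thesis
      unfolding integral_scaled[OF lm] by simp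
  qed
  let ?b = "\<lambda>\<omega>. a l m \<omega> * complex_of_real (h l)"
  have b_sq: "square_integrable M ?b"
    by (intro square_integrable_mult_right coeff_square_integrable)
  have J_b: "(\<integral>\<omega>. J \<omega> * cnj (?b \<omega>) \<partial>M) = complex_of_real (C l * (h l)\<^sup>2)"
  proof -
    have "(\<integral>\<omega>. J \<omega> * cnj (?b \<omega>) \<partial>M) = (\<integral>\<omega>. J \<omega> * cnj (a l m \<omega>) \<partial>M) * complex_of_real (h l)"
      by (simp flip: mult.assoc)
    then show ?thesis
      unfolding J_coeff[OF lm] by (simp add: power2_eq_square)
  qed
  have b_J: "(\<integral>\<omega>. ?b \<omega> * cnj (J \<omega>) \<partial>M) = complex_of_real (C l * (h l)\<^sup>2)"
  proof -
    have "(\<integral>\<omega>. ?b \<omega> * cnj (J \<omega>) \<partial>M) = cnj (\<integral>\<omega>. J \<omega> * cnj (?b \<omega>) \<partial>M)"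
      by (rule integral_cnj_product)
    then show ?thesis
      unfolding J_b by simp
  qed
  have b_b: "(\<integral>\<omega>. ?b \<omega> * cnj (?b \<omega>) \<partial>M) = complex_of_real (C l * (h l)\<^sup>2)"
  proof -
    have "?b \<omega> * cnj (?b \<omega>) = a l m \<omega> * cnj (a l m \<omega>) * complex_of_real ((h l)\<^sup>2)" for \<omega>
      by (simp add: power2_eq_square mult_ac)
    then have "(\<integral>\<omega>. ?b \<omega> * cnj (?b \<omega>) \<partial>M) = (\<integral>\<omega>. a l m \<omega> * cnj (a l m \<omega>) \<partial>M) * complex_of_real ((h l)\<^sup>2)"
      by (simp only: integral_mult_left_zero)
    then show ?thesis
      using coeff_orthogonal[OF lm lm] by simp
  qed
  have "complex_of_real ((ms_norm M (\<lambda>\<omega>. J \<omega> - ?b \<omega>))\<^sup>2) =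
      (\<integral>\<omega>. (J \<omega> * cnj (J \<omega>) - J \<omega> * cnj (?b \<omega>)) - (?b \<omega> * cnj (J \<omega>) - ?b \<omega> * cnj (?b \<omega>)) \<partial>M)"
    unfolding integral_mult_cnj[symmetric]
    by (intro Bochner_Integration.integral_cong refl) (simp add: algebra_simps)
  also have "\<dots> = ((\<integral>\<omega>. J \<omega> * cnj (J \<omega>) \<partial>M) - (\<integral>\<omega>. J \<omega> * cnj (?b \<omega>) \<partial>M)) -
      ((\<integral>\<omega>. ?b \<omega> * cnj (J \<omega>) \<partial>M) - (\<integral>\<omega>. ?b \<omega> * cnj (?b \<omega>) \<partial>M))"
    using cb_mult.integrable_product[OF J_sq square_integrable_cnj[OF J_sq]]
      cb_mult.integrable_product[OF J_sq square_integrable_cnj[OF b_sq]]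
      cb_mult.integrable_product[OF b_sq square_integrable_cnj[OF J_sq]]
      cb_mult.integrable_product[OF b_sq square_integrable_cnj[OF b_sq]]
    by (simp only: Bochner_Integration.integral_diff Bochner_Integration.integrable_diff)
  also have "\<dots> = 0"
    unfolding J_J J_b b_J b_b by simp
  finally have "ms_norm M (\<lambda>\<omega>. J \<omega> - ?b \<omega>) = 0"
    by simp
  from has_ms_integral_cong_AE[OF J b_sq this] show ?thesis
    by (simp add: scaleR_conv_of_real)
qed

end

lemma covariance_zero_mean:
  assumes "(\<integral>\<omega>. X \<omega> \<partial>M) = 0" "(\<integral>\<omega>. Y \<omega> \<partial>M) = 0"
  shows "covariance M X Y = (\<integral>\<omega>. X \<omega> * Y \<omega> \<partial>M)"
  using assms by (simp add: covariance_def)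

theorem theorem10:
  fixes M :: "'w measure"
    and T :: "real^3 \<Rightarrow> 'w \<Rightarrow> real"
    and B H :: "real \<Rightarrow> real"
    and C h :: "nat \<Rightarrow> real"
    and a a_conv :: "nat \<Rightarrow> int \<Rightarrow> 'w \<Rightarrow> complex"
    and T_conv :: "real^3 \<Rightarrow> 'w \<Rightarrow> real"
    and C_conv :: "nat \<Rightarrow> real"
  assumes "prob_space M"
    and "second_order_field M T"
    and "zero_mean_field M T"
    and "continuous_on (sphere2 \<times> sphere2) (\<lambda>(x\<^sub>1, x\<^sub>2). covariance M (T x\<^sub>1) (T x\<^sub>2))"
    and "\<not> (\<lambda>(x\<^sub>1, x\<^sub>2). covariance M (T x\<^sub>1) (T x\<^sub>2)) constant_on (sphere2 \<times> sphere2)"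
    and "isotropic_with M T B"
    and a_def: "a = harmonic_coeff M T"
    and "angular_power_spectrum M a C"
    and "H \<in> borel_measurable (restrict_space borel {0..pi})"
    and "harmonic_representation H h"
    and "Legendre_representation H h"
    and "\<forall>x\<in>sphere2.
           (\<integral>\<^sup>+x\<^sub>1. (\<integral>\<^sup>+x\<^sub>2.
              ennreal \<bar>B (great_circle_dist x\<^sub>1 x\<^sub>2) * H (great_circle_dist x x\<^sub>1)
                * H (great_circle_dist x x\<^sub>2)\<bar>
            \<partial>surface_measure) \<partial>surface_measure) < \<infinity>"
    and T_conv_def: "T_conv = convolved_field M T H"
    and a_conv_def: "a_conv = (\<lambda>l m \<omega>. a l m \<omega> * complex_of_real (h l))"
    and C_conv_def: "C_conv = (\<lambda>l. C l * (h l)\<^sup>2)"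
  shows
    "(\<forall>x\<in>sphere2. has_ms_integral M (\<lambda>x' \<omega>. T x' \<omega> * H (great_circle_dist x x')) (T_conv x)) \<and>
     second_order_field M T_conv \<and>
     zero_mean_field M T_conv \<and>
     isotropic M T_conv \<and>
     (\<forall>x\<in>sphere2.
        ms_tendsto M
          (\<lambda>n \<omega>. \<Sum>l\<le>n. \<Sum>m = - int l..int l. a_conv l m \<omega> * sph_harmonic l m x)
          (\<lambda>\<omega>. complex_of_real (T_conv x \<omega>))) \<and>
     (\<forall>l. \<forall>m\<in>{- int l..int l}.
        has_ms_integral M
          (\<lambda>x \<omega>. complex_of_real (T_conv x \<omega>) * cnj (sph_harmonic l m x)) (a_conv l m) \<and>
        (\<integral>\<omega>. a_conv l m \<omega> \<partial>M) = 0) \<and>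
     angular_power_spectrum M a_conv C_conv \<and>
     (\<forall>x\<^sub>1\<in>sphere2. \<forall>x\<^sub>2\<in>sphere2.
        (\<lambda>l. (2 * real l + 1) / (4 * pi) * C_conv l
               * poly (Legendre_poly l) (cos (great_circle_dist x\<^sub>1 x\<^sub>2)))
          sums covariance M (T_conv x\<^sub>1) (T_conv x\<^sub>2))"
proof -
  have mean: "(\<integral>\<omega>. T x \<omega> \<partial>M) = 0" if "x \<in> sphere2" for x
    using assms(3) that by (simp add: zero_mean_field_def)
  \<comment> \<open>With mean 0, covariances are second moments, the form in which the locale
    demands continuity.\<close>
  have "continuous_on (sphere2 \<times> sphere2) (\<lambda>(x, y). \<integral>\<omega>. T x \<omega> * T y \<omega> \<partial>M)"
    using assms(4) by (rule continuous_on_cong[OF refl, THEN iffD1, rotated])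
      (auto simp: covariance_zero_mean mean)
  then interpret convolution M T H C h
    using assms(1,2,3,8,9,11) unfolding a_def
    by (intro convolution.intro ms_continuous_field.intro ms_continuous_field_axioms.intro
        convolution_axioms.intro) (auto simp: second_order_field_def)
  have cov: "(\<lambda>l. (2 * real l + 1) / (4 * pi) * C_conv l * poly (Legendre_poly l) (cos (great_circle_dist x\<^sub>1 x\<^sub>2)))
      sums covariance M (T_conv x\<^sub>1) (T_conv x\<^sub>2)" if "x\<^sub>1 \<in> sphere2" "x\<^sub>2 \<in> sphere2" for x\<^sub>1 x\<^sub>2
    using conv_covariance_sums[OF that] that
    by (simp add: T_conv_def C_conv_def cos_great_circle_dist covariance_zero_mean zero_mean_conv)
  \<comment> \<open>The witness is the sum of the Legendre series as a function of the angle;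
    \<open>suminf\<close> makes it total, and convergence is known at every distance between two
    points of the sphere.\<close>
  then have "isotropic M T_conv"
    unfolding isotropic_def isotropic_with_def
    by (intro exI[of _ "\<lambda>\<gamma>. \<Sum>l. (2 * real l + 1) / (4 * pi) * C_conv l * poly (Legendre_poly l) (cos \<gamma>)"])
      (simp add: sums_iff)
  moreover have "angular_power_spectrum M a_conv C_conv"
    unfolding angular_power_spectrum_def
  proof (intro allI ballI)
    fix l l' m m' assume lm: "m \<in> {- int l..int l}" "m' \<in> {- int l'..int l'}"
    have "(\<integral>\<omega>. a_conv l m \<omega> * cnj (a_conv l' m' \<omega>) \<partial>M) =
        (\<integral>\<omega>. (a l m \<omega> * cnj (a l' m' \<omega>)) * complex_of_real (h l * h l') \<partial>M)"
      by (simp add: a_conv_def mult_ac)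
    also have "\<dots> = (\<integral>\<omega>. a l m \<omega> * cnj (a l' m' \<omega>) \<partial>M) * complex_of_real (h l * h l')"
      by (rule integral_mult_left_zero)
    finally show "(\<integral>\<omega>. a_conv l m \<omega> * cnj (a_conv l' m' \<omega>) \<partial>M) =
        (if l = l' \<and> m = m' then complex_of_real (C_conv l) else 0)"
      using coeff_orthogonal[OF lm] by (auto simp: a_def C_conv_def power2_eq_square)
  qed
  moreover have "(\<integral>\<omega>. a_conv l m \<omega> \<partial>M) = 0" for l m
    using zero_mean_coeff[of l m] by (simp add: a_conv_def a_def)
  ultimately show ?thesis
    using cov has_ms_integral_conv conv_square_integrable zero_mean_conv ms_tendsto_partial
      has_ms_integral_conv_coeff
    by (simp add: T_conv_def a_conv_def a_def second_order_field_def zero_mean_field_def partial_def[abs_def])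
qed

end
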